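(* Let $\Theta\subseteq\mathbb{R}^p$ be open and let $\mathcal{P}=\{P_\theta:\theta\in\Theta\}\subseteq\mathcal{P}_{2,\mathrm{ac}}(\mathbb{R}^d)$ be differentiable in the Wasserstein sense (DWS), with transport linearization $\Phi_\theta$ and Wasserstein information matrix $J(\theta)$. Let $\chi:\Theta\to\mathbb{R}^k$ be differentiable and let $T_n:(\mathbb{R}^d)^n\to\mathbb{R}^k$ be an unbiased estimator of $\chi(\theta)$, i.e. $\mathbb{E}_\theta[T_n(X_1,\dots,X_n)]=\chi(\theta)$ for all $\theta\in\Theta$, where $X_1,\dots,X_n$ are i.i.d. from $P_\theta$. Suppose: (i) $\theta\mapsto J(\theta)\in\mathbb{R}^{p\times p}$ is continuous and $J(\theta)$ is invertible for all $\theta\in\Theta$; (ii) $\theta\mapsto D\chi(\theta)\in\mathbb{R}^{p\times k}$ is continuous and $D\chi(\theta)$ is injective for all $\theta\in\Theta$; (iii) $\theta\mapsto \mathrm{Cos}_\theta(T_n)\in\mathbb{R}^{k\times k}$ is continuous; (iv) $T_n$ is locally Lipschitz, and for every $\theta\in\Theta$ there is an open neighborhood $U\subseteq\Theta$ of $\theta$ with $\int_U \mathbb{E}_{\theta'}\big[\|D_{x_i}T_n(X_1,\dots,X_n)\|^2\big]\,\mathrm{d}\theta'<\infty$ for all $1\le i\le n$. Then for all $\theta\in\Theta$, $$\mathrm{Cos}_\theta(T_n)\succeq \frac1n (D\chi(\theta))^\top (J(\theta))^{-1} D\chi(\theta)$$ in the positive semidefinite order.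
   Context: Jacobian convention: for $F:\mathbb{R}^a\to\mathbb{R}^b$, $DF(x)\in\mathbb{R}^{a\times b}$, so that $\lim_{t\to0}(F(x+th)-F(x))/t=(DF(x))^\top h$; $D_{x_i}$ denotes the Jacobian with respect to the argument $x_i$; $\|\cdot\|$ on matrices is the Frobenius norm. $\mathcal{P}_{2,\mathrm{ac}}(\mathbb{R}^d)$ is the set of Borel probability measures on $\mathbb{R}^d$ with finite second moment and a Lebesgue density. For $\mu\in\mathcal{P}_{2,\mathrm{ac}}(\mathbb{R}^d)$ and $\nu$ with finite second moment, $\mathbf{t}_{\mu\to\nu}$ is the (a.e. unique) optimal transport map for quadratic cost from $\mu$ to $\nu$. The model is DWS at $\theta$ if there is $\Phi_\theta:\mathbb{R}^d\to\mathbb{R}^{d\times p}$ (the transport linearization) with $\int\|\mathbf{t}_{P_\theta\to P_{\theta+th}}(x)-x-t\Phi_\theta(x)h\|^2\,\mathrm{d}P_\theta(x)=o(t^2)$ as $t\to0$ for every $h\in\mathbb{R}^p$; DWS means DWS at every $\theta$. The Wasserstein information matrix is $J(\theta)=\mathbb{E}_\theta[(\Phi_\theta(X))^\top\Phi_\theta(X)]$, $X\sim P_\theta$. The cosensitivity matrix of $T_n:(\mathbb{R}^d)^n\to\mathbb{R}^k$ is $\mathrm{Cos}_\theta(T_n)=\mathbb{E}_\theta\big[\sum_{i=1}^n (D_{x_i}T_n(X_1,\dots,X_n))^\top D_{x_i}T_n(X_1,\dots,X_n)\big]\in\mathbb{R}^{k\times k}$ with $X_1,\dots,X_n$ i.i.d.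 $P_\theta$. *)

theory Defs
  imports "HOL-Probability.Probability"
begin

definition P2ac :: "(real^'d) measure \<Rightarrow> bool" where
  "P2ac \<mu> \<longleftrightarrow> prob_space \<mu> \<and> sets \<mu> = sets borel \<and>
     integrable \<mu> (\<lambda>x. (norm x)\<^sup>2) \<and> absolutely_continuous lborel \<mu>"

definition coupling :: "(real^'d) measure \<Rightarrow> (real^'d) measure \<Rightarrow> ((real^'d) \<times> (real^'d)) measure \<Rightarrow> bool" where
  "coupling \<mu> \<nu> \<pi> \<longleftrightarrow> prob_space \<pi> \<and> sets \<pi> = sets borel \<and>
     distr \<pi> borel fst = \<mu> \<and> distr \<pi> borel snd = \<nu>"

definition is_ot_map :: "(real^'d) measure \<Rightarrow> (real^'d) measure \<Rightarrow> (real^'d \<Rightarrow> real^'d) \<Rightarrow> bool" where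
  "is_ot_map \<mu> \<nu> T \<longleftrightarrow> T \<in> borel_measurable borel \<and> distr \<mu> borel T = \<nu> \<and>
     (\<forall>\<pi>. coupling \<mu> \<nu> \<pi> \<longrightarrow>
        (\<integral>\<^sup>+x. ennreal ((dist (T x) x)\<^sup>2) \<partial>\<mu>) \<le> (\<integral>\<^sup>+z. ennreal ((dist (fst z) (snd z))\<^sup>2) \<partial>\<pi>))"

(* the (a.e. unique) optimal transport map t_{\<mu>\<rightarrow>\<nu>} *)
definition ot_map :: "(real^'d) measure \<Rightarrow> (real^'d) measure \<Rightarrow> real^'d \<Rightarrow> real^'d" where
  "ot_map \<mu> \<nu> = (SOME T. is_ot_map \<mu> \<nu> T)"

definition transport_lin ::
  "(real^'p \<Rightarrow> (real^'d) measure) \<Rightarrow> real^'p \<Rightarrow> (real^'d \<Rightarrow> real^'p^'d) \<Rightarrow> bool" where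
  "transport_lin P \<theta> \<Phi> \<longleftrightarrow> \<Phi> \<in> borel_measurable borel \<and>
     (\<forall>h. \<forall>\<epsilon>>0. eventually (\<lambda>t.
        (\<integral>\<^sup>+x. ennreal ((norm (ot_map (P \<theta>) (P (\<theta> + t *\<^sub>R h)) x - x - t *\<^sub>R (\<Phi> x *v h)))\<^sup>2) \<partial>(P \<theta>))
          \<le> ennreal (\<epsilon> * t\<^sup>2)) (at 0))"

definition wass_info ::
  "(real^'p \<Rightarrow> (real^'d) measure) \<Rightarrow> (real^'p \<Rightarrow> real^'d \<Rightarrow> real^'p^'d) \<Rightarrow> real^'p \<Rightarrow> real^'p^'p" where
  "wass_info P \<Phi> \<theta> = (\<integral>x. transpose (\<Phi> \<theta> x) ** \<Phi> \<theta> x \<partial>(P \<theta>))"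

definition iid :: "(real^'d) measure \<Rightarrow> (real^'d^'n) measure" where
  "iid \<mu> = distr (Pi\<^sub>M UNIV (\<lambda>_::'n. \<mu>)) borel (\<lambda>\<omega>. vec_lambda \<omega>)"

(* Jacobian convention: for F : R^a \<rightarrow> R^b, DF(x) is the a x b matrix transpose of the derivative matrix *)
definition jac :: "(real^'a \<Rightarrow> real^'b) \<Rightarrow> real^'a \<Rightarrow> real^'b^'a" where
  "jac F x = transpose (matrix (frechet_derivative F (at x)))"

definition partial_jac :: "(real^'d^'n \<Rightarrow> real^'k) \<Rightarrow> 'n \<Rightarrow> real^'d^'n \<Rightarrow> real^'k^'d" where
  "partial_jac T i X =
     (let f = (\<lambda>y. T (\<chi> j. if j = i then y else X $ j))
      in if f differentiable (at (X $ i)) then jac f (X $ i) else 0)"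

definition cos_integrand :: "(real^'d^'n \<Rightarrow> real^'k) \<Rightarrow> real^'d^'n \<Rightarrow> real^'k^'k" where
  "cos_integrand T X = (\<Sum>i\<in>UNIV. transpose (partial_jac T i X) ** partial_jac T i X)"

definition cosens :: "(real^'p \<Rightarrow> (real^'d) measure) \<Rightarrow> (real^'d^'n \<Rightarrow> real^'k) \<Rightarrow> real^'p \<Rightarrow> real^'k^'k" where
  "cosens P T \<theta> = (\<integral>X. cos_integrand T X \<partial>(iid (P \<theta>)))"

definition locally_lipschitz :: "('a::metric_space \<Rightarrow> 'b::metric_space) \<Rightarrow> bool" where
  "locally_lipschitz f \<longleftrightarrow> (\<forall>x. \<exists>e>0. \<exists>L. L-lipschitz_on (ball x e) f)"

definition psd_ge :: "real^'k^'k \<Rightarrow> real^'k^'k \<Rightarrow> bool" where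
  "psd_ge A B \<longleftrightarrow> (\<forall>v. v \<bullet> ((A - B) *v v) \<ge> 0)"

end

(*
  Fix directions h in parameter space and u in the target.  For a bounded Lipschitz F
  the expectation of F under P (theta + t h) is an expectation under P theta of F composed
  coordinatewise with the optimal map, whose displacement is t Phi h + o(t) in L^2.  Applied to
  truncations F of u . T, Rademacher's theorem and Cauchy-Schwarz bound the upper Dini derivative
  of that expectation along h by sqrt (u . Cos u) * sqrt (n * h . J h) plus an error that vanishes
  with the truncation.  A mean value inequality for Dini derivatives and the continuity of Cos
  and J give |u . (D chi)^T h|^2 <= (u . Cos u) (n * h . J h), and h = J^{-1} (D chi) u is optimal.

  ot_map is a choice operator, so the argument needs that optimal maps exist.  This is Brenier's
  theorem, and duality gives it: minimise the sum of the integrals of phi and psi subject to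
  x . y <= phi x + psi y.  Minimising sequences of convex potentials converge
  pointwise, and the first variation at a minimiser says that grad phi pushes mu to nu.
*)

theory Submission
  imports Defs "HOL-Complex_Analysis.Great_Picard"
begin

section \<open>Rademacher's theorem\<close>

text \<open>The remainder of the transport linearization is small only in mean square, so it can be
  pushed through F only if F is globally Lipschitz, while T is merely locally Lipschitz and may be
  unbounded. Truncation repairs this, but nothing bounds the Lipschitz constants of the truncations,
  so the order of limits is forced: t tends to 0 at a fixed truncation, which gives a slope bound
  free of the Lipschitz constant; this bound is integrated along a segment of parameters; only then
  is the truncation removed, from expectations rather than from derivatives, where dominated
  convergence applies. Cutting off at height k over radius k^2 keeps the slope added by the cut-off
  at most 1/k. In the dual problem the potentials are studied on open convex sets A and B of full
  measure, since a convex potential may be infinite elsewhere. Absolute continuity enters twice: it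
  makes the boundary of such a set null, and it turns Lebesgue almost everywhere differentiability
  of \<phi> into differentiability for almost every point of the source measure.\<close>

lemma vitali_emeasure_le:
  fixes M N :: "'a::euclidean_space measure"
  assumes sM: "sets M = sets borel" and sN: "sets N = sets borel"
    and fN: "emeasure N UNIV < \<infinity>" and ac: "absolutely_continuous lborel M"
    and A: "A \<in> sets borel" and c: "c > 0"
    and fine: "\<And>x d. \<lbrakk>x \<in> A; d > 0\<rbrakk> \<Longrightarrow> \<exists>a r. 0 < r \<and> r < d \<and> x \<in> cball a r
                 \<and> emeasure M (cball a r) \<le> ennreal c * emeasure N (cball a r)"
  shows "emeasure M A \<le> ennreal c * emeasure N A"
proof -
  \<comment> \<open>Fine balls inside an open U thin out to countably many disjoint ones that cover
    A up to a Lebesgue null set, which is null for M too; summing their inequalities gives the bound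
    with U on the right. Outer regularity of the finite measure N then shrinks U to A. The balls
    contain x without being centred there, because the intervals to which this is applied have x at
    an arbitrary interior place.\<close>
  have open_le: "emeasure M A \<le> ennreal c * emeasure N U" if U: "open U" "A \<subseteq> U" for U
  proof -
    define K where "K = {(a, r). 0 < r \<and> cball a r \<subseteq> U
        \<and> emeasure M (cball a r) \<le> ennreal c * emeasure N (cball a r)}"
    have ex: "\<exists>i. i \<in> K \<and> x \<in> cball (fst i) (snd i) \<and> snd i < d" if x: "x \<in> A" and d: "0 < d" for x d
    proof -
      obtain e where e: "e > 0" "ball x e \<subseteq> U" using U x by (meson open_contains_ball subsetD)
      obtain a r where ar: "0 < r" "r < min d (e/2)" "x \<in> cball a r"
          "emeasure M (cball a r) \<le> ennreal c * emeasure N (cball a r)"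
        using fine[OF x, of "min d (e/2)"] d e by auto
      have "cball a r \<subseteq> ball x e"
      proof
        fix y assume "y \<in> cball a r"
        then have "dist x y \<le> 2 * r"
          using ar(3) dist_triangle[of x y a] by (simp add: dist_commute)
        then show "y \<in> ball x e" using ar(2) by auto
      qed
      then show ?thesis using ar e by (intro exI[of _ "(a, r)"]) (auto simp: K_def)
    qed
    obtain C where C: "countable C" "C \<subseteq> K"
       "pairwise (\<lambda>i j. disjnt (cball (fst i) (snd i)) (cball (fst j) (snd j))) C"
       "negligible (A - (\<Union>i \<in> C. cball (fst i) (snd i)))"
    proof (rule Vitali_covering_theorem_cballs[of K snd A fst])
      show "0 < snd i" if "i \<in> K" for i using that by (auto simp: K_def)
    qed (use ex in auto)
    let ?B = "\<lambda>i. cball (fst i) (snd i)"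
    have disj: "disjoint_family_on ?B C"
      using C(3) by (auto simp: disjoint_family_on_def pairwise_def disjnt_def)
    have borelU: "(\<Union>i\<in>C. ?B i) \<in> sets borel"
      using C(1) by (intro sets.countable_UN') auto
    have "A - (\<Union>i\<in>C. ?B i) \<in> null_sets lborel"
      using C(4) A borelU by (simp add: negligible_iff_null_sets null_sets_completion_iff)
    then have "A - (\<Union>i\<in>C. ?B i) \<in> null_sets M"
      using ac by (auto simp: absolutely_continuous_def)
    then have z: "emeasure M (A - (\<Union>i\<in>C. ?B i)) = 0" by auto
    have "emeasure M A \<le> emeasure M ((\<Union>i\<in>C. ?B i) \<union> (A - (\<Union>i\<in>C. ?B i)))"
      using A borelU by (intro emeasure_mono) (auto simp: sM)
    also have "\<dots> \<le> emeasure M (\<Union>i\<in>C. ?B i)"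
      using emeasure_subadditive[of "\<Union>i\<in>C. ?B i" M "A - (\<Union>i\<in>C. ?B i)"] A borelU z
      by (simp add: sM)
    also have "\<dots> = (\<integral>\<^sup>+i. emeasure M (?B i) \<partial>count_space C)"
      by (rule emeasure_UN_countable) (use C(1) disj in \<open>auto simp: sM\<close>)
    also have "\<dots> \<le> (\<integral>\<^sup>+i. ennreal c * emeasure N (?B i) \<partial>count_space C)"
      using C(2) by (intro nn_integral_mono) (auto simp: K_def)
    also have "\<dots> = ennreal c * (\<integral>\<^sup>+i. emeasure N (?B i) \<partial>count_space C)"
      by (rule nn_integral_cmult) auto
    also have "(\<integral>\<^sup>+i. emeasure N (?B i) \<partial>count_space C) = emeasure N (\<Union>i\<in>C. ?B i)"
      by (rule emeasure_UN_countable[symmetric]) (use C(1) disj in \<open>auto simp: sN\<close>)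
    also have "\<dots> \<le> emeasure N U"
      using C(2) U by (intro emeasure_mono) (fastforce simp: K_def sN)+
    finally show ?thesis by (simp add: mult_left_mono)
  qed
  have spN: "space N = UNIV" using sN by (metis sets_eq_imp_space_eq space_borel)
  have reg: "emeasure N A = (INF U \<in> {U. A \<subseteq> U \<and> open U}. emeasure N U)"
    by (rule outer_regular) (use sN fN A spN in auto)
  show ?thesis
  proof (rule ennreal_le_epsilon)
    fix e :: real assume e: "0 < e" and fin: "ennreal c * emeasure N A < top"
    have NA: "emeasure N A < \<infinity>"
      using fN emeasure_mono[of A UNIV N] by (metis le_less_trans sN sets.top space_borel spN subset_UNIV)
    have "emeasure N A < emeasure N A + ennreal (e / c)"
      using NA e c by (simp add: ennreal_add_left_cancel_less[of _ 0, simplified])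
    then obtain U where U: "A \<subseteq> U" "open U" "emeasure N U < emeasure N A + ennreal (e / c)"
      using reg by (auto simp: INF_less_iff)
    have "emeasure M A \<le> ennreal c * emeasure N U" using open_le U by blast
    also have "\<dots> \<le> ennreal c * (emeasure N A + ennreal (e / c))"
      using U(3) by (intro mult_left_mono) auto
    also have "\<dots> = ennreal c * emeasure N A + ennreal e"
      using c e by (simp add: distrib_left ennreal_mult[symmetric])
    finally show "emeasure M A \<le> ennreal c * emeasure N A + ennreal e" .
  qed
qed

text \<open>Let \<open>\<nu> A\<close> be the Lebesgue measure of \<open>G ` A\<close>. On a set \<open>A\<close> where arbitrarily short
  intervals have slope below \<open>p\<close> and others have slope above \<open>q\<close>, Vitali's covering theorem gives
  both \<open>\<nu> A \<le> p * \<bar>A\<bar>\<close> and \<open>q * \<bar>A\<bar> \<le> \<nu> A\<close>, so \<open>A\<close> is null if \<open>p < q\<close>.\<close>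

lemma expanding_lipschitz_differentiable_AE:
  fixes G :: "real \<Rightarrow> real"
  assumes lo: "\<And>x y. x \<le> y \<Longrightarrow> y - x \<le> G y - G x"
    and up: "\<And>x y. x \<le> y \<Longrightarrow> G y - G x \<le> C * (y - x)"
  shows "AE x in lborel. G differentiable (at x)"
proof -
  have C1: "C \<ge> 1" using lo[of 0 1] up[of 0 1] by simp
  have Glip: "\<bar>G x - G y\<bar> \<le> C * \<bar>x - y\<bar>" for x y
    using lo[of x y] up[of x y] lo[of y x] up[of y x] by (cases "x \<le> y") (auto simp: abs_if)
  have lipG: "C-lipschitz_on UNIV G"
    using Glip C1 by (intro lipschitz_onI) (auto simp: dist_real_def)
  have contG: "continuous_on UNIV G" using lipG lipschitz_on_continuous_on by blast
  have smono: "strict_mono G" 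
    unfolding strict_mono_def by (smt (verit, best) lo)
  have surj: "\<exists>x. G x = y" for y
  proof -
    define R where "R = \<bar>y - G 0\<bar>"
    have "G (-R) \<le> y" "y \<le> G R" "-R \<le> R"
      using lo[of 0 R] lo[of "-R" 0] by (auto simp: R_def)
    then show ?thesis
      using IVT'[of G "-R" y R] contG continuous_on_subset by blast
  qed
  define k where "k = inv G"
  have Gk: "G (k y) = y" for y unfolding k_def using surj[of y] by (metis f_inv_into_f rangeI)
  have kG: "k (G x) = x" for x unfolding k_def using smono by (simp add: strict_mono_imp_inj_on)
  have "1-lipschitz_on UNIV k"
  proof (rule lipschitz_onI)
    fix x y :: real
    show "dist (k x) (k y) \<le> 1 * dist x y"
      using lo[of "k x" "k y"] lo[of "k y" "k x"] by (simp add: Gk dist_real_def abs_if) linarith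
  qed simp
  then have kmeas[measurable]: "k \<in> borel_measurable borel"
    by (simp add: borel_measurable_continuous_onI lipschitz_on_continuous_on)
  define \<nu> where "\<nu> = distr lborel borel k"
  have \<nu>: "emeasure \<nu> A = emeasure lborel (G ` A)" if "A \<in> sets borel" for A
  proof -
    have "k -` A = G ` A" using Gk kG by (auto simp: image_iff) metis
    then show ?thesis using that by (simp add: \<nu>_def emeasure_distr)
  qed
  have \<nu>I: "emeasure \<nu> (cball a r) = ennreal (G (a + r) - G (a - r))" if "r > 0" for a r
  proof -
    have "k -` cball a r = {G (a - r) .. G (a + r)}"
      using smono Gk by (auto simp: dist_real_def abs_le_iff) (smt (verit) strict_mono_less_eq Gk)+
    then show ?thesis using smono that strict_mono_less_eq[OF smono, of "a-r" "a+r"]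
      by (simp add: \<nu>_def emeasure_distr)
  qed
  have ac\<nu>: "absolutely_continuous lborel \<nu>"
    unfolding absolutely_continuous_def
  proof
    fix A :: "real set" assume A: "A \<in> null_sets lborel"
    then have "negligible A" by (simp add: negligible_iff_null_sets null_sets_completionI)
    then have "negligible (G ` A)"
      by (rule negligible_locally_Lipschitz_image[rotated])
         (use Glip in \<open>auto intro!: exI[of _ UNIV] exI[of _ C]\<close>)
    moreover have "G ` A = k -` A" using Gk kG by (auto simp: image_iff) metis
    moreover have "k -` A \<in> sets borel" using measurable_sets[OF kmeas, of A] null_setsD2[OF A] by simp
    ultimately have "G ` A \<in> null_sets lborel"
      by (simp add: negligible_iff_null_sets null_sets_completion_iff)
    then show "A \<in> null_sets \<nu>" using A \<nu>[of A] by (auto simp: null_sets_def \<nu>_def)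
  qed
  \<comment> \<open>Only intervals with x strictly inside are considered. Each condition at a fixed
    scale then defines an open set, so both families consist of G-delta sets.\<close>
  define Lo where "Lo p = {x. \<forall>d>0. \<exists>a b. a < x \<and> x < b \<and> b - a < d \<and> G b - G a < p * (b - a)}" for p
  define Up where "Up q = {x. \<forall>d>0. \<exists>a b. a < x \<and> x < b \<and> b - a < d \<and> G b - G a > q * (b - a)}" for q
  have Gdelta: "{x. \<forall>d>0. \<exists>a b. a < x \<and> x < b \<and> b - a < d \<and> Q a b} \<in> sets borel" (is "?S \<in> _") for Q :: "real \<Rightarrow> real \<Rightarrow> bool"
  proof -
    have "?S = (\<Inter>n::nat. \<Union>(a,b)\<in>{(a,b). b - a < inverse (real (Suc n)) \<and> Q a b}. {a<..<b})" (is "_ = ?T")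
    proof (rule set_eqI)
      fix x
      have "x \<in> ?S" if "x \<in> ?T"
      proof (clarsimp)
        fix d :: real assume "d > 0"
        then obtain n where "inverse (real (Suc n)) < d" using reals_Archimedean by blast
        then show "\<exists>a<x. \<exists>b>x. b - a < d \<and> Q a b" using that by (simp) (meson order_less_trans)
      qed
      moreover have "x \<in> ?T" if "x \<in> ?S"
      proof 
        fix n
        have "inverse (real (Suc n)) > 0" by simp
        then obtain a b where "a < x \<and> x < b \<and> b - a < inverse (real (Suc n)) \<and> Q a b" using \<open>x \<in> ?S\<close> by blast
        then show "x \<in> (\<Union>(a,b)\<in>{(a,b). b - a < inverse (real (Suc n)) \<and> Q a b}. {a<..<b})" by fastforce
      qed
      ultimately show "x \<in> ?S \<longleftrightarrow> x \<in> ?T" by blast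
    qed
    moreover have "(\<Union>(a,b)\<in>{(a,b). b - a < inverse (real (Suc n)) \<and> Q a b}. {a<..<b}) \<in> sets borel" for n
      by (intro borel_open open_UN) auto
    ultimately show ?thesis by simp
  qed
  have LoUp[measurable]: "Lo p \<in> sets borel" "Up p \<in> sets borel" for p
    unfolding Lo_def Up_def by (rule Gdelta)+
  have null: "Lo p \<inter> Up q \<in> null_sets lborel" if pq: "p < q" for p q
  proof (cases "p \<le> 0")
    case True
    have "x \<notin> Lo p" for x
    proof
      assume "x \<in> Lo p"
      then obtain a b where ab: "a < x" "x < b" "G b - G a < p * (b - a)" unfolding Lo_def using zero_less_one by blast
      moreover have "p * (b - a) \<le> 0" using ab True by (simp add: mult_nonpos_nonneg)
      ultimately show False using lo[of a b] by simp
    qed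
    then have "Lo p = {}" by blast
    then show ?thesis by simp
  next
    case False
    then have p: "p > 0" and q: "q > 0" using pq by auto
    \<comment> \<open>Vitali's comparison takes outer regularity from finite measures, hence the
      restriction of both measures to a bounded interval.\<close>
    have bdd: "Lo p \<inter> Up q \<inter> {-K<..<K} \<in> null_sets lborel" for K :: real
    proof -
      let ?I = "{-K<..<K}"
      let ?A = "Lo p \<inter> Up q \<inter> ?I"
      define M where "M = density lborel (indicator ?I)"
      define N where "N = density \<nu> (indicator ?I)"
      have sets: "sets M = sets borel" "sets N = sets borel" by (auto simp: M_def N_def \<nu>_def)
      have M: "emeasure M A = emeasure lborel (A \<inter> ?I)" if "A \<in> sets borel" for A
        unfolding M_def using that by (subst emeasure_restricted) (auto simp: Int_commute)
      have N: "emeasure N A = emeasure \<nu> (A \<inter> ?I)" if "A \<in> sets borel" for A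
        unfolding N_def using that by (subst emeasure_restricted) (auto simp: Int_commute \<nu>_def)
      have Mfin: "emeasure M UNIV < \<infinity>" by (cases "-K \<le> K") (simp_all add: M)
      have "emeasure \<nu> ?I \<le> emeasure \<nu> (cball 0 (max K 1))"
        by (intro emeasure_mono) (auto simp: \<nu>_def dist_real_def)
      then have Nfin: "emeasure N UNIV < \<infinity>" by (simp add: N \<nu>I) (metis ennreal_less_top le_less_trans)
      have acM: "absolutely_continuous lborel M" "absolutely_continuous lborel N"
        unfolding absolutely_continuous_def
      proof safe
        fix A :: "real set" assume A: "A \<in> null_sets lborel"
        have A\<nu>: "A \<in> null_sets \<nu>" using ac\<nu> A by (auto simp: absolutely_continuous_def)
        have AB: "A \<in> sets borel" using null_setsD2[OF A] by simp
        show "A \<in> null_sets M" "A \<in> null_sets N"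
          using null_set_Int2[OF A, of ?I] null_set_Int2[OF A\<nu>, of ?I] AB sets
          by (auto intro!: null_setsI simp: M N Int_commute \<nu>_def dest!: null_setsD1)
      qed
      have fineM: "\<exists>a' r. 0 < r \<and> r < d \<and> x \<in> cball a' r \<and> Q (a' - r) (a' + r) \<and> cball a' r \<subseteq> ?I"
        if x: "\<forall>d>0. \<exists>a b. a < x \<and> x < b \<and> b - a < d \<and> Q a b" "x \<in> ?I" and d: "d > 0" for x d Q
      proof -
        define e where "e = min d (min (K - x) (x + K))"
        have "e > 0" using x d by (auto simp: e_def)
        then obtain a b where ab: "a < x" "x < b" "b - a < e" "Q a b" using x by blast
        show ?thesis
        proof (rule exI[of _ "(a + b)/2"], rule exI[of _ "(b - a)/2"], intro conjI)
          have "(a + b)/2 - (b-a)/2 = a" "(a + b)/2 + (b-a)/2 = b" by (auto simp: field_simps)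
          then show "Q ((a + b)/2 - (b-a)/2) ((a + b)/2 + (b-a)/2)" using ab(4) by metis
        qed (use ab in \<open>auto simp: e_def dist_real_def abs_if field_simps split: if_splits\<close>)
      qed
      have "emeasure N ?A \<le> ennreal p * emeasure M ?A"
      proof (rule vitali_emeasure_le[OF sets(2,1) Mfin acM(2) _ p])
        fix x d :: real assume "x \<in> ?A" "d > 0"
        then obtain a r where ar: "0 < r" "r < d" "x \<in> cball a r" "G (a+r) - G (a-r) < p * (a + r - (a-r))" "cball a r \<subseteq> ?I"
          using fineM[of x "\<lambda>a b. G b - G a < p * (b - a)" d] by (auto simp: Lo_def)
        then have i: "cball a r \<inter> ?I = cball a r" by blast
        have lb: "emeasure lborel (cball a r) = ennreal (2 * r)"
          using ar(1) by (simp add: cball_eq_atLeastAtMost)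
        have "emeasure N (cball a r) \<le> ennreal p * emeasure M (cball a r)"
          using ar p lb by (simp add: M N i \<nu>I ennreal_mult[symmetric] ennreal_leI del: cball_eq_atLeastAtMost)
        then show "\<exists>a r. 0 < r \<and> r < d \<and> x \<in> cball a r \<and> emeasure N (cball a r) \<le> ennreal p * emeasure M (cball a r)"
          using ar by blast
      qed auto
      moreover have "emeasure M ?A \<le> ennreal (1/q) * emeasure N ?A"
      proof (rule vitali_emeasure_le[OF sets Nfin acM(1)])
        fix x d :: real assume "x \<in> ?A" "d > 0"
        then obtain a r where ar: "0 < r" "r < d" "x \<in> cball a r" "G (a+r) - G (a-r) > q * (a + r - (a-r))" "cball a r \<subseteq> ?I"
          using fineM[of x "\<lambda>a b. G b - G a > q * (b - a)" d] by (auto simp: Up_def)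
        then have i: "cball a r \<inter> ?I = cball a r" by blast
        have lb: "emeasure lborel (cball a r) = ennreal (2 * r)"
          using ar(1) by (simp add: cball_eq_atLeastAtMost)
        have "2 * r \<le> 1/q * (G (a+r) - G (a-r))" using ar q by (simp add: field_simps)
        then have "emeasure M (cball a r) \<le> ennreal (1/q) * emeasure N (cball a r)"
          using ar q i lo[of "a-r" "a+r"] lb by (simp add: M N i \<nu>I ennreal_mult[symmetric] ennreal_leI del: times_divide_eq_left cball_eq_atLeastAtMost)
        then show "\<exists>a r. 0 < r \<and> r < d \<and> x \<in> cball a r \<and> emeasure M (cball a r) \<le> ennreal (1/q) * emeasure N (cball a r)"
          using ar by blast
      qed (use q in auto)
      ultimately have "emeasure M ?A \<le> ennreal (1/q) * (ennreal p * emeasure M ?A)"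
        by (meson mult_left_mono order_trans zero_le)
      then have *: "emeasure M ?A \<le> ennreal (p/q) * emeasure M ?A"
        using p q by (simp add: mult.assoc[symmetric] ennreal_mult[symmetric])
      have "emeasure M ?A < \<infinity>" using Mfin emeasure_mono[of ?A UNIV M] sets by (metis le_less_trans sets.top sets_eq_imp_space_eq space_borel subset_UNIV)
      then obtain r where r: "emeasure M ?A = ennreal r" "r \<ge> 0" by (metis ennreal_cases less_irrefl infinity_ennreal_def)
      have "r \<le> p/q * r" using * r p q by (simp add: ennreal_mult[symmetric])
      then have "r = 0" using r(2) p q pq by (smt (verit) divide_less_eq_1_pos mult_le_cancel_right1 mult_right_mono)
      then have "emeasure lborel ?A = 0" using r M[of ?A] by (simp add: Int_assoc)
      then show ?thesis by (intro null_setsI) auto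
    qed
    have "Lo p \<inter> Up q = (\<Union>n::nat. Lo p \<inter> Up q \<inter> {-real n<..<real n})"
    proof -
      have "\<exists>n::nat. - real n < x \<and> x < real n" for x :: real
        using reals_Archimedean2[of "\<bar>x\<bar>"] by (auto simp: abs_less_iff) (metis minus_less_iff)
      then show ?thesis by auto
    qed
    then show ?thesis using null_sets_UN[OF bdd, of real] by simp
  qed
  have "(\<Union>(p,q)\<in>{(p,q). p \<in> \<rat> \<and> q \<in> \<rat> \<and> p < q}. Lo p \<inter> Up q) \<in> null_sets lborel"
  proof (rule null_sets_UN')
    have "{(p,q). p \<in> \<rat> \<and> q \<in> \<rat> \<and> p < (q::real)} \<subseteq> \<rat> \<times> \<rat>" by auto
    then show "countable {(p,q). p \<in> \<rat> \<and> q \<in> \<rat> \<and> p < (q::real)}" by (rule countable_subset) (intro countable_SIGMA countable_rat)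
  qed (use null in auto)
  then show ?thesis
  proof (rule AE_I')
    show "{x \<in> space lborel. \<not> G differentiable at x} \<subseteq> (\<Union>(p,q)\<in>{(p,q). p \<in> \<rat> \<and> q \<in> \<rat> \<and> p < q}. Lo p \<inter> Up q)" (is "_ \<subseteq> ?Bad")
    proof
      fix x assume "x \<in> {x \<in> space lborel. \<not> G differentiable at x}"
      then have nd: "\<not> G differentiable at x" by simp
      show "x \<in> ?Bad"
      proof (rule ccontr)
        assume nb: "x \<notin> ?Bad"
        \<comment> \<open>The infimum l of S is the upper derivative of G over intervals around x.
          Off the bad set no rational pair separates upper from lower slopes, so all short intervals
          around x have slope close to l.\<close>
        define S where "S = {q. x \<notin> Up q}"
        have CS: "C \<in> S"
        proof (unfold S_def, clarify)
          assume "x \<in> Up C" 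
          then obtain a b where "a < x" "x < b" "G b - G a > C * (b - a)" unfolding Up_def using zero_less_one by blast
          then show False using up[of a b] by simp
        qed
        have UpI: "x \<in> Up q" if "q < 1" for q
          unfolding Up_def
        proof clarify
          fix d :: real assume "d > 0"
          define a b where "a = x - d/3" and "b = x + d/3"
          have ab: "a < x" "x < b" "b - a < d" "b - a \<le> G b - G a"
            using lo[of a b] \<open>d > 0\<close> by (auto simp: a_def b_def)
          have "q * (b - a) < 1 * (b - a)" using ab that by (intro mult_strict_right_mono) auto
          also have "\<dots> \<le> G b - G a" using ab(4) by simp
          finally show "\<exists>a b. a < x \<and> x < b \<and> b - a < d \<and> G b - G a > q * (b - a)" using ab by blast
        qed
        have bddS: "bdd_below S" using UpI by (intro bdd_belowI[of _ 1]) (force simp: S_def)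
        have anti: "x \<in> Up q" if "x \<in> Up q'" "q \<le> q'" for q q'
        proof -
          have "q * (b - a) \<le> q' * (b - a)" if "a < b" for a b using \<open>q \<le> q'\<close> that by (simp add: mult_right_mono)
          then show ?thesis using that(1) unfolding Up_def by (smt (verit, best) mem_Collect_eq)
        qed
        define l where "l = Inf S"
        have upl: "x \<notin> Up q" if ql: "q > l" for q
        proof -
          have "S \<noteq> {}" using CS by blast
          then obtain q' where "q' \<in> S" "q' < q" using ql cInf_less_iff[OF _ bddS, of q] unfolding l_def by blast
          then show ?thesis using anti by (auto simp: S_def)
        qed
        have lol: "x \<notin> Lo p" if p: "p < l" for p
        proof
          assume "x \<in> Lo p"
          obtain p' where p': "p' \<in> \<rat>" "p < p'" "p' < l" using Rats_dense_in_real[OF p] by blast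
          obtain q' where q': "q' \<in> \<rat>" "p' < q'" "q' < l" using Rats_dense_in_real[OF p'(3)] by blast
          have "p * (b - a) \<le> p' * (b - a)" if "a < b" for a b using p' that by (simp add: mult_right_mono)
          then have "x \<in> Lo p'" using \<open>x \<in> Lo p\<close> unfolding Lo_def by (smt (verit, best) mem_Collect_eq)
          moreover have "x \<in> Up q'" 
          proof (rule ccontr)
            assume "x \<notin> Up q'"
            then have "l \<le> q'" unfolding l_def by (intro cInf_lower bddS) (simp add: S_def)
            then show False using q' by simp
          qed
          ultimately show False using nb p' q' by auto
        qed
        have "(G has_real_derivative l) (at x)"
          unfolding has_field_derivative_iff LIM_def
        proof (clarify)
          fix e :: real assume e: "e > 0"
          obtain d1 where d1: "d1 > 0" "\<And>a b. a < x \<Longrightarrow> x < b \<Longrightarrow> b - a < d1 \<Longrightarrow> G b - G a \<le> (l + e/2) * (b - a)"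
            using upl[of "l + e/2"] e unfolding Up_def by simp (meson not_less)
          obtain d2 where d2: "d2 > 0" "\<And>a b. a < x \<Longrightarrow> x < b \<Longrightarrow> b - a < d2 \<Longrightarrow> G b - G a \<ge> (l - e/2) * (b - a)"
            using lol[of "l - e/2"] e unfolding Lo_def by simp (meson not_less)
          define d where "d = min d1 d2"
          have d: "d > 0" "\<And>a b. a < x \<Longrightarrow> x < b \<Longrightarrow> b - a < d \<Longrightarrow> \<bar>G b - G a - l * (b - a)\<bar> \<le> e/2 * (b - a)"
          proof -
            fix a b assume ab: "a < x" "x < b" "b - a < d"
            have "G b - G a \<le> (l + e/2) * (b - a)" "G b - G a \<ge> (l - e/2) * (b - a)"
              using ab by (auto intro!: d1(2) d2(2) simp: d_def)
            then show "\<bar>G b - G a - l * (b - a)\<bar> \<le> e/2 * (b - a)"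
              unfolding abs_le_iff distrib_right left_diff_distrib by linarith
          qed (use d1 d2 in \<open>simp add: d_def\<close>)
          have Gc: "(G \<longlongrightarrow> G x) (at x within A)" for A
            using contG by (metis continuous_on_def tendsto_within_subset UNIV_I subset_UNIV)
          \<comment> \<open>An interval with x strictly inside becomes one with endpoint x by
            letting the other endpoint tend to x; continuity of G preserves the estimate.\<close>
          have right: "\<bar>G b - G x - l * (b - x)\<bar> \<le> e/2 * (b - x)" if "x < b" "b - x < d" for b
          proof (rule tendsto_le[where F="at_left x"])
            show "((\<lambda>a. e/2 * (b - a)) \<longlongrightarrow> e/2 * (b - x)) (at_left x)" by (intro tendsto_intros)
            show "((\<lambda>a. \<bar>G b - G a - l * (b - a)\<bar>) \<longlongrightarrow> \<bar>G b - G x - l * (b - x)\<bar>) (at_left x)"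
              by (intro tendsto_intros Gc)
            show "eventually (\<lambda>a. \<bar>G b - G a - l * (b - a)\<bar> \<le> e/2 * (b - a)) (at_left x)"
              unfolding eventually_at_left_field using d(2) that by (intro exI[of _ "b - d"]) auto
          qed simp
          have left: "\<bar>G x - G a - l * (x - a)\<bar> \<le> e/2 * (x - a)" if "a < x" "x - a < d" for a
          proof (rule tendsto_le[where F="at_right x"])
            show "((\<lambda>b. e/2 * (b - a)) \<longlongrightarrow> e/2 * (x - a)) (at_right x)" by (intro tendsto_intros)
            show "((\<lambda>b. \<bar>G b - G a - l * (b - a)\<bar>) \<longlongrightarrow> \<bar>G x - G a - l * (x - a)\<bar>) (at_right x)"
              by (intro tendsto_intros Gc)
            show "eventually (\<lambda>b. \<bar>G b - G a - l * (b - a)\<bar> \<le> e/2 * (b - a)) (at_right x)"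
              unfolding eventually_at_right_field using d(2) that by (intro exI[of _ "a + d"]) auto
          qed simp
          show "\<exists>s>0. \<forall>y. y \<noteq> x \<and> dist y x < s \<longrightarrow> dist ((G y - G x) / (y - x)) l < e"
          proof (intro exI[of _ d] conjI allI impI d(1))
            fix y assume y: "y \<noteq> x \<and> dist y x < d"
            have "\<bar>G y - G x - l * (y - x)\<bar> \<le> e/2 * \<bar>y - x\<bar>"
            proof (cases "x < y")
              case True then show ?thesis using right[of y] y by (simp add: dist_real_def)
            next
              case False then show ?thesis using left[of y] y by (simp add: dist_real_def abs_if algebra_simps split: if_splits)
            qed
            moreover have "(G y - G x) / (y - x) - l = (G y - G x - l * (y - x)) / (y - x)"
              using y by (simp add: field_simps)
            ultimately have "\<bar>(G y - G x) / (y - x) - l\<bar> \<le> e/2" using y by (simp add: abs_divide divide_le_eq)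
            then show "dist ((G y - G x) / (y - x)) l < e" using e by (simp add: dist_real_def)
          qed
        qed
        then show False using nd real_differentiable_def by blast
      qed
    qed
  qed
qed

text \<open>Adding \<open>(L + 1) * x\<close> moves all slopes from [-L, L] into [1, 2 L + 1] and
  does not affect differentiability.\<close>

lemma lipschitz_real_differentiable_AE:
  fixes g :: "real \<Rightarrow> real"
  assumes "L-lipschitz_on UNIV g"
  shows "AE x in lborel. g differentiable (at x)"
proof -
  have *: "\<bar>g x - g y\<bar> \<le> L * \<bar>x - y\<bar>" for x y
    using lipschitz_onD[OF assms, of x y] by (simp add: dist_real_def)
  have "AE x in lborel. (\<lambda>x. g x + (L + 1) * x) differentiable (at x)"
  proof (rule expanding_lipschitz_differentiable_AE[where C = "2 * L + 1"])
    fix x y :: real assume "x \<le> y"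
    then show "y - x \<le> g y + (L + 1) * y - (g x + (L + 1) * x)"
      "g y + (L + 1) * y - (g x + (L + 1) * x) \<le> (2 * L + 1) * (y - x)"
      using *[of x y] by (auto simp: algebra_simps abs_le_iff)
  qed
  moreover have "g differentiable (at x)" if "(\<lambda>x. g x + (L + 1) * x) differentiable (at x)" for x
  proof -
    have "(\<lambda>x. (g x + (L + 1) * x) - (L + 1) * x) differentiable (at x)"
      by (rule differentiable_diff[OF that]) simp
    then show ?thesis by (simp only: add_diff_cancel_right')
  qed
  ultimately show ?thesis by (auto elim: eventually_mono)
qed

section \<open>Directional derivatives of Lipschitz functions\<close>

definition has_dir_deriv :: "('a::real_normed_vector \<Rightarrow> real) \<Rightarrow> 'a \<Rightarrow> 'a \<Rightarrow> real \<Rightarrow> bool" where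
  "has_dir_deriv f v x l \<longleftrightarrow> ((\<lambda>t. (f (x + t *\<^sub>R v) - f x) / t) \<longlongrightarrow> l) (at 0)"

text \<open>A limit along the steps 1/(n+1) is total and Borel measurable in x, and it agrees with
  the directional derivative wherever that exists.\<close>

definition dir_deriv :: "('a::real_normed_vector \<Rightarrow> real) \<Rightarrow> 'a \<Rightarrow> 'a \<Rightarrow> real" where
  "dir_deriv f v x = lim (\<lambda>n. real (Suc n) * (f (x + (1 / real (Suc n)) *\<^sub>R v) - f x))"

lemma has_dir_deriv_seq:
  assumes "has_dir_deriv f v x l"
  shows "(\<lambda>n. real (Suc n) * (f (x + (1 / real (Suc n)) *\<^sub>R v) - f x)) \<longlonglongrightarrow> l"
proof -
  have "filterlim (\<lambda>n. 1 / real (Suc n)) (at 0) sequentially"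
    unfolding filterlim_at using LIMSEQ_inverse_real_of_nat by (simp add: field_simps)
  from filterlim_compose[OF assms[unfolded has_dir_deriv_def] this] show ?thesis by (simp add: mult.commute)
qed

lemma dir_deriv_eq:
  assumes "has_dir_deriv f v x l"
  shows "dir_deriv f v x = l"
  unfolding dir_deriv_def by (rule limI[OF has_dir_deriv_seq[OF assms]])

lemma has_dir_deriv_scaleR:
  assumes "has_dir_deriv f v x l"
  shows "has_dir_deriv f (c *\<^sub>R v) x (c * l)"
proof (cases "c = 0")
  case True then show ?thesis by (simp add: has_dir_deriv_def)
next
  case False
  have "filterlim (\<lambda>t. t * c) (at 0) (at 0)"
    using False by (auto simp: filterlim_at eventually_at_filter intro!: tendsto_eq_intros)
  from filterlim_compose[OF assms[unfolded has_dir_deriv_def] this]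
  have "((\<lambda>t. c * ((f (x + (t * c) *\<^sub>R v) - f x) / (t * c))) \<longlongrightarrow> c * l) (at 0)"
    by (intro tendsto_intros)
  then show ?thesis using False unfolding has_dir_deriv_def by simp
qed

text \<open>The points where the difference quotients are Cauchy form a Borel set E. On every line
  in direction v the one-dimensional result puts almost all points in E, and Fubini collects the
  lines. Averaging over translates by s v avoids a change of coordinates that would align v with an
  axis.\<close>

lemma lipschitz_has_dir_deriv_AE:
  fixes f :: "'a::euclidean_space \<Rightarrow> real"
  assumes lip: "L-lipschitz_on UNIV f"
  shows "AE x in lborel. has_dir_deriv f v x (dir_deriv f v x)"
proof -
  have cont: "continuous_on UNIV f" using lip lipschitz_on_continuous_on by blast
  define q where "q x t = (f (x + t *\<^sub>R v) - f x) / t" for x t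
  \<comment> \<open>For a fixed tolerance and range this is an intersection of closed conditions on
    x, one for each pair s, t. Existence of the limit thus becomes a countable combination of closed
    sets.\<close>
  define Cl where "Cl e m = {x. \<forall>s t. 0 < \<bar>s\<bar> \<longrightarrow> \<bar>s\<bar> < m \<longrightarrow> 0 < \<bar>t\<bar> \<longrightarrow> \<bar>t\<bar> < m \<longrightarrow> \<bar>q x s - q x t\<bar> \<le> e}" for e m :: real
  have clo: "closed (Cl e m)" for e m
      proof -
    have "continuous_on UNIV (\<lambda>x. q x t)" for t
      unfolding q_def divide_inverse by (intro continuous_intros continuous_on_compose2[OF cont]) auto
    then show ?thesis
      unfolding Cl_def by (intro closed_Collect_all closed_Collect_imp closed_Collect_le open_Collect_const continuous_intros) simp_all
  qed
  define E where "E = (\<Inter>k::nat. \<Union>m::nat. Cl (1 / real (Suc k)) (1 / real (Suc m)))"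
  have E[measurable]: "E \<in> sets borel" unfolding E_def using clo by (intro sets.countable_INT sets.countable_UN borel_closed) auto
  have EI: "x \<in> E" if ql: "((\<lambda>t. q x t) \<longlongrightarrow> l) (at 0)" for x l
    unfolding E_def
  proof
    fix k :: nat
    obtain d where d: "d > 0" "\<And>t. t \<noteq> 0 \<Longrightarrow> \<bar>t\<bar> < d \<Longrightarrow> \<bar>q x t - l\<bar> < 1 / real (Suc k) / 2"
      using LIM_D[OF ql, of "1 / real (Suc k) / 2"] by auto
    obtain m where m: "1 / real (Suc m) < d" using d(1) reals_Archimedean[of d] by (auto simp: inverse_eq_divide)
    have "\<bar>q x s - q x t\<bar> \<le> 1 / real (Suc k)" if "0 < \<bar>s\<bar>" "\<bar>s\<bar> < 1 / real (Suc m)" "0 < \<bar>t\<bar>" "\<bar>t\<bar> < 1 / real (Suc m)" for s t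
    proof -
      have "\<bar>q x s - l\<bar> < 1 / real (Suc k) / 2" "\<bar>q x t - l\<bar> < 1 / real (Suc k) / 2" using d(2)[of s] d(2)[of t] that m by auto
      moreover have "\<bar>q x s - q x t\<bar> \<le> \<bar>q x s - l\<bar> + \<bar>q x t - l\<bar>" by linarith
      ultimately have "\<bar>q x s - q x t\<bar> < 1 / real (Suc k) / 2 + 1 / real (Suc k) / 2" by (meson add_strict_mono le_less_trans)
      then show ?thesis by (simp only: field_sum_of_halves less_imp_le)
    qed
    then have "x \<in> Cl (1 / real (Suc k)) (1 / real (Suc m))" unfolding Cl_def by blast
    then show "x \<in> (\<Union>m. Cl (1 / real (Suc k)) (1 / real (Suc m)))" by blast
  qed
  have ED: "\<exists>l. has_dir_deriv f v x l" if xE: "x \<in> E" for x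
  proof -
    have ex: "\<exists>d>0. \<forall>s t. 0 < \<bar>s\<bar> \<longrightarrow> \<bar>s\<bar> < d \<longrightarrow> 0 < \<bar>t\<bar> \<longrightarrow> \<bar>t\<bar> < d \<longrightarrow> \<bar>q x s - q x t\<bar> \<le> e" if e0: "e > 0" for e
    proof -
      obtain k where k: "1 / real (Suc k) < e" using reals_Archimedean[OF e0] by (auto simp: inverse_eq_divide simp del: of_nat_Suc)
      obtain m where "x \<in> Cl (1 / real (Suc k)) (1 / real (Suc m))" using xE unfolding E_def by blast
      then show ?thesis using k unfolding Cl_def by (intro exI[of _ "1 / real (Suc m)"]) fastforce
    qed
    let ?s = "\<lambda>n. 1 / real (Suc n)"
    have s0: "?s \<longlonglongrightarrow> 0" using LIMSEQ_inverse_real_of_nat by (simp add: field_simps)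
    have evs: "eventually (\<lambda>n. ?s n < d) sequentially" if "d > 0" for d using order_tendstoD(2)[OF s0 that] .
    have "Cauchy (\<lambda>n. q x (?s n))"
    proof (rule metric_CauchyI)
      fix e :: real assume "e > 0"
      then obtain d where d: "d > 0" "\<And>s t. 0 < \<bar>s\<bar> \<Longrightarrow> \<bar>s\<bar> < d \<Longrightarrow> 0 < \<bar>t\<bar> \<Longrightarrow> \<bar>t\<bar> < d \<Longrightarrow> \<bar>q x s - q x t\<bar> \<le> e/2"
        using ex[of "e/2"] by auto
      obtain N where N: "\<And>n. n \<ge> N \<Longrightarrow> ?s n < d" using evs[OF d(1)] unfolding eventually_sequentially by blast
      show "\<exists>M. \<forall>m\<ge>M. \<forall>n\<ge>M. dist (q x (?s m)) (q x (?s n)) < e"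
      proof (intro exI[of _ N] allI impI)
        fix m n assume "m \<ge> N" "n \<ge> N"
        then have "\<bar>q x (?s m) - q x (?s n)\<bar> \<le> e/2" using N by (intro d(2)) (auto simp del: of_nat_Suc)
        then show "dist (q x (?s m)) (q x (?s n)) < e" using \<open>e > 0\<close> by (simp add: dist_real_def)
      qed
    qed
    then obtain l where l: "(\<lambda>n. q x (?s n)) \<longlonglongrightarrow> l" using Cauchy_convergent convergent_def by blast
    have "((\<lambda>t. q x t) \<longlongrightarrow> l) (at 0)"
      unfolding LIM_def
    proof (intro allI impI)
      fix e :: real assume "e > 0"
      then obtain d where d: "d > 0" "\<And>s t. 0 < \<bar>s\<bar> \<Longrightarrow> \<bar>s\<bar> < d \<Longrightarrow> 0 < \<bar>t\<bar> \<Longrightarrow> \<bar>t\<bar> < d \<Longrightarrow> \<bar>q x s - q x t\<bar> \<le> e/2"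
        using ex[of "e/2"] by auto
      have "dist (q x t) l < e" if "t \<noteq> 0" "dist t 0 < d" for t
      proof -
        have "\<bar>q x t - l\<bar> \<le> e/2"
        proof (rule tendsto_upperbound)
          show "(\<lambda>n. \<bar>q x t - q x (?s n)\<bar>) \<longlonglongrightarrow> \<bar>q x t - l\<bar>" by (intro tendsto_intros l)
          show "\<forall>\<^sub>F n in sequentially. \<bar>q x t - q x (?s n)\<bar> \<le> e/2"
            using evs[OF d(1)]
          proof eventually_elim
            fix n assume "?s n < d"
            then show "\<bar>q x t - q x (?s n)\<bar> \<le> e/2" using that by (intro d(2)) (auto simp del: of_nat_Suc)
          qed
        qed simp
        then show ?thesis using \<open>e > 0\<close> by (simp add: dist_real_def)
      qed
      then show "\<exists>s>0. \<forall>t. t \<noteq> 0 \<and> dist t 0 < s \<longrightarrow> dist (q x t) l < e" using d(1) by blast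
    qed
    then show ?thesis unfolding has_dir_deriv_def q_def by blast
  qed
  have line: "AE s in lborel. x + s *\<^sub>R v \<in> E" for x
  proof -
    have "(L * norm v)-lipschitz_on UNIV (\<lambda>s. f (x + s *\<^sub>R v))"
    proof (rule lipschitz_onI)
      fix s t :: real
      have "dist (f (x + s *\<^sub>R v)) (f (x + t *\<^sub>R v)) \<le> L * dist (x + s *\<^sub>R v) (x + t *\<^sub>R v)"
        by (rule lipschitz_onD[OF lip]) auto
      also have "dist (x + s *\<^sub>R v) (x + t *\<^sub>R v) = norm v * dist s t"
        by (simp add: dist_norm dist_real_def scaleR_diff_left[symmetric])
      finally show "dist (f (x + s *\<^sub>R v)) (f (x + t *\<^sub>R v)) \<le> L * norm v * dist s t" by (simp add: mult.assoc)
    qed (use lip in \<open>auto dest: lipschitz_on_nonneg\<close>)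
    then have "AE s in lborel. (\<lambda>s. f (x + s *\<^sub>R v)) differentiable (at s)" by (rule lipschitz_real_differentiable_AE)
    then show ?thesis
    proof (eventually_elim)
      fix s assume "(\<lambda>s. f (x + s *\<^sub>R v)) differentiable (at s)"
      then obtain l where "((\<lambda>s. f (x + s *\<^sub>R v)) has_field_derivative l) (at s)" using real_differentiableE by blast
      then have "((\<lambda>h. (f (x + (s + h) *\<^sub>R v) - f (x + s *\<^sub>R v)) / h) \<longlongrightarrow> l) (at 0)" unfolding DERIV_def .
      then have "((\<lambda>t. q (x + s *\<^sub>R v) t) \<longlongrightarrow> l) (at 0)" unfolding q_def by (simp add: scaleR_add_left add.assoc)
      then show "x + s *\<^sub>R v \<in> E" by (rule EI)
    qed
  qed
  have N[measurable]: "- E \<in> sets borel" by auto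
  \<comment> \<open>By translation invariance the measure of the complement equals its average over
    the shifts by s v with s in [0, 1]; after exchanging the integrals the inner one runs along a
    line, where it vanishes.\<close>
  have "emeasure lborel (- E) = (\<integral>\<^sup>+s. indicator {0..1::real} s * emeasure lborel (- E) \<partial>lborel)"
    by (simp add: nn_integral_multc)
  also have "\<dots> = (\<integral>\<^sup>+s. (\<integral>\<^sup>+x. indicator {0..1} s * indicator (- E) (x + s *\<^sub>R v) \<partial>(lborel :: 'a measure)) \<partial>lborel)"
  proof (rule nn_integral_cong)
    fix s :: real
    have "emeasure lborel (- E) = (\<integral>\<^sup>+x. indicator (- E) x \<partial>distr lborel borel ((+) (s *\<^sub>R v)))"
      by (simp add: lborel_distr_plus)
    also have "\<dots> = (\<integral>\<^sup>+x. indicator (- E) (x + s *\<^sub>R v) \<partial>lborel)"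
      by (subst nn_integral_distr) (auto simp: add.commute)
    finally show "indicator {0..1} s * emeasure lborel (- E) = (\<integral>\<^sup>+x. indicator {0..1} s * indicator (- E) (x + s *\<^sub>R v) \<partial>lborel)"
      by (simp add: nn_integral_cmult)
  qed
  also have "\<dots> = (\<integral>\<^sup>+x. (\<integral>\<^sup>+s. indicator {0..1::real} s * indicator (- E) (x + s *\<^sub>R v) \<partial>lborel) \<partial>(lborel :: 'a measure))"
  proof (rule lborel_pair.Fubini'[symmetric])
    have "(\<lambda>z. indicator {0..1::real} (fst z) * indicator (- E) (snd z + fst z *\<^sub>R v) :: ennreal) \<in> borel_measurable (lborel \<Otimes>\<^sub>M (lborel :: 'a measure))"
    proof (rule borel_measurable_times_ennreal)
      have "indicator (- E) \<in> (borel :: 'a measure) \<rightarrow>\<^sub>M (borel :: ennreal measure)" by (rule borel_measurable_indicator[OF N])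
      then show "(\<lambda>z. indicator (- E) (snd z + fst z *\<^sub>R v) :: ennreal) \<in> borel_measurable (lborel \<Otimes>\<^sub>M (lborel :: 'a measure))"
        unfolding lborel_prod measurable_lborel2
        by (rule measurable_compose[rotated]) (intro borel_measurable_continuous_onI continuous_intros)
    qed measurable
    then show "(\<lambda>(s, x). indicator {0..1::real} s * indicator (- E) (x + s *\<^sub>R v) :: ennreal) \<in> borel_measurable (lborel \<Otimes>\<^sub>M (lborel :: 'a measure))"
      by (simp add: case_prod_beta')
  qed
  also have "\<dots> = (\<integral>\<^sup>+x. 0 \<partial>(lborel :: 'a measure))"
  proof (rule nn_integral_cong)
    fix x :: 'a
    have "(\<integral>\<^sup>+s. indicator {0..1::real} s * indicator (- E) (x + s *\<^sub>R v) \<partial>lborel) = (\<integral>\<^sup>+s. 0 \<partial>(lborel :: real measure))"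
      by (rule nn_integral_cong_AE) (use line[of x] in eventually_elim, auto)
    then show "(\<integral>\<^sup>+s. indicator {0..1::real} s * indicator (- E) (x + s *\<^sub>R v) \<partial>lborel) = (0::ennreal)" by simp
  qed
  finally have "- E \<in> null_sets lborel" by (intro null_setsI) auto
  then show ?thesis
  proof (rule AE_I')
    show "{x \<in> space lborel. \<not> has_dir_deriv f v x (dir_deriv f v x)} \<subseteq> - E"
      using ED dir_deriv_eq by fastforce
  qed
qed

lemma lipschitz_quotient_bound:
  fixes f :: "'a::euclidean_space \<Rightarrow> real"
  assumes lip: "L-lipschitz_on UNIV f"
  shows "\<bar>real (Suc n) * (f (x + (1 / real (Suc n)) *\<^sub>R v) - f x)\<bar> \<le> L * norm v"
proof -
  have "\<bar>f (x + (1 / real (Suc n)) *\<^sub>R v) - f x\<bar> \<le> L * norm ((1 / real (Suc n)) *\<^sub>R v)"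
    using lipschitz_onD[OF lip, of "x + (1 / real (Suc n)) *\<^sub>R v" x] by (simp add: dist_norm)
  then show ?thesis by (simp add: abs_mult divide_simps mult.commute)
qed

text \<open>The function \<open>(w x + K) / K\<close> is nonnegative almost everywhere and, as a
  density, gives every box its Lebesgue volume. So it is a density of Lebesgue measure itself, and
  uniqueness of densities makes it 1 almost everywhere.\<close>

lemma lborel_zero_box_integrals:
  fixes w :: "'a::euclidean_space \<Rightarrow> real"
  assumes [measurable]: "w \<in> borel_measurable borel" and K: "K > 0" "AE x in lborel. \<bar>w x\<bar> \<le> K"
    and 0: "\<And>l u. (\<integral>x. indicator (box l u) x * w x \<partial>lborel) = 0"
  shows "AE x in lborel. w x = 0"
proof -
  let ?g = "\<lambda>x. ennreal ((w x + K) / K)"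
  have "lborel = density lborel ?g"
  proof (rule lborel_eqI)
    fix l u :: 'a assume lu: "\<And>b. b \<in> Basis \<Longrightarrow> l \<bullet> b \<le> u \<bullet> b"
    have ib: "integrable lborel (\<lambda>x. indicator (box l u) x :: real)" by (simp add: lu)
    have iw: "integrable lborel (\<lambda>x. indicator (box l u) x * w x)"
      by (rule Bochner_Integration.integrable_bound[of _ "\<lambda>x. K * indicator (box l u) x"])
         (use K(2) ib in \<open>auto elim!: eventually_mono split: split_indicator intro: order_trans[OF _ abs_ge_self]\<close>)
    have "emeasure (density lborel ?g) (box l u) = (\<integral>\<^sup>+x. ?g x * indicator (box l u) x \<partial>lborel)"
      by (rule emeasure_density) auto
    also have "\<dots> = (\<integral>\<^sup>+x. ennreal (indicator (box l u) x * w x / K + indicator (box l u) x) \<partial>lborel)"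
      using K(1) by (intro nn_integral_cong) (auto split: split_indicator simp: field_simps)
    also have "\<dots> = ennreal (\<integral>x. indicator (box l u) x * w x / K + indicator (box l u) x \<partial>lborel)"
    proof (rule nn_integral_eq_integral)
      show "AE x in lborel. 0 \<le> indicator (box l u) x * w x / K + indicator (box l u) x"
        using K(2) by eventually_elim (use K(1) in \<open>auto split: split_indicator simp: field_simps\<close>)
    qed (intro Bochner_Integration.integrable_add integrable_divide iw ib)
    also have "(\<integral>x. indicator (box l u) x * w x / K + indicator (box l u) x \<partial>lborel) = (\<Prod>b\<in>Basis. (u - l) \<bullet> b)"
      by (subst Bochner_Integration.integral_add) (use iw ib 0 lu in \<open>auto simp: measure_lborel_box_eq\<close>)
    finally show "emeasure (density lborel ?g) (box l u) = ennreal (\<Prod>b\<in>Basis. (u - l) \<bullet> b)" .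
  qed simp
  then have "density lborel ?g = density lborel (\<lambda>_. 1)" by (simp add: density_1)
  then have "AE x in lborel. ?g x = 1" using sigma_finite_measure.density_unique[OF sigma_finite_lborel, of ?g "\<lambda>_. 1"] by simp
  then show ?thesis by eventually_elim (use K(1) in \<open>auto simp: ennreal_eq_1 field_simps\<close>)
qed

lemma dir_deriv_measurable [measurable]:
  fixes f :: "'a::euclidean_space \<Rightarrow> real"
  assumes [measurable]: "f \<in> borel_measurable borel"
  shows "dir_deriv f v \<in> borel_measurable borel"
proof -
  have "(\<lambda>x. real (Suc n) * (f (x + (1 / real (Suc n)) *\<^sub>R v) - f x)) \<in> borel_measurable borel" for n by measurable
  then show ?thesis unfolding dir_deriv_def[abs_def] by (rule borel_measurable_lim_metric)
qed

text \<open>Integrated over a box, the second difference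
  \<open>f (x + s (u + v)) - f (x + s u) - f (x + s v) + f x\<close> divided by \<open>s\<close> equals the integral of a
  bounded difference quotient over the symmetric difference of the box and its translate by
  \<open>s u\<close>, which shrinks to a null set.\<close>

lemma dir_deriv_add_AE:
  fixes f :: "'a::euclidean_space \<Rightarrow> real"
  assumes lip: "L-lipschitz_on UNIV f"
  shows "AE x in lborel. dir_deriv f (u + v) x = dir_deriv f u x + dir_deriv f v x"
proof -
  have [measurable]: "f \<in> borel_measurable borel"
    using lip lipschitz_on_continuous_on borel_measurable_continuous_onI by blast
  have L0: "L \<ge> 0" using lip lipschitz_on_nonneg by blast
  define a where "a v n x = real (Suc n) * (f (x + (1 / real (Suc n)) *\<^sub>R v) - f x)" for v n x
  have [measurable]: "a v n \<in> borel_measurable borel" for v n unfolding a_def by measurable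
  have ab: "\<bar>a v n x\<bar> \<le> L * norm v" for v n x unfolding a_def by (rule lipschitz_quotient_bound[OF lip])
  have alim: "AE x in lborel. (\<lambda>n. a v n x) \<longlonglongrightarrow> dir_deriv f v x" for v
    using lipschitz_has_dir_deriv_AE[OF lip, of v] by eventually_elim (unfold a_def, rule has_dir_deriv_seq)
  define w where "w x = dir_deriv f (u + v) x - dir_deriv f u x - dir_deriv f v x" for x
  have [measurable]: "w \<in> borel_measurable borel" unfolding w_def by measurable
  define c where "c n x = a (u + v) n x - a u n x - a v n x" for n x
  have [measurable]: "c n \<in> borel_measurable borel" for n unfolding c_def by measurable
  define K where "K = L * norm (u + v) + L * norm u + L * norm v + 1"
  have K: "K > 0" using L0 by (auto simp: K_def intro!: add_nonneg_pos)
  have cK: "\<bar>c n x\<bar> \<le> K" for n x using ab[of "u+v" n x] ab[of u n x] ab[of v n x] unfolding c_def K_def by linarith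
  have clim: "AE x in lborel. (\<lambda>n. c n x) \<longlonglongrightarrow> w x"
    using alim[of "u+v"] alim[of u] alim[of v] unfolding c_def w_def by eventually_elim (intro tendsto_intros)
  have wK: "AE x in lborel. \<bar>w x\<bar> \<le> K"
    using clim
  proof eventually_elim
    fix x assume "(\<lambda>n. c n x) \<longlonglongrightarrow> w x"
    then have "(\<lambda>n. \<bar>c n x\<bar>) \<longlonglongrightarrow> \<bar>w x\<bar>" by (intro tendsto_intros)
    then show "\<bar>w x\<bar> \<le> K" by (rule LIMSEQ_le_const2) (use cK in auto)
  qed
  have shift: "c n x = a v n (x + (1 / real (Suc n)) *\<^sub>R u) - a v n x" for n x
    unfolding c_def a_def by (simp add: algebra_simps)
  have box0: "(\<integral>x. indicator (box l r) x * w x \<partial>lborel) = 0" for l r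
  proof -
    have l1: "(\<lambda>n. \<integral>x. indicator (box l r) x * c n x \<partial>lborel) \<longlonglongrightarrow> (\<integral>x. indicator (box l r) x * w x \<partial>lborel)"
    proof (rule integral_dominated_convergence[where w = "\<lambda>x. K * indicator (box l r) x"])
      show "AE x in lborel. (\<lambda>n. indicator (box l r) x * c n x) \<longlonglongrightarrow> indicator (box l r) x * w x"
        using clim by eventually_elim (intro tendsto_intros)
      show "integrable lborel (\<lambda>x. K * indicator (box l r) x)" 
        using emeasure_lborel_box_finite[of l r] by (intro integrable_mult_right integrable_real_indicator) auto
    qed (use cK in \<open>auto split: split_indicator\<close>)
    let ?B = "\<lambda>n x. indicator (box l r) (x - (1 / real (Suc n)) *\<^sub>R u) :: real"
    obtain R where R: "R > 0" "box l r \<subseteq> ball 0 R" using bounded_box[of l r] bounded_subset_ballD by blast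
    define W where "W = ball (0::'a) (R + norm u)"
    have Wi: "integrable lborel (\<lambda>x. k * indicator W x :: real)" for k unfolding W_def
      using emeasure_lborel_ball_finite[of "0::'a" "R + norm u"] by (intro integrable_mult_right integrable_real_indicator) auto
    have inW: "x \<in> W" if "x - (1 / real (Suc n)) *\<^sub>R u \<in> box l r" for x n
    proof -
      have "norm (x - (1 / real (Suc n)) *\<^sub>R u) < R" using that R by auto
      moreover have "norm ((1 / real (Suc n)) *\<^sub>R u) \<le> norm u" by (simp add: divide_simps distrib_left)
      ultimately show ?thesis unfolding W_def using norm_triangle_ineq2[of x "(1 / real (Suc n)) *\<^sub>R u"] by simp
    qed
    have inW': "box l r \<subseteq> W" 
    proof
      fix x assume "x \<in> box l r"
      then have "norm x < R" using R by auto
      then show "x \<in> W" unfolding W_def mem_ball_0 using norm_ge_zero[of u] by linarith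
    qed
    have aB: "integrable lborel (\<lambda>x. ?B n x * a v n x)" "integrable lborel (\<lambda>x. indicator (box l r) x * a v n x)" for n
      by (rule Bochner_Integration.integrable_bound[OF Wi[of "L * norm v"]];
          use ab L0 inW inW' in \<open>auto split: split_indicator\<close>)+
    have eq: "(\<integral>x. indicator (box l r) x * c n x \<partial>lborel) = (\<integral>x. (?B n x - indicator (box l r) x) * a v n x \<partial>lborel)" for n
    proof -
      let ?s = "(1 / real (Suc n)) *\<^sub>R u"
      have "(\<integral>x. indicator (box l r) x * a v n (x + ?s) \<partial>lborel) = (\<integral>x. ?B n (?s + x) * a v n (?s + x) \<partial>lborel)"
        by (simp add: add.commute)
      also have "\<dots> = (\<integral>x. ?B n x * a v n x \<partial>distr lborel borel ((+) ?s))"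
        by (rule integral_distr[symmetric]) auto
      also have "\<dots> = (\<integral>x. ?B n x * a v n x \<partial>lborel)" by (simp add: lborel_distr_plus)
      finally have 1: "(\<integral>x. indicator (box l r) x * a v n (x + ?s) \<partial>lborel) = (\<integral>x. ?B n x * a v n x \<partial>lborel)" .
      have i1: "integrable lborel (\<lambda>x. indicator (box l r) x * a v n (x + ?s))"
        by (rule Bochner_Integration.integrable_bound[OF Wi[of "L * norm v"]]) 
           (use ab L0 inW' in \<open>auto split: split_indicator\<close>)
      show ?thesis
        unfolding shift right_diff_distrib left_diff_distrib
        by (subst (1 2) Bochner_Integration.integral_diff) (use 1 i1 aB in auto)
    qed
    have l2: "(\<lambda>n. \<integral>x. (?B n x - indicator (box l r) x) * a v n x \<partial>lborel) \<longlonglongrightarrow> (\<integral>x. 0 \<partial>(lborel :: 'a measure))"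
    proof (rule integral_dominated_convergence[where w = "\<lambda>x. (L * norm v) * indicator W x"])
      show "AE x in lborel. norm ((?B n x - indicator (box l r) x) * a v n x) \<le> L * norm v * indicator W x" for n
        using ab[of v n] L0 inW inW' by (auto split: split_indicator)
      \<comment> \<open>Off the boundary, a point is eventually in the shifted box exactly when it
        is in the box, so the integrand is eventually 0.\<close>
      have "negligible (frontier (box l r))" by (intro negligible_convex_frontier convex_box)
      then have "frontier (box l r) \<in> null_sets lborel"
        by (simp add: negligible_iff_null_sets null_sets_completion_iff)
      then have "AE x in lborel. x \<notin> frontier (box l r)" by (rule AE_not_in)
      then show "AE x in lborel. (\<lambda>n. (?B n x - indicator (box l r) x) * a v n x) \<longlonglongrightarrow> 0"
      proof eventually_elim
        fix x assume x: "x \<notin> frontier (box l r)"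
        have "(\<lambda>n. x - (1 / real (Suc n)) *\<^sub>R u) \<longlonglongrightarrow> x - 0 *\<^sub>R u"
          using LIMSEQ_inverse_real_of_nat by (intro tendsto_intros) (simp add: inverse_eq_divide)
        then have lx: "(\<lambda>n. x - (1 / real (Suc n)) *\<^sub>R u) \<longlonglongrightarrow> x" by simp
        have "x \<in> box l r \<or> x \<in> - closure (box l r)" using x by (auto simp: frontier_def interior_open open_box)
        then have "eventually (\<lambda>n. ?B n x = indicator (box l r) x) sequentially"
        proof
          assume "x \<in> box l r"
          with topological_tendstoD[OF lx open_box, of l r] show ?thesis by (auto elim!: eventually_mono simp del: of_nat_Suc)
        next
          assume i: "x \<in> - closure (box l r)"
          have "x \<notin> box l r" using i closure_subset by blast
          moreover have "eventually (\<lambda>n. x - (1 / real (Suc n)) *\<^sub>R u \<in> - closure (box l r)) sequentially"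
            using topological_tendstoD[OF lx, of "- closure (box l r)"] i by auto
          ultimately show ?thesis using closure_subset[of "box l r"] by (auto elim!: eventually_mono split: split_indicator simp del: of_nat_Suc)
        qed
        then show "(\<lambda>n. (?B n x - indicator (box l r) x) * a v n x) \<longlonglongrightarrow> 0"
          by (intro tendsto_eventually) (auto elim: eventually_mono)
      qed
    qed (use Wi in auto)
    show ?thesis using LIMSEQ_unique[OF l1[unfolded eq] l2] by simp
  qed
  have "AE x in lborel. w x = 0" by (rule lborel_zero_box_integrals[OF _ K wK box0]) simp
  then show ?thesis by eventually_elim (simp add: w_def)
qed

lemma dir_deriv_linear_AE:
  fixes f :: "'a::euclidean_space \<Rightarrow> real"
  assumes lip: "L-lipschitz_on UNIV f"
  shows "AE x in lborel. dir_deriv f v x = (\<Sum>b\<in>Basis. (v \<bullet> b) * dir_deriv f b x)"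
proof -
  have "AE x in lborel. dir_deriv f (\<Sum>b\<in>S. (v \<bullet> b) *\<^sub>R b) x = (\<Sum>b\<in>S. (v \<bullet> b) * dir_deriv f b x)"
    if "finite S" for S :: "'a set"
    using that
  proof induction
    case empty
    have "dir_deriv f 0 x = 0" for x by (rule dir_deriv_eq) (simp add: has_dir_deriv_def)
    then show ?case by simp
  next
    case (insert b S)
    have "AE x in lborel. has_dir_deriv f b x (dir_deriv f b x)" by (rule lipschitz_has_dir_deriv_AE[OF lip])
    moreover have "AE x in lborel. dir_deriv f ((v \<bullet> b) *\<^sub>R b + (\<Sum>b\<in>S. (v \<bullet> b) *\<^sub>R b)) x =
        dir_deriv f ((v \<bullet> b) *\<^sub>R b) x + dir_deriv f (\<Sum>b\<in>S. (v \<bullet> b) *\<^sub>R b) x"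
      by (rule dir_deriv_add_AE[OF lip])
    ultimately show ?case using insert.IH
      by eventually_elim (use insert.hyps in \<open>simp add: dir_deriv_eq[OF has_dir_deriv_scaleR]\<close>)
  qed
  from this[of Basis] show ?thesis by (simp add: euclidean_representation)
qed

text \<open>By compactness of the sphere, finitely many of the given directions come close to every
  unit vector. For finitely many directions the quotients converge uniformly, and the Lipschitz
  bound carries the estimate to the neighbouring directions.\<close>

lemma lipschitz_differentiable_if_dense_dir_derivs:
  fixes f :: "'a::euclidean_space \<Rightarrow> real"
  assumes lip: "L-lipschitz_on UNIV f"
    and dense: "\<And>U. open U \<Longrightarrow> U \<noteq> {} \<Longrightarrow> \<exists>d\<in>Q. d \<in> (U::'a set)"
    and Q: "\<And>v. v \<in> Q \<Longrightarrow> has_dir_deriv f v x (v \<bullet> G)"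
  shows "(f has_derivative (\<lambda>h. h \<bullet> G)) (at x)"
  unfolding has_derivative_at_alt
proof (intro conjI allI impI bounded_linear_inner_left)
  fix e :: real assume e: "0 < e"
  have L0: "L \<ge> 0" using lip lipschitz_on_nonneg by blast
  define K where "K = L + norm G + 1"
  have K: "K > 0" using L0 by (auto simp: K_def intro: add_nonneg_pos)
  \<comment> \<open>Replacing a unit vector z by v within \<eta> costs at most (L + |G|) \<eta> t,
    which is at most half of e t; the other half is spent on the direction v.\<close>
  define \<eta> where "\<eta> = e / (2 * K)"
  have \<eta>: "\<eta> > 0" using e K by (simp add: \<eta>_def)
  have cover: "sphere 0 1 \<subseteq> (\<Union>v\<in>Q. ball v \<eta>)"
  proof
    fix y :: 'a
    obtain v where "v \<in> Q" "v \<in> ball y \<eta>" using dense[of "ball y \<eta>"] \<eta> by auto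
    then show "y \<in> (\<Union>v\<in>Q. ball v \<eta>)" by (auto simp: dist_commute)
  qed
  have "compact (sphere (0::'a) 1)" by simp
  from compactE_image[OF this _ cover] obtain F where F: "F \<subseteq> Q" "finite F" "sphere 0 1 \<subseteq> (\<Union>v\<in>F. ball v \<eta>)" by auto
  have "\<exists>d>0. \<forall>t. 0 < t \<longrightarrow> t < d \<longrightarrow> \<bar>f (x + t *\<^sub>R v) - f x - t * (v \<bullet> G)\<bar> \<le> e/2 * t" if "v \<in> F" for v
  proof -
    have "has_dir_deriv f v x (v \<bullet> G)" using that F Q by blast
    then obtain d where d: "d > 0" "\<And>t. t \<noteq> 0 \<Longrightarrow> \<bar>t\<bar> < d \<Longrightarrow> \<bar>(f (x + t *\<^sub>R v) - f x) / t - v \<bullet> G\<bar> < e/2"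
      unfolding has_dir_deriv_def using e LIM_D[of "\<lambda>t. (f (x + t *\<^sub>R v) - f x) / t" "v \<bullet> G" 0 "e/2"] by auto
    have "\<bar>f (x + t *\<^sub>R v) - f x - t * (v \<bullet> G)\<bar> \<le> e/2 * t" if "0 < t" "t < d" for t
    proof -
      have "\<bar>f (x + t *\<^sub>R v) - f x - t * (v \<bullet> G)\<bar> = t * \<bar>(f (x + t *\<^sub>R v) - f x) / t - v \<bullet> G\<bar>"
        using that by (simp add: abs_mult_pos' [symmetric] field_simps)
      also have "\<dots> \<le> t * (e/2)" using that d(2)[of t] by (intro mult_left_mono) auto
      finally show ?thesis by (simp add: mult.commute)
    qed
    then show ?thesis using d(1) by blast
  qed
  then obtain \<delta> where \<delta>: "\<And>v. v \<in> F \<Longrightarrow> \<delta> v > 0"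
      "\<And>v t. v \<in> F \<Longrightarrow> 0 < t \<Longrightarrow> t < \<delta> v \<Longrightarrow> \<bar>f (x + t *\<^sub>R v) - f x - t * (v \<bullet> G)\<bar> \<le> e/2 * t" by metis
  define d where "d = Min (insert 1 (\<delta> ` F))"
  have d: "d > 0" "\<And>v. v \<in> F \<Longrightarrow> d \<le> \<delta> v" unfolding d_def using F(2) \<delta>(1) by auto
  have "norm (f y - f x - (y - x) \<bullet> G) \<le> e * norm (y - x)" if y: "norm (y - x) < d" for y
  proof (cases "y = x")
    case False
    define t where "t = norm (y - x)"
    define z where "z = (1 / t) *\<^sub>R (y - x)"
    have t: "t > 0" "t < d" using False y by (auto simp: t_def)
    have yz: "y = x + t *\<^sub>R z" using t by (simp add: z_def)
    have "z \<in> sphere 0 1" using t by (simp add: z_def t_def)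
    then obtain v where v: "v \<in> F" "norm (z - v) < \<eta>" using F(3) by (auto simp: dist_norm norm_minus_commute)
    have 1: "\<bar>f (x + t *\<^sub>R z) - f (x + t *\<^sub>R v)\<bar> \<le> L * (t * norm (z - v))"
      using lipschitz_onD[OF lip, of "x + t *\<^sub>R z" "x + t *\<^sub>R v"] t
      by (simp add: dist_norm scaleR_diff_right[symmetric])
    have 2: "\<bar>f (x + t *\<^sub>R v) - f x - t * (v \<bullet> G)\<bar> \<le> e/2 * t" using \<delta>(2)[OF v(1) t(1)] t d(2)[OF v(1)] by simp
    have "\<bar>(v - z) \<bullet> G\<bar> \<le> norm (z - v) * norm G" using Cauchy_Schwarz_ineq2[of "v - z" G] by (simp add: norm_minus_commute)
    then have 3: "\<bar>t * (v \<bullet> G) - t * (z \<bullet> G)\<bar> \<le> t * (norm (z - v) * norm G)"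
      using t by (simp add: inner_diff_left right_diff_distrib[symmetric] abs_mult)
    have "L * (t * norm (z - v)) + t * (norm (z - v) * norm G) = t * (norm (z - v) * (L + norm G))" by (simp add: algebra_simps)
    also have "\<dots> \<le> t * (\<eta> * K)" using t v \<eta> L0 unfolding K_def by (intro mult_left_mono mult_mono) auto
    also have "\<dots> = e/2 * t" using K by (simp add: \<eta>_def)
    finally have 4: "L * (t * norm (z - v)) + t * (norm (z - v) * norm G) \<le> e/2 * t" .
    have "(y - x) \<bullet> G = t * (z \<bullet> G)" by (simp add: yz)
    then have "norm (f y - f x - (y - x) \<bullet> G) \<le> e * t" using 1 2 3 4 unfolding yz real_norm_def by linarith
    then show ?thesis by (simp add: t_def)
  qed simp
  then show "\<exists>d>0. \<forall>y. norm (y - x) < d \<longrightarrow> norm (f y - f x - (y - x) \<bullet> G) \<le> e * norm (y - x)" using d(1) by blast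
qed

lemma lipschitz_differentiable_AE:
  fixes f :: "'a::euclidean_space \<Rightarrow> real"
  assumes lip: "L-lipschitz_on UNIV f"
  shows "AE x in lborel. f differentiable (at x)"
proof -
  obtain Q :: "'a set" where Q: "countable Q" "\<And>U. open U \<Longrightarrow> U \<noteq> {} \<Longrightarrow> \<exists>d\<in>Q. d \<in> U"
    using countable_dense_setE by blast
  have "AE x in lborel. \<forall>v\<in>Q. has_dir_deriv f v x (\<Sum>b\<in>Basis. (v \<bullet> b) * dir_deriv f b x)"
    unfolding AE_ball_countable[OF Q(1)]
  proof
    fix v
    show "AE x in lborel. has_dir_deriv f v x (\<Sum>b\<in>Basis. (v \<bullet> b) * dir_deriv f b x)"
      using lipschitz_has_dir_deriv_AE[OF lip, of v] dir_deriv_linear_AE[OF lip, of v] by eventually_elim simp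
  qed
  then show ?thesis
  proof eventually_elim
    fix x assume x: "\<forall>v\<in>Q. has_dir_deriv f v x (\<Sum>b\<in>Basis. (v \<bullet> b) * dir_deriv f b x)"
    have "v \<bullet> (\<Sum>b\<in>Basis. dir_deriv f b x *\<^sub>R b) = (\<Sum>b\<in>Basis. (v \<bullet> b) * dir_deriv f b x)" for v
      by (simp add: inner_sum_right mult.commute)
    then have "(f has_derivative (\<lambda>h. h \<bullet> (\<Sum>b\<in>Basis. dir_deriv f b x *\<^sub>R b))) (at x)"
      using x by (intro lipschitz_differentiable_if_dense_dir_derivs[OF lip Q(2)]) auto
    then show "f differentiable (at x)" unfolding differentiable_def by blast
  qed
qed

text \<open>McShane's infimum of cones. It lets a function that is Lipschitz on a ball be treated as
  globally Lipschitz without changing it on the ball.\<close>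

lemma lipschitz_extension:
  fixes f :: "'a::metric_space \<Rightarrow> real"
  assumes lip: "L-lipschitz_on B f"
  obtains g where "L-lipschitz_on UNIV g" "\<And>x. x \<in> B \<Longrightarrow> g x = f x"
proof (cases "B = {}")
  case True
  have "L \<ge> 0" using lip lipschitz_on_nonneg by blast
  then show ?thesis using that[of "\<lambda>_. 0"] True by (auto simp: lipschitz_on_def)
next
  case False
  then obtain z0 where z0: "z0 \<in> B" by blast
  have L0: "L \<ge> 0" using lip lipschitz_on_nonneg by blast
  have *: "\<bar>f x - f y\<bar> \<le> L * dist x y" if "x \<in> B" "y \<in> B" for x y
    using lipschitz_onD[OF lip that] by (simp add: dist_real_def)
  define g where "g y = (INF z\<in>B. f z + L * dist y z)" for y
  have bdd: "bdd_below ((\<lambda>z. f z + L * dist y z) ` B)" for y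
  proof (rule bdd_belowI2[of _ "f z0 - L * dist y z0"])
    fix z assume z: "z \<in> B"
    have "L * dist z0 z \<le> L * (dist y z0 + dist y z)" using L0 dist_triangle3[of z0 z y] by (intro mult_left_mono) auto
    then show "f z0 - L * dist y z0 \<le> f z + L * dist y z" using *[OF z0 z] by (simp add: algebra_simps)
  qed
  have le: "g x \<le> g y + L * dist x y" for x y
  proof -
    have "g x - L * dist x y \<le> g y" unfolding g_def[of y]
    proof (rule cINF_greatest[OF False])
      fix z assume z: "z \<in> B"
      have "g x \<le> f z + L * dist x z" unfolding g_def by (rule cINF_lower[OF bdd z])
      also have "\<dots> \<le> f z + L * (dist x y + dist y z)" using L0 dist_triangle[of x z y] by (intro add_left_mono mult_left_mono) auto
      finally show "g x - L * dist x y \<le> f z + L * dist y z" by (simp add: algebra_simps)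
    qed
    then show ?thesis by simp
  qed
  show ?thesis
  proof (rule that[of g])
    show "L-lipschitz_on UNIV g"
    proof (rule lipschitz_onI)
      fix x y show "dist (g x) (g y) \<le> L * dist x y"
        using le[of x y] le[of y x] by (simp add: dist_real_def dist_commute abs_le_iff)
    qed (rule L0)
    fix x assume x: "x \<in> B"
    have "g x \<le> f x + L * dist x x" unfolding g_def by (rule cINF_lower[OF bdd x])
    moreover have "f x \<le> g x" unfolding g_def
      by (rule cINF_greatest[OF False]) (use *[OF x] in \<open>force simp: abs_le_iff\<close>)
    ultimately show "g x = f x" by simp
  qed
qed

text \<open>On each small ball every coordinate is replaced by a global Lipschitz extension, which
  has the same derivatives inside the open ball. Lindelof's theorem leaves countably many balls,
  hence countably many null sets.\<close>

theorem rademacher: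
  fixes f :: "'a::euclidean_space \<Rightarrow> 'b::euclidean_space"
  assumes "open S" and lip: "\<And>x. x \<in> S \<Longrightarrow> \<exists>e>0. \<exists>L. L-lipschitz_on (ball x e) f"
  shows "AE x in lborel. x \<in> S \<longrightarrow> f differentiable (at x)"
proof -
  have ball: "AE y in lborel. y \<in> ball x e \<longrightarrow> f differentiable (at y)" if L: "L-lipschitz_on (ball x e) f" for x e L
  proof -
    have "AE y in lborel. y \<in> ball x e \<longrightarrow> (\<lambda>z. f z \<bullet> b) differentiable (at y)" if b: "b \<in> Basis" for b
    proof -
      have "L-lipschitz_on (ball x e) (\<lambda>z. f z \<bullet> b)"
      proof (rule lipschitz_onI)
        fix y z assume "y \<in> ball x e" "z \<in> ball x e"
        then have "dist (f y) (f z) \<le> L * dist y z" by (rule lipschitz_onD[OF L])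
        moreover have "dist (f y \<bullet> b) (f z \<bullet> b) \<le> dist (f y) (f z)"
          using Basis_le_norm[OF b, of "f y - f z"] by (simp add: dist_norm inner_diff_left)
        ultimately show "dist (f y \<bullet> b) (f z \<bullet> b) \<le> L * dist y z" by linarith
      qed (use L lipschitz_on_nonneg in blast)
      then obtain g where g: "L-lipschitz_on UNIV g" "\<And>y. y \<in> ball x e \<Longrightarrow> g y = f y \<bullet> b" by (rule lipschitz_extension) blast
      from lipschitz_differentiable_AE[OF g(1)] show ?thesis
      proof eventually_elim
        fix y assume y: "g differentiable at y"
        show "y \<in> ball x e \<longrightarrow> (\<lambda>z. f z \<bullet> b) differentiable at y"
        proof
          assume i: "y \<in> ball x e"
          show "(\<lambda>z. f z \<bullet> b) differentiable at y"
            using y has_derivative_transform_within_open[of g _ y UNIV "ball x e" "\<lambda>z. f z \<bullet> b"] i g(2)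
            unfolding differentiable_def by auto
        qed
      qed
    qed
    then have "AE y in lborel. \<forall>b\<in>Basis. y \<in> ball x e \<longrightarrow> (\<lambda>z. f z \<bullet> b) differentiable (at y)"
      by (intro AE_finite_allI) auto
    then show ?thesis by eventually_elim (use differentiable_componentwise_within[of f _ UNIV] in auto)
  qed
  obtain e L where eL: "\<And>x. x \<in> S \<Longrightarrow> e x > 0" "\<And>x. x \<in> S \<Longrightarrow> (L x)-lipschitz_on (ball x (e x)) f" using lip by metis
  obtain F where F: "F \<subseteq> (\<lambda>x. ball x (e x)) ` S" "countable F" "\<Union> F = (\<Union>x\<in>S. ball x (e x))"
    by (rule Lindelof[of "(\<lambda>x. ball x (e x)) ` S"]) auto
  have "AE y in lborel. \<forall>B\<in>F. y \<in> B \<longrightarrow> f differentiable (at y)"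
    unfolding AE_ball_countable[OF F(2)]
  proof
    fix B assume "B \<in> F"
    then obtain x where "x \<in> S" "B = ball x (e x)" using F(1) by blast
    then show "AE y in lborel. y \<in> B \<longrightarrow> f differentiable (at y)" using ball[OF eL(2)] by simp
  qed
  then show ?thesis
  proof eventually_elim
    fix y assume y: "\<forall>B\<in>F. y \<in> B \<longrightarrow> f differentiable (at y)"
    show "y \<in> S \<longrightarrow> f differentiable at y"
    proof
      assume "y \<in> S"
      then have "y \<in> \<Union> F" unfolding F(3) using eL(1) by (metis UN_iff centre_in_ball)
      then show "f differentiable at y" using y by blast
    qed
  qed
qed

section \<open>Brenier maps\<close>

text \<open>Rather than exact subgradients, which need not exist at every stage, we work with
  \<open>e\<close>-subgradients: a supremum of affine functions has them by construction.\<close>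

definition approx_subdiff :: "'a::euclidean_space set \<Rightarrow> ('a \<Rightarrow> real) \<Rightarrow> bool" where
  "approx_subdiff S f \<longleftrightarrow> (\<forall>x\<in>S. \<forall>e>0. \<exists>p. \<forall>z\<in>S. f x - e + p \<bullet> (z - x) \<le> f z)"

text \<open>An affine minorant that misses f by at most e at the intermediate point, averaged over
  the two endpoints, gives the convexity inequality up to e.\<close>

lemma approx_subdiff_convex_on:
  assumes S: "convex S" and f: "approx_subdiff S f"
  shows "convex_on S f"
proof (rule convex_onI[OF _ S])
  fix t :: real and x y assume t: "0 < t" "t < 1" and xy: "x \<in> S" "y \<in> S"
  let ?w = "(1 - t) *\<^sub>R x + t *\<^sub>R y"
  have w: "?w \<in> S" using S xy t by (simp add: convexD)
  show "f ?w \<le> (1 - t) * f x + t * f y"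
  proof (rule field_le_epsilon)
    fix e :: real assume "e > 0"
    then obtain p where p: "\<And>z. z \<in> S \<Longrightarrow> f ?w - e + p \<bullet> (z - ?w) \<le> f z"
      using f w unfolding approx_subdiff_def by blast
    have "(1 - t) * (f ?w - e + p \<bullet> (x - ?w)) + t * (f ?w - e + p \<bullet> (y - ?w)) \<le> (1 - t) * f x + t * f y"
      using p[OF xy(1)] p[OF xy(2)] t by (intro add_mono mult_left_mono) auto
    moreover have "(1 - t) * (f ?w - e + p \<bullet> (x - ?w)) + t * (f ?w - e + p \<bullet> (y - ?w)) = f ?w - e"
      by (simp add: inner_diff_right inner_add_right algebra_simps)
    ultimately show "f ?w \<le> (1 - t) * f x + t * f y + e" by linarith
  qed
qed

text \<open>The segment from y to z is prolonged beyond z by the length e; its end w is still in the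
  ball of radius 2 e. Convexity bounds the slope from y to z by the slope from y to w, whose rise is
  at most 2 B over a length of at least e.\<close>

lemma convex_on_bounded_lipschitz:
  fixes f :: "'a::euclidean_space \<Rightarrow> real"
  assumes cv: "convex_on (cball x (2 * e)) f" and e: "e > 0"
    and B: "\<And>y. y \<in> cball x (2 * e) \<Longrightarrow> \<bar>f y\<bar> \<le> B"
  shows "(2 * B / e)-lipschitz_on (ball x e) f"
proof (rule lipschitz_onI)
  have B0: "B \<ge> 0" using B[of x] e by auto
  then show "0 \<le> 2 * B / e" using e by simp
  have le: "f z - f y \<le> 2 * B / e * dist y z" if y: "y \<in> ball x e" and z: "z \<in> ball x e" for y z
  proof (cases "y = z")
    case False
    define s where "s = dist y z"
    have s: "s > 0" using False by (simp add: s_def)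
    define w where "w = z + (e / s) *\<^sub>R (z - y)"
    have "dist x w \<le> dist x z + norm ((e / s) *\<^sub>R (z - y))" unfolding w_def dist_norm
      using norm_triangle_ineq4[of "x - z" "(e / s) *\<^sub>R (z - y)"] by (simp add: algebra_simps)
    also have "norm ((e / s) *\<^sub>R (z - y)) = e" using s e by (simp add: s_def dist_norm norm_minus_commute)
    finally have w: "w \<in> cball x (2 * e)" using z by simp
    have yc: "y \<in> cball x (2 * e)" using y e by simp
    define t where "t = s / (s + e)"
    have t: "0 \<le> t" "t \<le> 1" using s e by (auto simp: t_def)
    have "z = (1 - t) *\<^sub>R y + t *\<^sub>R w"
    proof -
      have 1: "1 - t = e / (s + e)" "t * (e / s) = e / (s + e)" using s e by (auto simp: t_def field_simps)
      have "(1 - t) *\<^sub>R y + t *\<^sub>R w = (1 - t) *\<^sub>R y + t *\<^sub>R z + (t * (e / s)) *\<^sub>R (z - y)"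
        by (simp add: w_def scaleR_add_right)
      also have "\<dots> = (1 - t) *\<^sub>R y + t *\<^sub>R z + (1 - t) *\<^sub>R (z - y)" using 1 by simp
      also have "\<dots> = z" by (simp add: algebra_simps)
      finally show ?thesis by simp
    qed
    then have "f z \<le> (1 - t) * f y + t * f w" using convex_onD[OF cv t yc w] by simp
    then have "f z - f y \<le> t * (f w - f y)" by (simp add: algebra_simps)
    also have "\<dots> \<le> t * (2 * B)" using B[OF w] B[OF yc] t by (intro mult_left_mono) auto
    also have "\<dots> \<le> (s / e) * (2 * B)" using s e B0 by (intro mult_right_mono) (auto simp: t_def intro!: divide_left_mono)
    finally show ?thesis by (simp add: s_def mult.commute)
  qed simp
  fix y z assume yz: "y \<in> ball x e" "z \<in> ball x e"
  show "dist (f y) (f z) \<le> 2 * B / e * dist y z"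
    using le[OF yz] le[OF yz(2,1)] by (simp add: dist_real_def dist_commute abs_le_iff)
qed

lemma convex_on_locally_lipschitz:
  fixes f :: "'a::euclidean_space \<Rightarrow> real"
  assumes S: "open S" "convex_on S f" "x \<in> S"
  shows "\<exists>e>0. \<exists>L. L-lipschitz_on (ball x e) f"
proof -
  obtain d where d: "d > 0" "cball x d \<subseteq> S" using S open_contains_cball by blast
  have "continuous_on (cball x d) f" using convex_on_continuous[OF S(1,2)] d continuous_on_subset by blast
  then have "bounded (f ` cball x d)" by (intro compact_imp_bounded compact_continuous_image) auto
  then obtain B where "\<And>y. y \<in> cball x d \<Longrightarrow> \<bar>f y\<bar> \<le> B"
    unfolding bounded_iff ball_simps real_norm_def by blast
  moreover have "convex_on (cball x d) f" using S(2) d by (meson convex_cball convex_on_subset)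
  ultimately have "(2 * B / (d/2))-lipschitz_on (ball x (d/2)) f"
    using d(1) by (intro convex_on_bounded_lipschitz) auto
  then show ?thesis using d(1) half_gt_zero by blast
qed

lemma convex_on_SUP:
  fixes f :: "nat \<Rightarrow> 'a::real_vector \<Rightarrow> real"
  assumes cv: "\<And>n. convex_on S (f n)" and bd: "\<And>x. x \<in> S \<Longrightarrow> bdd_above (range (\<lambda>n. f n x))"
  shows "convex_on S (\<lambda>x. SUP n. f n x)"
proof (rule convex_onI)
  show S: "convex S" using cv convex_on_imp_convex by blast
  fix t :: real and x y assume t: "0 < t" "t < 1" and xy: "x \<in> S" "y \<in> S"
  show "(SUP n. f n ((1 - t) *\<^sub>R x + t *\<^sub>R y)) \<le> (1 - t) * (SUP n. f n x) + t * (SUP n. f n y)"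
  proof (rule cSUP_least)
    fix n
    have "f n ((1 - t) *\<^sub>R x + t *\<^sub>R y) \<le> (1 - t) * f n x + t * f n y" using convex_onD[OF cv] t xy by auto
    also have "\<dots> \<le> (1 - t) * (SUP n. f n x) + t * (SUP n. f n y)"
      using t xy by (intro add_mono mult_left_mono cSUP_upper bd) auto
    finally show "f n ((1 - t) *\<^sub>R x + t *\<^sub>R y) \<le> (1 - t) * (SUP n. f n x) + t * (SUP n. f n y)" .
  qed simp
qed

text \<open>The pointwise supremum of the sequence is convex, hence continuous; this is what makes the
  pointwise bounds locally uniform and the sequence locally equi-Lipschitz.\<close>

lemma convex_pointwise_bounded_equilipschitz:
  fixes f :: "nat \<Rightarrow> 'a::euclidean_space \<Rightarrow> real"
  assumes S: "open S" and cv: "\<And>n. convex_on S (f n)"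
    and bd: "\<And>x. x \<in> S \<Longrightarrow> \<exists>K. \<forall>n. \<bar>f n x\<bar> \<le> K" and x: "x \<in> S"
  shows "\<exists>e>0. \<exists>L. \<forall>n. L-lipschitz_on (ball x e) (f n)"
proof -
  define M where "M x = (SUP n. f n x)" for x
  have bdd: "bdd_above (range (\<lambda>n. f n x))" if "x \<in> S" for x
    using bd[OF that] by (force simp: bdd_above_def abs_le_iff)
  have fM: "f n x \<le> M x" if "x \<in> S" for n x unfolding M_def using bdd[OF that] by (intro cSUP_upper) auto
  have "convex_on S M" unfolding M_def by (rule convex_on_SUP[OF cv bdd])
  then have contM: "continuous_on S M" using convex_on_continuous S by blast
  obtain d where d: "d > 0" "cball x d \<subseteq> S" using S x open_contains_cball by blast
  have "bounded (M ` cball x d)"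
    by (intro compact_imp_bounded compact_continuous_image continuous_on_subset[OF contM d(2)] compact_cball)
  then obtain B where B: "\<And>y. y \<in> cball x d \<Longrightarrow> \<bar>M y\<bar> \<le> B"
    unfolding bounded_iff ball_simps real_norm_def by blast
  obtain K where K: "\<And>n. \<bar>f n x\<bar> \<le> K" using bd[OF x] by blast
  \<comment> \<open>The lower bound comes from reflection in x: the value at x is at most the mean
    of the values at y and at 2 x - y, and the latter is at most |B|. So the value at y is at least
    - 2 K - |B|.\<close>
  define C where "C = 2 * K + \<bar>B\<bar>"
  have C: "\<bar>f n y\<bar> \<le> C" if y: "y \<in> cball x d" for n y
  proof -
    have y': "2 *\<^sub>R x - y \<in> cball x d" using y by (simp add: dist_norm algebra_simps scaleR_2 norm_minus_commute)
    have "x = (1 - 1/2) *\<^sub>R y + (1/2) *\<^sub>R (2 *\<^sub>R x - y)" by (simp add: algebra_simps)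
    then have "f n x \<le> (1 - 1/2) * f n y + (1/2) * f n (2 *\<^sub>R x - y)"
      using convex_onD[OF cv, of "1/2" y "2 *\<^sub>R x - y" n] subsetD[OF d(2) y] subsetD[OF d(2) y'] by simp
    moreover have "f n (2 *\<^sub>R x - y) \<le> \<bar>B\<bar>" using fM[of "2 *\<^sub>R x - y" n] B[OF y'] y' d by (force simp: abs_le_iff)
    moreover have "f n y \<le> \<bar>B\<bar>" using fM[of y n] B[OF y] y d by (force simp: abs_le_iff)
    ultimately show ?thesis using K[of n] unfolding C_def by auto
  qed
  have "(2 * C / (d/2))-lipschitz_on (ball x (d/2)) (f n)" for n
  proof (rule convex_on_bounded_lipschitz)
    show "convex_on (cball x (2 * (d/2))) (f n)" using convex_on_subset[OF cv d(2)] by simp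
  qed (use C d in auto)
  then show ?thesis using d(1) half_gt_zero by blast
qed

text \<open>A diagonal sequence converges on a countable dense set; the locally uniform Lipschitz
  constants spread the Cauchy property from nearby dense points to every point of S.\<close>

lemma convex_convergent_subsequence:
  fixes f :: "nat \<Rightarrow> 'a::euclidean_space \<Rightarrow> real"
  assumes S: "open S" and cv: "\<And>n. convex_on S (f n)"
    and bd: "\<And>x. x \<in> S \<Longrightarrow> \<exists>K. \<forall>n. \<bar>f n x\<bar> \<le> K"
  obtains r :: "nat \<Rightarrow> nat" where "strict_mono r" "\<And>x. x \<in> S \<Longrightarrow> convergent (\<lambda>n. f (r n) x)"
proof -
  obtain Q :: "'a set" where Q: "countable Q" "\<And>U. open U \<Longrightarrow> U \<noteq> {} \<Longrightarrow> \<exists>d\<in>Q. d \<in> U"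
    using countable_dense_setE by blast
  obtain K where K: "\<And>x n. x \<in> S \<Longrightarrow> \<bar>f n x\<bar> \<le> K x" using bd by metis
  \<comment> \<open>The diagonal argument wants one bound for all points, so the values at x are
    divided by a factor that depends on x but not on n.\<close>
  define h where "h n x = f n x / (1 + \<bar>K x\<bar>)" for n x
  have h1: "norm (h n x) \<le> 1" if "x \<in> Q \<inter> S" for n x
    using K[of x n] that by (simp add: h_def)
  obtain r where r: "strict_mono (r :: nat \<Rightarrow> nat)" "\<And>x. x \<in> Q \<inter> S \<Longrightarrow> \<exists>l. (\<lambda>n. h (r n) x) \<longlonglongrightarrow> l"
  proof (rule function_convergent_subsequence[of "Q \<inter> S" h 1])
    show "countable (Q \<inter> S)" using Q(1) by (rule countable_Int1)
    show "norm (h n x) \<le> 1" if "x \<in> Q \<inter> S" for n x using h1[OF that] .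
  qed blast
  have conQ: "convergent (\<lambda>n. f (r n) x)" if x: "x \<in> Q \<inter> S" for x
  proof -
    obtain l where "(\<lambda>n. h (r n) x) \<longlonglongrightarrow> l" using r(2)[OF x] by blast
    then have "(\<lambda>n. h (r n) x * (1 + \<bar>K x\<bar>)) \<longlonglongrightarrow> l * (1 + \<bar>K x\<bar>)" by (intro tendsto_intros)
    moreover have "1 + \<bar>K x\<bar> \<noteq> 0" using abs_ge_zero[of "K x"] by linarith
    ultimately show ?thesis unfolding h_def convergent_def by auto
  qed
  have "convergent (\<lambda>n. f (r n) x)" if x: "x \<in> S" for x
  proof -
    obtain e L where eL: "e > 0" "\<And>n. L-lipschitz_on (ball x e) (f n)"
      using convex_pointwise_bounded_equilipschitz[OF S cv bd x] by blast
    have L0: "L \<ge> 0" using eL(2) lipschitz_on_nonneg by blast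
    have "Cauchy (\<lambda>n. f (r n) x)"
    proof (rule metric_CauchyI)
      fix \<epsilon> :: real assume \<epsilon>: "\<epsilon> > 0"
      define \<rho> where "\<rho> = min e (\<epsilon> / (3 * (L + 1)))"
      have \<rho>: "\<rho> > 0" using eL(1) \<epsilon> L0 by (simp add: \<rho>_def)
      have "x \<in> ball x \<rho> \<inter> S" "open (ball x \<rho> \<inter> S)" using S x \<rho> by auto
      then obtain y where y: "y \<in> Q \<inter> S" "dist x y < \<rho>" using Q(2) by fastforce
      have near: "dist (f n x) (f n y) \<le> \<epsilon> / 3" for n
      proof -
        have "dist (f n x) (f n y) \<le> L * dist x y"
          using y eL(1) by (intro lipschitz_onD[OF eL(2)]) (auto simp: \<rho>_def)
        also have "\<dots> \<le> (L + 1) * (\<epsilon> / (3 * (L + 1)))"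
          using y(2) L0 by (intro mult_mono) (auto simp: \<rho>_def)
        also have "\<dots> = \<epsilon> / 3" using L0 by (simp add: divide_simps)
        finally show ?thesis .
      qed
      have "Cauchy (\<lambda>n. f (r n) y)" using conQ[OF y(1)] convergent_Cauchy by blast
      then obtain N where N: "\<And>m n. m \<ge> N \<Longrightarrow> n \<ge> N \<Longrightarrow> dist (f (r m) y) (f (r n) y) < \<epsilon> / 3"
        using \<epsilon> metric_CauchyD[of _ "\<epsilon> / 3"] by (metis divide_pos_pos zero_less_numeral)
      show "\<exists>M. \<forall>m\<ge>M. \<forall>n\<ge>M. dist (f (r m) x) (f (r n) x) < \<epsilon>"
      proof (intro exI[of _ N] allI impI)
        fix m n assume mn: "m \<ge> N" "n \<ge> N"
        have "\<bar>f (r m) x - f (r m) y\<bar> \<le> \<epsilon>/3" "\<bar>f (r n) x - f (r n) y\<bar> \<le> \<epsilon>/3" "\<bar>f (r m) y - f (r n) y\<bar> < \<epsilon>/3"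
          using near[of "r m"] near[of "r n"] N[OF mn] by (auto simp: dist_real_def)
        then have "\<bar>f (r m) x - f (r n) x\<bar> < \<epsilon>/3 + \<epsilon>/3 + \<epsilon>/3" by linarith
        then show "dist (f (r m) x) (f (r n) x) < \<epsilon>" by (simp add: dist_real_def)
      qed
    qed
    then show ?thesis by (simp add: Cauchy_convergent)
  qed
  then show ?thesis using that r(1) by blast
qed

text \<open>The subgradient inequality is tested at distance s from x in the direction of y n - p.
  Against the derivative this gives |y n - p| \<le> c n / s + e/4. The distance s depends on e
  alone, so the first term vanishes as n grows.\<close>

lemma near_subgradients_tendsto:
  fixes \<phi> :: "'a::euclidean_space \<Rightarrow> real"
  assumes A: "open A" "x \<in> A" and der: "(\<phi> has_derivative (\<lambda>h. h \<bullet> p)) (at x)"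
    and c: "c \<longlonglongrightarrow> 0" and y: "\<And>n z. z \<in> A \<Longrightarrow> \<phi> x - c n + (z - x) \<bullet> y n \<le> \<phi> z"
  shows "y \<longlonglongrightarrow> p"
proof (rule LIMSEQ_I)
  fix e :: real assume e: "e > 0"
  obtain d1 where d1: "d1 > 0" "ball x d1 \<subseteq> A" using A open_contains_ball by blast
  obtain d2 where d2: "d2 > 0" "\<And>z. norm (z - x) < d2 \<Longrightarrow> norm (\<phi> z - \<phi> x - (z - x) \<bullet> p) \<le> e/4 * norm (z - x)"
    using der e unfolding has_derivative_at_alt by (metis divide_pos_pos zero_less_numeral)
  define s where "s = min d1 d2 / 2"
  have s: "s > 0" "s < d1" "s < d2" using d1 d2 by (auto simp: s_def)
  have bound: "norm (y n - p) \<le> c n / s + e/4" if "y n \<noteq> p" for n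
  proof -
    define N where "N = norm (y n - p)"
    have N: "N > 0" using that by (simp add: N_def)
    define h where "h = (s / N) *\<^sub>R (y n - p)"
    have nh: "norm h = s" using N s by (simp add: h_def N_def)
    have "\<phi> x - c n + h \<bullet> y n \<le> \<phi> (x + h)" using y[of "x + h" n] d1 nh s by (auto simp: subset_iff dist_norm)
    moreover have "\<phi> (x + h) - \<phi> x - h \<bullet> p \<le> e/4 * s" using d2(2)[of "x + h"] nh s(3) abs_ge_self[of "\<phi> (x + h) - \<phi> x - h \<bullet> p"] by simp
    ultimately have "h \<bullet> (y n - p) \<le> c n + e/4 * s" by (simp add: inner_diff_right)
    moreover have "h \<bullet> (y n - p) = s * N" using N by (simp add: h_def N_def dot_square_norm power2_eq_square)
    ultimately show ?thesis using s(1) by (simp add: N_def field_simps)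
  qed
  have "(\<lambda>n. c n / s) \<longlonglongrightarrow> 0 / s" using s(1) by (intro tendsto_intros c) auto
  then obtain M where M: "\<And>n. n \<ge> M \<Longrightarrow> \<bar>c n / s\<bar> < e/4"
    using e LIMSEQ_D[of "\<lambda>n. c n / s" 0 "e/4"] by auto
  show "\<exists>no. \<forall>n\<ge>no. norm (y n - p) < e"
  proof (intro exI[of _ M] allI impI)
    fix n assume "n \<ge> M"
    then have "\<bar>c n / s\<bar> < e/4" by (rule M)
    then show "norm (y n - p) < e" using bound[of n] e abs_ge_self[of "c n / s"] by (cases "y n = p") (simp, linarith)
  qed
qed

text \<open>\<open>A\<close> plays the role of the interior of the convex hull of the support of \<open>M\<close>; the last
  assumption says that no point of \<open>A\<close> can be cut off by a null half-space.\<close>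

locale convex_core = prob_space M for M :: "'a::euclidean_space measure" +
  fixes A :: "'a set"
  assumes sets_M [measurable_cong]: "sets M = sets borel"
    and sq_integrable: "integrable M (\<lambda>x. (norm x)\<^sup>2)"
    and open_A: "open A" and convex_A: "convex A"
    and AE_A: "AE x in M. x \<in> A"
    and halfspace_pos: "\<And>x u. x \<in> A \<Longrightarrow> u \<noteq> 0 \<Longrightarrow> emeasure M {z. u \<bullet> x < u \<bullet> z} \<noteq> 0"
begin

lemma space_M [simp]: "space M = UNIV"
  using sets_M sets_eq_imp_space_eq space_borel by metis

lemma prob_UNIV [simp]: "prob UNIV = 1"
  using prob_space by simp

lemma A_nonempty: "A \<noteq> {}"
  using AE_A by auto

lemma id_integrable: "integrable M (\<lambda>x. x)"
proof (rule Bochner_Integration.integrable_bound)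
  show "integrable M (\<lambda>x. 1 + (norm x)\<^sup>2)" using sq_integrable by simp
  have "norm x \<le> norm (1 + (norm x)\<^sup>2)" for x :: 'a
    using sum_power2_ge_zero[of "norm x - 1" 0] by (simp add: power2_eq_square algebra_simps) (smt (verit) norm_ge_zero zero_le_square)
  then show "AE x in M. norm x \<le> norm (1 + (norm x)\<^sup>2)" by simp
qed measurable

lemma affine_integrable: "integrable M (\<lambda>x. a \<bullet> x + b)"
  using id_integrable by auto

lemma borel_measurable_iff: "(f \<in> borel_measurable M) = (f \<in> borel_measurable borel)"
  using measurable_cong_sets[OF sets_M refl] by blast

text \<open>If the values at x were unbounded, an approximate subgradient would make the functions
  almost equally large on a whole half-space bounded at x. The normals subconverge, the functions
  tend to infinity on the limiting open half-space, and this half-space has positive measure.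
  Fatou's lemma then contradicts the bound on the integrals.\<close>

lemma approx_subdiff_pointwise_bounded:
  assumes sub: "\<And>n. approx_subdiff A (f n)" and int: "\<And>n::nat. integrable M (f n)"
    and le: "\<And>n. (\<integral>x. f n x \<partial>M) \<le> C"
    and lower: "\<And>n x. x \<in> A \<Longrightarrow> a \<bullet> x + b \<le> f n x" and x: "x \<in> A"
  shows "\<exists>K. \<forall>n. f n x \<le> K"
proof (rule ccontr)
  assume "\<nexists>K. \<forall>n. f n x \<le> K"
  then have "\<forall>k::nat. \<exists>n. real k < f n x" by (meson not_le)
  then obtain N where N: "\<And>k. real k < f (N k) x" by metis
  \<comment> \<open>Subtracting the common affine minorant makes the functions nonnegative on A, as
    Fatou's lemma requires.\<close>
  define g where "g k z = f (N k) z - (a \<bullet> z + b)" for k z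
  have g0: "0 \<le> g k z" if "z \<in> A" for k z using lower[OF that] by (simp add: g_def)
  have gint: "integrable M (g k)" for k unfolding g_def using int affine_integrable by auto
  define C' where "C' = C - (\<integral>z. a \<bullet> z + b \<partial>M)"
  have gC: "(\<integral>z. g k z \<partial>M) \<le> C'" for k
    unfolding g_def C'_def using int affine_integrable le by (subst Bochner_Integration.integral_diff) auto
  have gx: "g k x \<ge> real k - (a \<bullet> x + b)" for k using N[of k] by (simp add: g_def)
  have "\<exists>u. norm u = 1 \<and> (\<forall>z\<in>A. 0 \<le> u \<bullet> (z - x) \<longrightarrow> g k x - 1 \<le> g k z)" for k
  proof -
    obtain p where p: "\<And>z. z \<in> A \<Longrightarrow> f (N k) x - 1 + p \<bullet> (z - x) \<le> f (N k) z"
      using sub[of "N k"] x unfolding approx_subdiff_def by (meson zero_less_one)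
    define q where "q = p - a"
    have q: "g k x - 1 + q \<bullet> (z - x) \<le> g k z" if "z \<in> A" for z
      using p[OF that] by (simp add: g_def q_def inner_diff_left inner_diff_right)
    show ?thesis
    proof (cases "q = 0")
      case True
      \<comment> \<open>With a zero subgradient the lower bound holds on all of A, so any unit
        vector may serve as the normal.\<close>
      obtain b :: 'a where "b \<in> Basis" using nonempty_Basis by blast
      then show ?thesis using q True by (intro exI[of _ b]) auto
    next
      case False
      show ?thesis
      proof (intro exI[of _ "(1 / norm q) *\<^sub>R q"] conjI ballI impI)
        fix z assume z: "z \<in> A" "0 \<le> ((1 / norm q) *\<^sub>R q) \<bullet> (z - x)"
        then have "0 \<le> q \<bullet> (z - x)" using False by (simp add: zero_le_divide_iff)
        then show "g k x - 1 \<le> g k z" using q[OF z(1)] by linarith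
      qed (use False in simp)
    qed
  qed
  then obtain u where u: "\<And>k. norm (u k) = 1" "\<And>k z. z \<in> A \<Longrightarrow> 0 \<le> u k \<bullet> (z - x) \<Longrightarrow> g k x - 1 \<le> g k z" by metis
  have "compact (sphere (0::'a) 1)" by simp
  moreover have "\<forall>k. u k \<in> sphere 0 1" using u(1) by simp
  ultimately obtain v r where vr: "v \<in> sphere 0 1" "strict_mono (r::nat\<Rightarrow>nat)" "(u \<circ> r) \<longlonglongrightarrow> v"
    unfolding compact_def by metis
  \<comment> \<open>The inequality is strict: a point strictly inside the limiting half-space lies
    in the half-spaces of \<open>u (r k)\<close> for all large k, which can fail for a point on its
    boundary.\<close>
  define S where "S = {z. v \<bullet> x < v \<bullet> z}"
  have Sm[measurable]: "S \<in> sets M" unfolding S_def sets_M by (intro borel_open open_halfspace_gt)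
  have lim: "((\<lambda>k. ennreal (g (r k) z)) \<longlongrightarrow> \<infinity>) sequentially" if z: "z \<in> A" "z \<in> S" for z
  proof -
    have "(\<lambda>k. (u \<circ> r) k \<bullet> (z - x)) \<longlonglongrightarrow> v \<bullet> (z - x)" using vr(3) by (intro tendsto_intros)
    moreover have "0 < v \<bullet> (z - x)" using z(2) by (simp add: S_def inner_diff_right)
    ultimately have ev: "eventually (\<lambda>k. 0 < (u \<circ> r) k \<bullet> (z - x)) sequentially" using order_tendstoD(1) by blast
    have "filterlim (\<lambda>k. (- (a \<bullet> x + b) - 1) + real k) at_top sequentially"
      by (rule filterlim_tendsto_add_at_top[OF tendsto_const filterlim_real_sequentially])
    then have "filterlim (\<lambda>k. g (r k) z) at_top sequentially"
    proof (rule filterlim_at_top_mono)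
      show "\<forall>\<^sub>F k in sequentially. (- (a \<bullet> x + b) - 1) + real k \<le> g (r k) z"
        using ev
      proof eventually_elim
        fix k assume "0 < (u \<circ> r) k \<bullet> (z - x)"
        then have "g (r k) x - 1 \<le> g (r k) z" using u(2)[OF z(1), of "r k"] by simp
        moreover have "real k \<le> real (r k)" using vr(2) by (simp add: seq_suble)
        ultimately show "(- (a \<bullet> x + b) - 1) + real k \<le> g (r k) z" using gx[of "r k"] by linarith
      qed
    qed
    then show ?thesis by (simp add: ennreal_tendsto_top_eq_at_top)
  qed
  have "(\<integral>\<^sup>+z. \<infinity> * indicator S z \<partial>M) \<le> (\<integral>\<^sup>+z. liminf (\<lambda>k. ennreal (g (r k) z)) \<partial>M)"
  proof (rule nn_integral_mono_AE)
    show "AE z in M. \<infinity> * indicator S z \<le> liminf (\<lambda>k. ennreal (g (r k) z))"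
      using AE_A
    proof eventually_elim
      fix z assume "z \<in> A"
      then show "\<infinity> * indicator S z \<le> liminf (\<lambda>k. ennreal (g (r k) z))"
        using lim_imp_Liminf[OF _ lim[of z]] by (cases "z \<in> S") auto
    qed
  qed
  also have "\<dots> \<le> liminf (\<lambda>k. \<integral>\<^sup>+z. ennreal (g (r k) z) \<partial>M)"
    by (rule nn_integral_liminf) (use borel_measurable_integrable[OF gint] in auto)
  also have "\<dots> \<le> liminf (\<lambda>k::nat. ennreal C')"
  proof (intro Liminf_mono always_eventually allI)
    fix k
    have "(\<integral>\<^sup>+z. ennreal (g (r k) z) \<partial>M) = ennreal (\<integral>z. g (r k) z \<partial>M)"
      by (rule nn_integral_eq_integral[OF gint]) (use AE_A g0 in \<open>auto elim: eventually_mono\<close>)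
    also have "\<dots> \<le> ennreal C'" using gC by (rule ennreal_leI)
    finally show "(\<integral>\<^sup>+z. ennreal (g (r k) z) \<partial>M) \<le> ennreal C'" .
  qed
  also have "\<dots> = ennreal C'" by (simp add: Liminf_const)
  finally have "\<infinity> * emeasure M S \<le> ennreal C'" by (simp add: nn_integral_cmult_indicator)
  moreover have "emeasure M S \<noteq> 0" unfolding S_def by (rule halfspace_pos[OF x]) (use vr(1) in force)
  ultimately show False by (simp add: ennreal_top_mult top_unique)
qed

text \<open>Fatou's lemma for functions with a common affine minorant, which is integrable because
  the measure has a second moment.\<close>

lemma fatou_bounded_below:
  assumes int: "\<And>n::nat. integrable M (f n)" and lower: "\<And>n x. x \<in> A \<Longrightarrow> a \<bullet> x + b \<le> f n x"
    and lim: "\<And>x. x \<in> A \<Longrightarrow> (\<lambda>n. f n x) \<longlonglongrightarrow> F x" and [measurable]: "F \<in> borel_measurable M"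
    and le: "\<And>n. (\<integral>x. f n x \<partial>M) \<le> c n" and c: "c \<longlonglongrightarrow> c0"
  shows "integrable M F" "(\<integral>x. F x \<partial>M) \<le> c0"
proof -
  let ?l = "\<lambda>x. a \<bullet> x + b"
  define m where "m = (\<integral>x. ?l x \<partial>M)"
  have lint: "integrable M ?l" by (rule affine_integrable)
  have [measurable]: "f n \<in> borel_measurable M" for n using int by auto
  have F: "?l x \<le> F x" if "x \<in> A" for x using lim[OF that] by (rule LIMSEQ_le_const) (use lower that in auto)
  have nn: "(\<integral>\<^sup>+x. ennreal (F x - ?l x) \<partial>M) \<le> ennreal (c0 - m)"
  proof -
    have "(\<integral>\<^sup>+x. ennreal (F x - ?l x) \<partial>M) = (\<integral>\<^sup>+x. liminf (\<lambda>n. ennreal (f n x - ?l x)) \<partial>M)"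
    proof (rule nn_integral_cong_AE)
      show "AE x in M. ennreal (F x - ?l x) = liminf (\<lambda>n. ennreal (f n x - ?l x))"
        using AE_A by eventually_elim (intro lim_imp_Liminf[symmetric] tendsto_ennrealI tendsto_intros lim, auto)
    qed
    also have "\<dots> \<le> liminf (\<lambda>n. \<integral>\<^sup>+x. ennreal (f n x - ?l x) \<partial>M)" by (rule nn_integral_liminf) simp
    also have "\<dots> \<le> liminf (\<lambda>n. ennreal (c n - m))"
    proof (intro Liminf_mono always_eventually allI)
      fix n
      have "(\<integral>\<^sup>+x. ennreal (f n x - ?l x) \<partial>M) = ennreal (\<integral>x. f n x - ?l x \<partial>M)"
        by (rule nn_integral_eq_integral) (use AE_A lower int lint in \<open>auto elim: eventually_mono\<close>)
      also have "(\<integral>x. f n x - ?l x \<partial>M) \<le> c n - m"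
        unfolding m_def using le[of n] by (subst Bochner_Integration.integral_diff[OF int lint]) simp
      finally show "(\<integral>\<^sup>+x. ennreal (f n x - ?l x) \<partial>M) \<le> ennreal (c n - m)" using ennreal_leI by blast
    qed
    also have "\<dots> = ennreal (c0 - m)" by (intro lim_imp_Liminf tendsto_ennrealI tendsto_intros c) simp
    finally show ?thesis .
  qed
  have AE0: "AE x in M. 0 \<le> F x - ?l x" using AE_A by eventually_elim (use F in simp)
  have i: "integrable M (\<lambda>x. F x - ?l x)"
    by (rule integrableI_nonneg[OF _ AE0]) (use nn in \<open>auto simp: le_less_trans\<close>)
  have "integrable M (\<lambda>x. (F x - ?l x) + ?l x)" using i lint by (rule Bochner_Integration.integrable_add)
  then show Fi: "integrable M F" by simp
  \<comment> \<open>Coercion to \<open>ennreal\<close> sends negative numbers to 0, so the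
    inequality obtained there is informative only once c0 - m is known to be nonnegative.\<close>
  have "0 \<le> c n - m" for n
  proof -
    have "m \<le> (\<integral>x. f n x \<partial>M)" unfolding m_def by (rule integral_mono_AE[OF lint int]) (use AE_A lower in \<open>auto elim: eventually_mono\<close>)
    then show ?thesis using le[of n] by simp
  qed
  moreover have "(\<lambda>n. c n - m) \<longlonglongrightarrow> c0 - m" by (intro tendsto_intros c)
  ultimately have "0 \<le> c0 - m" using LIMSEQ_le_const[of "\<lambda>n. c n - m" "c0 - m" 0] by blast
  moreover have "ennreal (\<integral>x. F x - ?l x \<partial>M) \<le> ennreal (c0 - m)"
    using nn nn_integral_eq_integral[OF i AE0] by simp
  ultimately have "(\<integral>x. F x - ?l x \<partial>M) \<le> c0 - m" by simp
  then show "(\<integral>x. F x \<partial>M) \<le> c0" unfolding m_def by (subst (asm) Bochner_Integration.integral_diff[OF Fi lint]) simp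
qed

end

text \<open>A is the interior of the intersection C of all closed convex sets of full measure. By
  Lindelof's theorem C is already a countable intersection up to equality of sets, so it has full
  measure, and the boundary of a convex set is null. If an open half-space bounded at an interior
  point were null, its complement would be among the sets intersected and would exclude points of C
  close to x.\<close>

lemma ac_convex_core:
  fixes M :: "'a::euclidean_space measure"
  assumes "prob_space M" and sM: "sets M = sets borel" and sq: "integrable M (\<lambda>x. (norm x)\<^sup>2)"
    and ac: "absolutely_continuous lborel M"
  obtains A where "convex_core M A"
proof -
  interpret prob_space M by fact
  have spM: "space M = UNIV" using sM sets_eq_imp_space_eq space_borel by metis
  define HH where "HH = {H. closed H \<and> convex H \<and> (AE x in M. x \<in> H)}"
  define C where "C = \<Inter>HH"
  have C: "closed C" "convex C" unfolding C_def HH_def by (auto intro: convex_Inter)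
  obtain F where F: "F \<subseteq> uminus ` HH" "countable F" "\<Union>F = \<Union>(uminus ` HH)"
    by (rule Lindelof[of "uminus ` HH"]) (auto simp: HH_def open_Compl)
  have "AE x in M. \<forall>B\<in>F. x \<notin> B"
    unfolding AE_ball_countable[OF F(2)] using F(1) by (auto simp: HH_def)
  then have AEC: "AE x in M. x \<in> C"
    by eventually_elim (use F(3) in \<open>auto simp: C_def\<close>)
  have "frontier C \<in> null_sets lborel"
    using negligible_convex_frontier[OF C(2)] by (simp add: negligible_iff_null_sets null_sets_completion_iff)
  then have "frontier C \<in> null_sets M" using ac by (auto simp: absolutely_continuous_def)
  then have "AE x in M. x \<notin> frontier C" by (rule AE_not_in)
  with AEC have AEI: "AE x in M. x \<in> interior C"
    by eventually_elim (use C(1) in \<open>auto simp: frontier_def\<close>)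
  have "convex_core M (interior C)"
  proof unfold_locales
    fix x u :: 'a assume x: "x \<in> interior C" and u: "u \<noteq> 0"
    show "emeasure M {z. u \<bullet> x < u \<bullet> z} \<noteq> 0"
    proof
      assume 0: "emeasure M {z. u \<bullet> x < u \<bullet> z} = 0"
      have "{z. u \<bullet> x < u \<bullet> z} \<in> null_sets M" 
        by (intro null_setsI 0) (simp add: sM open_halfspace_gt borel_open)
      then have "AE z in M. z \<notin> {z. u \<bullet> x < u \<bullet> z}" by (rule AE_not_in)
      then have "{z. u \<bullet> z \<le> u \<bullet> x} \<in> HH"
        unfolding HH_def by (auto simp: closed_halfspace_le convex_halfspace_le not_less)
      then have sub: "C \<subseteq> {z. u \<bullet> z \<le> u \<bullet> x}" unfolding C_def by blast
      obtain e where e: "e > 0" "ball x e \<subseteq> C" using x mem_interior by blast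
      define z where "z = x + (e / (2 * norm u)) *\<^sub>R u"
      have "z \<in> ball x e" using e u by (simp add: z_def dist_norm)
      then have "u \<bullet> z \<le> u \<bullet> x" using e sub by blast
      moreover have "0 < (e / (2 * norm u)) * (u \<bullet> u)" using e u by simp
      ultimately show False by (simp add: z_def inner_add_right)
    qed
  qed (use sM sq C AEI in \<open>auto intro: convex_interior\<close>)
  then show ?thesis by (rule that)
qed

section \<open>Conjugate functions and the dual problem\<close>

text \<open>The Legendre transform relative to B. Outside A the supremum may be infinite; the value
  0 there keeps the function real and Borel measurable.\<close>

definition conj_on :: "'a::real_inner set \<Rightarrow> 'a set \<Rightarrow> ('a \<Rightarrow> real) \<Rightarrow> 'a \<Rightarrow> real" where
  "conj_on A B \<psi> x = (if x \<in> A then SUP y\<in>B. x \<bullet> y - \<psi> y else 0)"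

context
  fixes A B :: "'a::euclidean_space set" and \<phi> \<psi> :: "'a \<Rightarrow> real"
  assumes B: "B \<noteq> {}" and dom: "\<And>x y. x \<in> A \<Longrightarrow> y \<in> B \<Longrightarrow> x \<bullet> y \<le> \<phi> x + \<psi> y"
begin

lemma conj_on_bdd: "x \<in> A \<Longrightarrow> bdd_above ((\<lambda>y. x \<bullet> y - \<psi> y) ` B)"
  by (rule bdd_aboveI2[of _ _ "\<phi> x"]) (use dom in force)

lemma conj_on_upper: "x \<in> A \<Longrightarrow> y \<in> B \<Longrightarrow> x \<bullet> y - \<psi> y \<le> conj_on A B \<psi> x"
  unfolding conj_on_def by (auto intro: cSUP_upper conj_on_bdd)

lemma conj_on_le: "x \<in> A \<Longrightarrow> conj_on A B \<psi> x \<le> \<phi> x"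
  unfolding conj_on_def by (auto intro!: cSUP_least simp: B) (use dom in force)

lemma conj_on_approx:
  assumes "x \<in> A" "e > 0"
  obtains y where "y \<in> B" "conj_on A B \<psi> x - e < x \<bullet> y - \<psi> y"
proof -
  have "conj_on A B \<psi> x - e < (SUP y\<in>B. x \<bullet> y - \<psi> y)" using assms by (simp add: conj_on_def)
  then show ?thesis using that less_cSUP_iff[OF B conj_on_bdd[OF assms(1)]] by blast
qed

lemma conj_on_subdiff: "approx_subdiff A (conj_on A B \<psi>)"
  unfolding approx_subdiff_def
proof (intro ballI allI impI)
  fix x and e :: real assume "x \<in> A" "0 < e"
  then obtain y where y: "y \<in> B" "conj_on A B \<psi> x - e < x \<bullet> y - \<psi> y" using conj_on_approx by metis
  show "\<exists>p. \<forall>z\<in>A. conj_on A B \<psi> x - e + p \<bullet> (z - x) \<le> conj_on A B \<psi> z"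
  proof (intro exI[of _ y] ballI)
    fix z assume "z \<in> A"
    then show "conj_on A B \<psi> x - e + y \<bullet> (z - x) \<le> conj_on A B \<psi> z"
      using conj_on_upper[of z y] y by (simp add: inner_diff_right inner_commute)
  qed
qed

end

lemma approx_subdiff_add_const: "approx_subdiff S f \<Longrightarrow> approx_subdiff S (\<lambda>x. f x + c)"
  unfolding approx_subdiff_def by (simp add: algebra_simps)

lemma measurable_zero_outside_open:
  fixes f :: "'a::euclidean_space \<Rightarrow> real"
  assumes A: "open A" and f: "approx_subdiff A f" "convex A" and 0: "\<And>x. x \<notin> A \<Longrightarrow> f x = 0"
  shows "f \<in> borel_measurable borel"
proof -
  have "continuous_on A f" using A approx_subdiff_convex_on[OF f(2,1)] by (rule convex_on_continuous)
  then have "(\<lambda>x. if x \<in> A then f x else 0) \<in> borel_measurable borel"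
    using A by (intro borel_measurable_continuous_on_if) auto
  moreover have "(\<lambda>x. if x \<in> A then f x else 0) = f" using 0 by auto
  ultimately show ?thesis by simp
qed

locale convex_core_pair = \<mu>: convex_core M A + \<nu>: convex_core N B
  for M N :: "'a::euclidean_space measure" and A B
begin

definition feasible :: "('a \<Rightarrow> real) \<Rightarrow> ('a \<Rightarrow> real) \<Rightarrow> bool" where
  "feasible \<phi> \<psi> \<longleftrightarrow> integrable M \<phi> \<and> integrable N \<psi> \<and> (\<forall>x\<in>A. \<forall>y\<in>B. x \<bullet> y \<le> \<phi> x + \<psi> y)"

abbreviation dual_value :: "('a \<Rightarrow> real) \<Rightarrow> ('a \<Rightarrow> real) \<Rightarrow> real" where
  "dual_value \<phi> \<psi> \<equiv> (\<integral>x. \<phi> x \<partial>M) + (\<integral>y. \<psi> y \<partial>N)"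

lemma feasibleD: "feasible \<phi> \<psi> \<Longrightarrow> x \<in> A \<Longrightarrow> y \<in> B \<Longrightarrow> x \<bullet> y \<le> \<phi> x + \<psi> y"
  by (simp add: feasible_def)

text \<open>On A the conjugate is the least partner of \<psi>, so passing to it lowers the dual
  value while adding convexity. It is integrable because it lies between \<phi> and the affine
  function given by a single point y0 of B.\<close>

lemma feasible_conj:
  assumes f: "feasible \<phi> \<psi>"
  shows "feasible (conj_on A B \<psi>) \<psi>" "approx_subdiff A (conj_on A B \<psi>)"
    "(\<integral>x. conj_on A B \<psi> x \<partial>M) \<le> (\<integral>x. \<phi> x \<partial>M)" "conj_on A B \<psi> \<in> borel_measurable borel"
proof -
  note D = \<nu>.A_nonempty feasibleD[OF f]
  let ?c = "conj_on A B \<psi>"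
  show sub: "approx_subdiff A ?c" by (rule conj_on_subdiff[OF D])
  show meas: "?c \<in> borel_measurable borel"
    by (rule measurable_zero_outside_open[OF \<mu>.open_A sub \<mu>.convex_A]) (simp add: conj_on_def)
  obtain y0 where y0: "y0 \<in> B" using \<nu>.A_nonempty by blast
  have int\<phi>: "integrable M \<phi>" using f by (simp add: feasible_def)
  have bound: "\<bar>?c x\<bar> \<le> \<bar>\<phi> x\<bar> + \<bar>y0 \<bullet> x + - \<psi> y0\<bar>" if "x \<in> A" for x
    using conj_on_upper[OF D that y0] conj_on_le[OF D that] by (simp add: inner_commute)
  have int: "integrable M ?c"
  proof (rule Bochner_Integration.integrable_bound)
    show "integrable M (\<lambda>x. \<bar>\<phi> x\<bar> + \<bar>y0 \<bullet> x + - \<psi> y0\<bar>)"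
      by (intro Bochner_Integration.integrable_add integrable_abs int\<phi> \<mu>.affine_integrable)
    show "AE x in M. norm (?c x) \<le> norm (\<bar>\<phi> x\<bar> + \<bar>y0 \<bullet> x + - \<psi> y0\<bar>)"
      using \<mu>.AE_A by eventually_elim (use bound in fastforce)
  qed (use meas \<mu>.borel_measurable_iff in blast)
  show "(\<integral>x. ?c x \<partial>M) \<le> (\<integral>x. \<phi> x \<partial>M)"
    by (rule integral_mono_AE[OF int int\<phi>]) (use \<mu>.AE_A conj_on_le[OF D] in \<open>auto elim: eventually_mono\<close>)
  show "feasible ?c \<psi>"
    using f int conj_on_upper[OF D] by (auto simp: feasible_def algebra_simps)
qed

lemma feasible_sq: "feasible (\<lambda>x. (norm x)\<^sup>2 / 2) (\<lambda>y. (norm y)\<^sup>2 / 2)"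
proof -
  have "x \<bullet> y \<le> (norm x)\<^sup>2 / 2 + (norm y)\<^sup>2 / 2" for x y :: 'a
    using zero_le_power2[of "norm (x - y)"] by (simp add: power2_norm_eq_inner inner_diff_left inner_diff_right inner_commute)
  then show ?thesis using \<mu>.sq_integrable \<nu>.sq_integrable by (auto simp: feasible_def)
qed

text \<open>Averaging the constraint over y alone leaves an affine minorant of \<phi>. This is the
  source of every lower bound in the compactness argument, and averaging once more over x bounds the
  dual problem from below.\<close>

lemma feasible_inner_mean:
  assumes f: "feasible \<phi> \<psi>" and x: "x \<in> A"
  shows "x \<bullet> (\<integral>y. y \<partial>N) \<le> \<phi> x + (\<integral>y. \<psi> y \<partial>N)"
proof -
  have i: "integrable N \<psi>" "integrable N (\<lambda>y. x \<bullet> y)" using f \<nu>.id_integrable by (auto simp: feasible_def)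
  have "x \<bullet> (\<integral>y. y \<partial>N) = (\<integral>y. x \<bullet> y \<partial>N)" using \<nu>.id_integrable by simp
  also have "\<dots> \<le> (\<integral>y. \<phi> x + \<psi> y \<partial>N)"
    by (rule integral_mono_AE) (use i \<nu>.AE_A feasibleD[OF f x] in \<open>auto elim: eventually_mono\<close>)
  also have "\<dots> = \<phi> x + (\<integral>y. \<psi> y \<partial>N)"
    using i by simp
  finally show ?thesis .
qed

lemma feasible_lower_bound:
  assumes f: "feasible \<phi> \<psi>"
  shows "(\<integral>x. x \<partial>M) \<bullet> (\<integral>y. y \<partial>N) \<le> dual_value \<phi> \<psi>"
proof -
  have i: "integrable M \<phi>" using f by (auto simp: feasible_def)
  have "(\<integral>x. x \<partial>M) \<bullet> (\<integral>y. y \<partial>N) = (\<integral>x. x \<bullet> (\<integral>y. y \<partial>N) \<partial>M)" using \<mu>.id_integrable by simp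
  also have "\<dots> \<le> (\<integral>x. \<phi> x + (\<integral>y. \<psi> y \<partial>N) \<partial>M)"
    by (rule integral_mono_AE) (use i \<mu>.id_integrable \<mu>.AE_A feasible_inner_mean[OF f] in \<open>auto elim: eventually_mono\<close>)
  also have "\<dots> = dual_value \<phi> \<psi>" using i by simp
  finally show ?thesis .
qed

end

lemma (in convex_core_pair) swap: "convex_core_pair N M B A"
  by unfold_locales

text \<open>The problem is symmetric, so each statement about \<phi> transfers to \<psi>.\<close>

lemma (in convex_core_pair) feasible_swap: "convex_core_pair.feasible N M B A \<psi> \<phi> \<longleftrightarrow> feasible \<phi> \<psi>"
  unfolding convex_core_pair.feasible_def[OF swap] feasible_def
  by (subst (1) inner_commute, subst (2) add.commute) blast

context convex_core_pair
begin

lemma feasible_conj':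
  assumes f: "feasible \<phi> \<psi>"
  shows "feasible \<phi> (conj_on B A \<phi>)" "approx_subdiff B (conj_on B A \<phi>)"
    "(\<integral>x. conj_on B A \<phi> x \<partial>N) \<le> (\<integral>x. \<psi> x \<partial>N)" "conj_on B A \<phi> \<in> borel_measurable borel"
  using convex_core_pair.feasible_conj[OF swap, of \<psi> \<phi>] f by (simp_all add: feasible_swap)

text \<open>Shifting a constant from one potential to the other does not change the dual value, so a
  minimising sequence can be normalised to \<open>\<integral>\<psi> = 0\<close>; this yields affine lower bounds for both
  potentials and hence, by convexity, pointwise compactness.\<close>

lemma dual_minimiser_exists:
  "\<exists>\<phi> \<psi>. feasible \<phi> \<psi> \<and> (\<forall>\<phi>' \<psi>'. feasible \<phi>' \<psi>' \<longrightarrow>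
     dual_value \<phi> \<psi> \<le> dual_value \<phi>' \<psi>')"
proof -
  define V where "V = {dual_value \<phi> \<psi> | \<phi> \<psi>. feasible \<phi> \<psi>}"
  define I where "I = Inf V"
  have Vne: "V \<noteq> {}" using feasible_sq unfolding V_def by blast
  have Vbd: "bdd_below V" using feasible_lower_bound unfolding V_def by (intro bdd_belowI) blast
  have ex: "\<exists>\<phi> \<psi>. feasible \<phi> \<psi> \<and> approx_subdiff A \<phi> \<and> approx_subdiff B \<psi> \<and> (\<integral>y. \<psi> y \<partial>N) = 0
      \<and> (\<integral>x. \<phi> x \<partial>M) \<le> I + 1 / real (Suc n)" for n
  proof -
    have "I < I + 1 / real (Suc n)" by simp
    then obtain \<phi> \<psi> where f: "feasible \<phi> \<psi>" "dual_value \<phi> \<psi> < I + 1 / real (Suc n)"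
      unfolding I_def cInf_less_iff[OF Vne Vbd] unfolding V_def by blast
    \<comment> \<open>Conjugating twice gives both potentials approximate subgradients, and neither
      conjugation raises the dual value.\<close>
    define \<phi>' where "\<phi>' = conj_on A B \<psi>"
    define \<psi>' where "\<psi>' = conj_on B A \<phi>'"
    note 1 = feasible_conj[OF f(1), folded \<phi>'_def]
    note 2 = feasible_conj'[OF 1(1), folded \<psi>'_def]
    define c where "c = (\<integral>y. \<psi>' y \<partial>N)"
    have i: "integrable M \<phi>'" "integrable N \<psi>'" using 2(1) by (auto simp: feasible_def)
    show ?thesis
    proof (intro exI conjI)
      show "feasible (\<lambda>x. \<phi>' x + c) (\<lambda>y. \<psi>' y + - c)"
        using 2(1) by (auto simp: feasible_def)
      show "approx_subdiff A (\<lambda>x. \<phi>' x + c)" "approx_subdiff B (\<lambda>y. \<psi>' y + - c)"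
        by (rule approx_subdiff_add_const, rule 1 2)+
      show "(\<integral>y. \<psi>' y + - c \<partial>N) = 0" using i by (simp add: c_def)
      show "(\<integral>x. \<phi>' x + c \<partial>M) \<le> I + 1 / real (Suc n)"
        using i 1(3) 2(3) f(2) by (simp add: c_def)
    qed
  qed
  then obtain \<phi> \<psi> where s: "\<And>n. feasible (\<phi> n) (\<psi> n)" "\<And>n. approx_subdiff A (\<phi> n)" "\<And>n. approx_subdiff B (\<psi> n)"
      "\<And>n. (\<integral>y. \<psi> n y \<partial>N) = 0" "\<And>n. (\<integral>x. \<phi> n x \<partial>M) \<le> I + 1 / real (Suc n)" by metis
  have i: "integrable M (\<phi> n)" "integrable N (\<psi> n)" for n using s(1)[of n] by (auto simp: feasible_def)
  have I1: "(\<integral>x. \<phi> n x \<partial>M) \<le> I + 1" for n using s(5)[of n] by (rule order_trans) simp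
  define mN where "mN = (\<integral>y. y \<partial>N)"
  define mM where "mM = (\<integral>x. x \<partial>M)"
  \<comment> \<open>Since \<psi> n has integral 0, the averaged constraint bounds \<phi> n below by
    a linear function. For \<psi> n the constant is \<open>- (I + 1)\<close>, because the integral
    of \<phi> n is at most I + 1.\<close>
  have lo\<phi>: "mN \<bullet> x + 0 \<le> \<phi> n x" if "x \<in> A" for n x
    using feasible_inner_mean[OF s(1) that, of n] s(4) by (simp add: mN_def inner_commute)
  have lo\<psi>: "mM \<bullet> y + (- (I + 1)) \<le> \<psi> n y" if "y \<in> B" for n y
    using convex_core_pair.feasible_inner_mean[OF swap, of "\<psi> n" "\<phi> n" y] s(1)[of n] that I1[of n]
    by (simp add: feasible_swap mM_def inner_commute)
  have bd\<phi>: "\<exists>K. \<forall>n. \<bar>\<phi> n x\<bar> \<le> K" if x: "x \<in> A" for x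
  proof -
    obtain K where K: "\<And>n. \<phi> n x \<le> K" using \<mu>.approx_subdiff_pointwise_bounded[of \<phi>, OF s(2) i(1) I1 lo\<phi> x] by blast
    have "\<bar>\<phi> n x\<bar> \<le> \<bar>K\<bar> + \<bar>mN \<bullet> x\<bar>" for n using K[of n] lo\<phi>[OF x, of n] by linarith
    then show ?thesis by blast
  qed
  have bd\<psi>: "\<exists>K. \<forall>n. \<bar>\<psi> n y\<bar> \<le> K" if y: "y \<in> B" for y
  proof -
    have le0: "(\<integral>y. \<psi> n y \<partial>N) \<le> 0" for n using s(4) by simp
    obtain K where K: "\<And>n. \<psi> n y \<le> K" using \<nu>.approx_subdiff_pointwise_bounded[of \<psi>, OF s(3) i(2) le0 lo\<psi> y] by blast
    have "\<bar>\<psi> n y\<bar> \<le> \<bar>K\<bar> + \<bar>mM \<bullet> y + (- (I + 1))\<bar>" for n using K[of n] lo\<psi>[OF y, of n] by linarith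
    then show ?thesis by blast
  qed
  have cv: "convex_on A (\<phi> n)" "convex_on B (\<psi> n)" for n
    using approx_subdiff_convex_on[OF \<mu>.convex_A s(2)] approx_subdiff_convex_on[OF \<nu>.convex_A s(3)] by auto
  obtain r where r: "strict_mono r" "\<And>x. x \<in> A \<Longrightarrow> convergent (\<lambda>n. \<phi> (r n) x)"
    using convex_convergent_subsequence[of A \<phi>, OF \<mu>.open_A cv(1) bd\<phi>] by blast
  have bd\<psi>': "\<exists>K. \<forall>n. \<bar>\<psi> (r n) y\<bar> \<le> K" if y: "y \<in> B" for y using bd\<psi>[OF y] by blast
  obtain r' where r': "strict_mono r'" "\<And>y. y \<in> B \<Longrightarrow> convergent (\<lambda>n. \<psi> (r (r' n)) y)"
    using convex_convergent_subsequence[of B "\<lambda>n. \<psi> (r n)", OF \<nu>.open_A cv(2) bd\<psi>'] by blast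
  define q where "q n = r (r' n)" for n
  have q: "strict_mono q" unfolding q_def using r(1) r'(1) by (simp add: strict_mono_def)
  have qn: "n \<le> q n" for n using q seq_suble by blast
  \<comment> \<open>Convergence is known only on A and B, and outside them the value 0 replaces an
    uncontrolled limit; both complements are null.\<close>
  define \<Phi> where "\<Phi> x = (if x \<in> A then lim (\<lambda>n. \<phi> (q n) x) else 0)" for x
  define \<Psi> where "\<Psi> y = (if y \<in> B then lim (\<lambda>n. \<psi> (q n) y) else 0)" for y
  have l\<phi>: "(\<lambda>n. \<phi> (q n) x) \<longlonglongrightarrow> \<Phi> x" if x: "x \<in> A" for x
    using convergent_subseq_convergent[OF r(2)[OF x] r'(1)] x unfolding \<Phi>_def q_def by (simp add: convergent_LIMSEQ_iff comp_def)
  have l\<psi>: "(\<lambda>n. \<psi> (q n) y) \<longlonglongrightarrow> \<Psi> y" if y: "y \<in> B" for y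
    using r'(2)[OF y] y unfolding \<Psi>_def q_def by (simp add: convergent_LIMSEQ_iff)
  have m\<Phi>: "\<Phi> \<in> borel_measurable M"
  proof -
    have [measurable]: "\<phi> n \<in> borel_measurable M" "A \<in> sets M" for n using i \<mu>.open_A \<mu>.sets_M by auto
    show ?thesis unfolding \<Phi>_def[abs_def] by measurable
  qed
  have m\<Psi>: "\<Psi> \<in> borel_measurable N"
  proof -
    have [measurable]: "\<psi> n \<in> borel_measurable N" "B \<in> sets N" for n using i \<nu>.open_A \<nu>.sets_M by auto
    show ?thesis unfolding \<Psi>_def[abs_def] by measurable
  qed
  have "integrable M \<Phi>" "(\<integral>x. \<Phi> x \<partial>M) \<le> I"
  proof -
    have le: "(\<integral>x. \<phi> (q n) x \<partial>M) \<le> I + 1 / real (Suc n)" for n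
    proof -
      have "1 / real (Suc (q n)) \<le> 1 / real (Suc n)" using qn[of n] by (intro divide_left_mono) auto
      then show ?thesis using s(5)[of "q n"] by linarith
    qed
    have "(\<lambda>n. I + 1 / real (Suc n)) \<longlonglongrightarrow> I + 0"
      using LIMSEQ_inverse_real_of_nat by (intro tendsto_intros) (simp add: inverse_eq_divide)
    then have c: "(\<lambda>n. I + 1 / real (Suc n)) \<longlonglongrightarrow> I" by simp
    show "integrable M \<Phi>" "(\<integral>x. \<Phi> x \<partial>M) \<le> I"
      using \<mu>.fatou_bounded_below[of "\<lambda>n. \<phi> (q n)", OF i(1) lo\<phi> l\<phi> m\<Phi> le c] by auto
  qed
  moreover have "integrable N \<Psi>" "(\<integral>y. \<Psi> y \<partial>N) \<le> 0"
  proof -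
    have le: "(\<integral>y. \<psi> (q n) y \<partial>N) \<le> 0" for n using s(4) by simp
    show "integrable N \<Psi>" "(\<integral>y. \<Psi> y \<partial>N) \<le> 0"
      using \<nu>.fatou_bounded_below[of "\<lambda>n. \<psi> (q n)", OF i(2) lo\<psi> l\<psi> m\<Psi> le tendsto_const] by auto
  qed
  moreover have "x \<bullet> y \<le> \<Phi> x + \<Psi> y" if "x \<in> A" "y \<in> B" for x y
    by (rule LIMSEQ_le_const[OF tendsto_add[OF l\<phi>[OF that(1)] l\<psi>[OF that(2)]]]) (use feasibleD[OF s(1) that] in blast)
  \<comment> \<open>Fatou's lemma was applied to each potential separately, with bounds I and 0.
    They add up to I because of the normalisation.\<close>
  ultimately have "feasible \<Phi> \<Psi>" "dual_value \<Phi> \<Psi> \<le> I" by (auto simp: feasible_def)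
  moreover have "I \<le> dual_value \<phi>' \<psi>'" if "feasible \<phi>' \<psi>'" for \<phi>' \<psi>'
    unfolding I_def by (rule cInf_lower[OF _ Vbd]) (use that in \<open>auto simp: V_def\<close>)
  ultimately show ?thesis by (meson order_trans)
qed

text \<open>The first variation perturbs \<psi> and must know that \<phi> is its conjugate. Two
  conjugations of a minimiser achieve this: \<psi> \<le> \<psi>0 makes the conjugate of \<psi> at
  least that of \<psi>0, which is \<phi>, and feasibility gives the converse.\<close>

lemma dual_optimal_pair:
  obtains \<phi> \<psi> where "feasible \<phi> \<psi>" "approx_subdiff A \<phi>" "approx_subdiff B \<psi>"
    "\<phi> \<in> borel_measurable borel" "\<And>x. x \<in> A \<Longrightarrow> \<phi> x = conj_on A B \<psi> x"
    "\<And>\<phi>' \<psi>'. feasible \<phi>' \<psi>' \<Longrightarrow> dual_value \<phi> \<psi> \<le> dual_value \<phi>' \<psi>'"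
proof -
  obtain \<phi>0 \<psi>0 where f: "feasible \<phi>0 \<psi>0" and opt: "\<And>\<phi>' \<psi>'. feasible \<phi>' \<psi>' \<Longrightarrow>
     dual_value \<phi>0 \<psi>0 \<le> dual_value \<phi>' \<psi>'"
    using dual_minimiser_exists by blast
  define \<phi> where "\<phi> = conj_on A B \<psi>0"
  define \<psi> where "\<psi> = conj_on B A \<phi>"
  note 1 = feasible_conj[OF f, folded \<phi>_def]
  note 2 = feasible_conj'[OF 1(1), folded \<psi>_def]
  have le: "\<psi> y \<le> \<psi>0 y" if "y \<in> B" for y
    unfolding \<psi>_def
  proof (rule conj_on_le[OF \<mu>.A_nonempty _ that])
    fix y x assume "y \<in> B" "x \<in> A"
    then show "y \<bullet> x \<le> \<psi>0 y + \<phi> x" using feasibleD[OF 1(1), of x y] by (simp add: inner_commute add.commute)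
  qed
  have "\<phi> x = conj_on A B \<psi> x" if x: "x \<in> A" for x
  proof (rule antisym)
    show "conj_on A B \<psi> x \<le> \<phi> x" by (rule conj_on_le[OF \<nu>.A_nonempty feasibleD[OF 2(1)] x])
    show "\<phi> x \<le> conj_on A B \<psi> x"
      unfolding \<phi>_def
    proof (rule conj_on_le[OF \<nu>.A_nonempty _ x])
      fix x y assume xy: "x \<in> A" "y \<in> B"
      show "x \<bullet> y \<le> conj_on A B \<psi> x + \<psi>0 y"
        using conj_on_upper[OF \<nu>.A_nonempty feasibleD[OF 2(1)] xy] le[OF xy(2)] by simp
    qed
  qed
  moreover have "dual_value \<phi> \<psi> \<le> dual_value \<phi>' \<psi>'" if "feasible \<phi>' \<psi>'" for \<phi>' \<psi>'
    using opt[OF that] 1(3) 2(3) by linarith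
  ultimately show ?thesis using that[of \<phi> \<psi>] 1 2 by blast
qed

end

section \<open>Gradients, first variation and the transport map\<close>

text \<open>Assembled from \<open>dir_deriv\<close>, hence defined and Borel on the whole space,
  with no reference to where f is differentiable.\<close>

definition gradient :: "('a::euclidean_space \<Rightarrow> real) \<Rightarrow> 'a \<Rightarrow> 'a" where
  "gradient f x = (\<Sum>b\<in>Basis. dir_deriv f b x *\<^sub>R b)"

lemma gradient_measurable:
  fixes f :: "'a::euclidean_space \<Rightarrow> real"
  assumes [measurable]: "f \<in> borel_measurable borel"
  shows "gradient f \<in> borel_measurable borel"
  unfolding gradient_def[abs_def] by measurable

lemma has_derivative_has_dir_deriv:
  fixes f :: "'a::real_normed_vector \<Rightarrow> real"
  assumes f: "(f has_derivative D) (at x)"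
  shows "has_dir_deriv f v x (D v)"
proof -
  have "((\<lambda>t. f (x + t *\<^sub>R v)) has_derivative (\<lambda>t. D (t *\<^sub>R v))) (at 0)"
  proof (rule has_derivative_compose[where g=f and g'=D])
    show "((\<lambda>t. x + t *\<^sub>R v) has_derivative (\<lambda>t. t *\<^sub>R v)) (at 0)" by (auto intro!: derivative_eq_intros)
  qed (use f in simp)
  moreover have "(\<lambda>t. D (t *\<^sub>R v)) = (*) (D v)"
    using linear_simps(5)[OF has_derivative_bounded_linear[OF f]] by (auto simp: mult.commute)
  ultimately have "((\<lambda>t. f (x + t *\<^sub>R v)) has_field_derivative D v) (at 0)" by (simp add: has_field_derivative_def)
  then show ?thesis by (simp add: has_dir_deriv_def DERIV_def)
qed

lemma has_derivative_gradient:
  fixes f :: "'a::euclidean_space \<Rightarrow> real"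
  assumes "f differentiable (at x)"
  shows "(f has_derivative (\<lambda>h. h \<bullet> gradient f x)) (at x)"
proof -
  obtain D where D: "(f has_derivative D) (at x)" using assms differentiable_def by blast
  have lin: "linear D" using has_derivative_linear[OF D] .
  have "D h = h \<bullet> gradient f x" for h
  proof -
    have "D h = D (\<Sum>b\<in>Basis. (h \<bullet> b) *\<^sub>R b)" by (simp add: euclidean_representation)
    also have "\<dots> = (\<Sum>b\<in>Basis. (h \<bullet> b) * D b)"
      by (simp add: linear_sum[OF lin] linear_cmul[OF lin])
    also have "\<dots> = (\<Sum>b\<in>Basis. (h \<bullet> b) * dir_deriv f b x)"
      using dir_deriv_eq[OF has_derivative_has_dir_deriv[OF D]] by simp
    also have "\<dots> = h \<bullet> gradient f x" by (simp add: gradient_def inner_sum_right mult.commute)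
    finally show ?thesis .
  qed
  then have "D = (\<lambda>h. h \<bullet> gradient f x)" by blast
  then show ?thesis using D by simp
qed

text \<open>Closed sets form an intersection-stable generator, and the indicator of a closed set is
  the pointwise limit of the continuous functions
  \<open>max 0 (1 - real k * infdist x C)\<close>.\<close>

lemma measure_eqI_bounded_continuous:
  fixes M N :: "'a::metric_space measure"
  assumes M: "prob_space M" "sets M = sets borel" and N: "prob_space N" "sets N = sets borel"
    and eq: "\<And>g::'a \<Rightarrow> real. continuous_on UNIV g \<Longrightarrow> (\<And>x. \<bar>g x\<bar> \<le> 1) \<Longrightarrow> (\<integral>x. g x \<partial>M) = (\<integral>x. g x \<partial>N)"
  shows "M = N"
proof (rule measure_eqI_generator_eq)
  interpret M: prob_space M by fact
  interpret N: prob_space N by fact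
  let ?E = "Collect closed :: 'a set set"
  show "Int_stable ?E" by (auto simp: Int_stable_def)
  show "sets M = sigma_sets UNIV ?E" "sets N = sigma_sets UNIV ?E"
    using M(2) N(2) by (simp_all add: borel_eq_closed)
  show "range (\<lambda>_::nat. UNIV) \<subseteq> ?E" "(\<Union>i::nat. UNIV) = UNIV" by auto
  show "emeasure M UNIV \<noteq> \<infinity>" using M.emeasure_finite by auto
  fix C assume "C \<in> ?E"
  then have C: "closed C" by simp
  show "emeasure M C = emeasure N C"
  proof (cases "C = {}")
    case False
    define g where "g k x = max 0 (1 - real k * infdist x C)" for k :: nat and x
    have gc: "continuous_on UNIV (g k)" for k unfolding g_def by (intro continuous_intros)
    have g1: "\<bar>g k x\<bar> \<le> 1" for k x unfolding g_def using infdist_nonneg[of x C] by auto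
    have lim: "(\<lambda>k. g k x) \<longlonglongrightarrow> indicator C x" for x
    proof (cases "x \<in> C")
      case True
      then show ?thesis by (simp add: g_def)
    next
      case x: False
      then have d: "infdist x C > 0" using C False by (simp add: infdist_pos_not_in_closed)
      then obtain n where n: "1 / infdist x C < real n" using reals_Archimedean2 by blast
      have "g k x = 0" if "k \<ge> n" for k
      proof -
        have "1 / infdist x C \<le> real k" using n that by linarith
        then have "1 \<le> real k * infdist x C" using d by (simp add: divide_le_eq)
        then show ?thesis by (simp add: g_def)
      qed
      then have "eventually (\<lambda>k. g k x = 0) sequentially" unfolding eventually_sequentially by blast
      then show ?thesis using x by (simp add: tendsto_eventually)
    qed
    have dc: "(\<lambda>k. \<integral>x. g k x \<partial>P) \<longlonglongrightarrow> measure P C" if P: "prob_space P" "sets P = sets borel" for P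
    proof -
      interpret P: prob_space P by fact
      have [measurable]: "C \<in> sets P" using C P(2) by simp
      have [measurable]: "g k \<in> borel_measurable P" for k
        using borel_measurable_continuous_onI[OF gc] measurable_cong_sets[OF P(2) refl] by blast
      have "(\<lambda>k. \<integral>x. g k x \<partial>P) \<longlonglongrightarrow> (\<integral>x. indicator C x \<partial>P)"
        by (rule integral_dominated_convergence[where w="\<lambda>_. 1"]) (use lim g1 in auto)
      moreover have "C \<inter> space P = C" using P(2) sets_eq_imp_space_eq[OF P(2)] by simp
      ultimately show ?thesis by simp
    qed
    have "measure M C = measure N C"
      using LIMSEQ_unique[OF dc[OF M] dc[OF N, folded eq[OF gc g1]]] .
    then show ?thesis by (simp add: M.emeasure_eq_measure N.emeasure_eq_measure)
  qed simp
qed auto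

context convex_core_pair
begin

text \<open>By feasibility, a point y that nearly attains the supremum in the conjugate at x is an
  approximate subgradient there, so it is forced towards the gradient.\<close>

lemma conj_maximisers_tendsto:
  assumes f: "feasible \<phi> \<psi>" and x: "x \<in> A" and der: "(\<phi> has_derivative (\<lambda>h. h \<bullet> p)) (at x)"
    and y: "\<And>n. y n \<in> B" "\<And>n. \<phi> x - c n \<le> x \<bullet> y n - \<psi> (y n)" and c: "c \<longlonglongrightarrow> 0"
  shows "y \<longlonglongrightarrow> p"
proof (rule near_subgradients_tendsto[OF \<mu>.open_A x der c])
  fix n z assume "z \<in> A"
  then show "\<phi> x - c n + (z - x) \<bullet> y n \<le> \<phi> z"
    using feasibleD[OF f _ y(1), of z n] y(2)[of n] by (simp add: inner_diff_left)
qed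

text \<open>First variation: perturbing \<open>\<psi>\<close> by \<open>\<delta> g\<close> changes its conjugate by \<open>- \<delta> g (\<nabla>\<phi>)\<close> to first
  order, so optimality forces \<open>\<integral> g (\<nabla>\<phi>) \<partial>M \<le> \<integral> g \<partial>N\<close>.\<close>

lemma first_variation:
  assumes f: "feasible \<phi> \<psi>" and m\<phi>: "\<phi> \<in> borel_measurable borel"
    and cj: "\<And>x. x \<in> A \<Longrightarrow> \<phi> x = conj_on A B \<psi> x"
    and opt: "\<And>\<phi>' \<psi>'. feasible \<phi>' \<psi>' \<Longrightarrow> dual_value \<phi> \<psi> \<le> dual_value \<phi>' \<psi>'"
    and diff: "AE x in M. \<phi> differentiable (at x)"
    and g: "continuous_on UNIV g" "\<And>x. \<bar>g x\<bar> \<le> (1::real)"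
  shows "(\<integral>x. g (gradient \<phi> x) \<partial>M) \<le> (\<integral>y. g y \<partial>N)"
proof -
  define \<delta> where "\<delta> n = 1 / real (Suc n)" for n
  have \<delta>: "\<delta> n > 0" for n by (simp add: \<delta>_def)
  have \<delta>0: "\<delta> \<longlonglongrightarrow> 0" unfolding \<delta>_def[abs_def] using LIMSEQ_inverse_real_of_nat by (simp add: inverse_eq_divide)
  have gb: "g \<in> borel_measurable borel" using g(1) by (rule borel_measurable_continuous_onI)
  have gN: "integrable N g"
    by (rule \<nu>.integrable_const_bound[of _ 1]) (use g gb \<nu>.borel_measurable_iff in auto)
  define \<psi>' where "\<psi>' n y = \<psi> y + \<delta> n * g y" for n y
  define \<phi>' where "\<phi>' n = conj_on A B (\<psi>' n)" for n
  \<comment> \<open>Since |g| \<le> 1, raising \<phi> by \<delta> pays for the perturbation of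
    \<psi>. This certifies that the perturbed conjugate is finite, and it bounds the quotient q by
    1.\<close>
  have f0: "feasible (\<lambda>x. \<phi> x + \<delta> n) (\<psi>' n)" for n
  proof -
    have "x \<bullet> y \<le> \<phi> x + \<delta> n + \<psi>' n y" if "x \<in> A" "y \<in> B" for x y
    proof -
      have "\<delta> n * (- g y) \<le> \<delta> n * 1" using g(2)[of y] \<delta>[of n] by (intro mult_left_mono) (auto simp: abs_le_iff)
      then show ?thesis using feasibleD[OF f that] by (simp add: \<psi>'_def)
    qed
    then show ?thesis using f gN by (auto simp: feasible_def \<psi>'_def[abs_def])
  qed
  note f1 = feasible_conj[OF f0, folded \<phi>'_def]
  define q where "q n x = (\<phi>' n x - \<phi> x) / \<delta> n" for n x
  have i: "integrable M \<phi>" "integrable M (\<phi>' n)" "integrable N \<psi>" for n using f f1(1)[of n] by (auto simp: feasible_def)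
  have q_le: "q n x \<le> 1" if "x \<in> A" for n x
  proof -
    have "\<phi>' n x \<le> \<phi> x + \<delta> n" unfolding \<phi>'_def by (rule conj_on_le[OF \<nu>.A_nonempty feasibleD[OF f0] that])
    then show ?thesis using \<delta>[of n] by (simp add: q_def divide_le_eq)
  qed
  have q_ge: "-1 \<le> q n x" if x: "x \<in> A" for n x
  proof -
    have "\<phi> x \<le> \<phi>' n x + \<delta> n" unfolding cj[OF x]
    proof (rule conj_on_le[OF \<nu>.A_nonempty _ x])
      fix x y assume xy: "x \<in> A" "y \<in> B"
      have "\<delta> n * g y \<le> \<delta> n * 1" using g(2)[of y] \<delta>[of n] by (intro mult_left_mono) (auto simp: abs_le_iff)
      then show "x \<bullet> y \<le> \<phi>' n x + \<delta> n + \<psi> y" using feasibleD[OF f1(1) xy, of n] by (simp add: \<psi>'_def)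
    qed
    then show ?thesis using \<delta>[of n] by (simp add: q_def le_divide_eq)
  qed
  have i_q: "integrable M (q n)" for n unfolding q_def[abs_def] using i by auto
  have q_opt: "0 \<le> (\<integral>x. q n x \<partial>M) + (\<integral>y. g y \<partial>N)" for n
  proof -
    have "dual_value \<phi> \<psi> \<le> dual_value (\<phi>' n) (\<psi>' n)" by (rule opt[OF f1(1)])
    also have "(\<integral>y. \<psi>' n y \<partial>N) = (\<integral>y. \<psi> y \<partial>N) + \<delta> n * (\<integral>y. g y \<partial>N)" unfolding \<psi>'_def using i gN by simp
    finally have "0 \<le> ((\<integral>x. \<phi>' n x \<partial>M) - (\<integral>x. \<phi> x \<partial>M)) + \<delta> n * (\<integral>y. g y \<partial>N)" by simp
    also have "\<dots> = \<delta> n * ((\<integral>x. q n x \<partial>M) + (\<integral>y. g y \<partial>N))"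
      unfolding q_def using i \<delta>[of n] by (simp add: distrib_left)
    finally show ?thesis using \<delta>[of n] by (simp add: zero_le_mult_iff)
  qed
  let ?T = "gradient \<phi>"
  \<comment> \<open>Only an upper bound for q + g (\<nabla>\<phi>) is wanted, so its positive part
    is enough. It is at most 2 on A and tends to 0 almost everywhere, which suits dominated
    convergence.\<close>
  define m where "m n x = max 0 (q n x + g (?T x))" for n x
  have mlim: "(\<lambda>n. m n x) \<longlonglongrightarrow> 0" if x: "x \<in> A" and d: "\<phi> differentiable (at x)" for x
  proof -
    \<comment> \<open>The slack \<delta>^2 is of smaller order than the perturbation \<delta>, so it
      still vanishes after division by \<delta>. Returning to the unperturbed potentials costs
      another \<delta> for \<phi> and one for g, so y n is a maximiser up to 2 \<delta> +
      \<delta>^2.\<close>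
    have "\<exists>y\<in>B. \<phi>' n x - (\<delta> n)\<^sup>2 < x \<bullet> y - \<psi>' n y" for n
      unfolding \<phi>'_def using conj_on_approx[OF \<nu>.A_nonempty feasibleD[OF f0] x, of "(\<delta> n)\<^sup>2" n] \<delta>[of n] by (metis zero_less_power)
    then obtain y where y: "\<And>n. y n \<in> B" "\<And>n. \<phi>' n x - (\<delta> n)\<^sup>2 < x \<bullet> y n - \<psi>' n (y n)" by metis
    have "y \<longlonglongrightarrow> ?T x"
    proof (rule conj_maximisers_tendsto[OF f x has_derivative_gradient[OF d] y(1)])
      show "(\<lambda>n. 2 * \<delta> n + (\<delta> n)\<^sup>2) \<longlonglongrightarrow> 0" using \<delta>0 by (auto intro!: tendsto_eq_intros)
      fix n
      have "\<delta> n * (- g (y n)) \<le> \<delta> n * 1" using g(2)[of "y n"] \<delta>[of n] by (intro mult_left_mono) (auto simp: abs_le_iff)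
      moreover have "\<phi> x \<le> \<phi>' n x + \<delta> n" using q_ge[OF x, of n] \<delta>[of n] by (simp add: q_def le_divide_eq)
      ultimately show "\<phi> x - (2 * \<delta> n + (\<delta> n)\<^sup>2) \<le> x \<bullet> y n - \<psi> (y n)" using y(2)[of n] by (simp add: \<psi>'_def)
    qed
    then have "(\<lambda>n. g (y n)) \<longlonglongrightarrow> g (?T x)"
      using g(1) by (metis continuous_on_eq_continuous_at isCont_tendsto_compose open_UNIV UNIV_I)
    then have lim: "(\<lambda>n. max 0 (g (?T x) - g (y n) + \<delta> n)) \<longlonglongrightarrow> max 0 (g (?T x) - g (?T x) + 0)"
      by (intro tendsto_intros \<delta>0)
    have le: "m n x \<le> max 0 (g (?T x) - g (y n) + \<delta> n)" for n
    proof -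
      have "x \<bullet> y n - \<psi> (y n) \<le> \<phi> x" using feasibleD[OF f x y(1), of n] by simp
      then have "\<phi>' n x - \<phi> x \<le> \<delta> n * (\<delta> n - g (y n))" using y(2)[of n] by (simp add: \<psi>'_def power2_eq_square algebra_simps)
      then have "q n x \<le> \<delta> n - g (y n)" using \<delta>[of n] by (simp add: q_def divide_le_eq mult.commute)
      then show ?thesis unfolding m_def by auto
    qed
    show ?thesis
      by (rule tendsto_sandwich[OF _ _ tendsto_const]) (use lim le in \<open>auto simp: m_def\<close>)
  qed
  have gT: "(\<lambda>x. g (?T x)) \<in> borel_measurable M"
    unfolding \<mu>.borel_measurable_iff using gb gradient_measurable[OF m\<phi>] by measurable
  have i_gT: "integrable M (\<lambda>x. g (?T x))"
    by (rule \<mu>.integrable_const_bound[of _ 1]) (use g gT in auto)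
  have i_m: "integrable M (m n)" for n unfolding m_def[abs_def] using i_q i_gT by auto
  have "(\<lambda>n. \<integral>x. m n x \<partial>M) \<longlonglongrightarrow> (\<integral>x. 0 \<partial>M)"
  proof (rule integral_dominated_convergence[where w = "\<lambda>_. 2"])
    show "AE x in M. (\<lambda>n. m n x) \<longlonglongrightarrow> 0" using \<mu>.AE_A diff by eventually_elim (rule mlim)
    show "AE x in M. norm (m n x) \<le> 2" for n
      using \<mu>.AE_A
    proof eventually_elim
      fix x assume "x \<in> A"
      then show "norm (m n x) \<le> 2" using q_le[of x n] g(2)[of "?T x"] unfolding m_def by auto
    qed
  qed (use i_m in auto)
  moreover have "(\<integral>x. g (?T x) \<partial>M) - (\<integral>y. g y \<partial>N) \<le> (\<integral>x. m n x \<partial>M)" for n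
  proof -
    have "(\<integral>x. q n x \<partial>M) + (\<integral>x. g (?T x) \<partial>M) = (\<integral>x. q n x + g (?T x) \<partial>M)" using i_q i_gT by simp
    also have "\<dots> \<le> (\<integral>x. m n x \<partial>M)" by (rule integral_mono) (use i_q i_gT i_m in \<open>auto simp: m_def\<close>)
    finally show ?thesis using q_opt[of n] by linarith
  qed
  ultimately have "(\<integral>x. g (?T x) \<partial>M) - (\<integral>y. g y \<partial>N) \<le> (\<integral>x. 0 \<partial>M)" by (intro LIMSEQ_le_const) auto
  then show ?thesis by simp
qed

text \<open>Optimality tested with g and with - g identifies the push-forward of M under the
  gradient of \<phi>. The last conclusion says that the dual constraint is tight along the graph of
  T, which is what certifies T as optimal.\<close>

theorem gradient_transport_exists:
  assumes ac: "absolutely_continuous lborel M"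
  obtains T \<phi> \<psi> where "T \<in> borel_measurable borel" "distr M borel T = N" "feasible \<phi> \<psi>"
    "AE x in M. \<phi> x + \<psi> (T x) \<le> x \<bullet> T x"
proof -
  obtain \<phi> \<psi> where f: "feasible \<phi> \<psi>" and sub: "approx_subdiff A \<phi>" "approx_subdiff B \<psi>"
    and m\<phi>: "\<phi> \<in> borel_measurable borel" and cj: "\<And>x. x \<in> A \<Longrightarrow> \<phi> x = conj_on A B \<psi> x"
    and opt: "\<And>\<phi>' \<psi>'. feasible \<phi>' \<psi>' \<Longrightarrow> dual_value \<phi> \<psi> \<le> dual_value \<phi>' \<psi>'"
    by (rule dual_optimal_pair) blast
  let ?T = "gradient \<phi>"
  have T: "?T \<in> borel_measurable borel" by (rule gradient_measurable[OF m\<phi>])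
  have TM: "?T \<in> borel_measurable M" using T by (simp add: \<mu>.borel_measurable_iff)
  have "AE x in lborel. x \<in> A \<longrightarrow> \<phi> differentiable (at x)"
    by (rule rademacher[OF \<mu>.open_A convex_on_locally_lipschitz[OF \<mu>.open_A approx_subdiff_convex_on[OF \<mu>.convex_A sub(1)]]])
  then have "AE x in M. x \<in> A \<longrightarrow> \<phi> differentiable (at x)"
    by (rule absolutely_continuous_AE[OF _ ac, rotated]) (simp add: \<mu>.sets_M)
  with \<mu>.AE_A have diff: "AE x in M. \<phi> differentiable (at x)" by eventually_elim simp
  have push: "distr M borel ?T = N"
  proof (rule measure_eqI_bounded_continuous)
    show "prob_space (distr M borel ?T)" by (rule \<mu>.prob_space_distr[OF TM])
    show "prob_space N" by unfold_locales
    fix g :: "'a \<Rightarrow> real" assume g: "continuous_on UNIV g" "\<And>x. \<bar>g x\<bar> \<le> 1"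
    have "(\<integral>x. g x \<partial>distr M borel ?T) = (\<integral>x. g (?T x) \<partial>M)"
      by (rule integral_distr[OF TM borel_measurable_continuous_onI[OF g(1)]])
    moreover have "(\<integral>x. g (?T x) \<partial>M) \<le> (\<integral>y. g y \<partial>N)" by (rule first_variation[OF f m\<phi> cj opt diff g])
    moreover have "(\<integral>x. - g (?T x) \<partial>M) \<le> (\<integral>y. - g y \<partial>N)"
      by (rule first_variation[OF f m\<phi> cj opt diff, of "\<lambda>x. - g x"]) (use g in \<open>auto intro: continuous_intros\<close>)
    ultimately show "(\<integral>x. g x \<partial>distr M borel ?T) = (\<integral>x. g x \<partial>N)" by simp
  qed (use \<nu>.sets_M in auto)
  \<comment> \<open>N is concentrated on B and is the push-forward, so T x lies in the open set B
    for almost every x. The convex \<psi> is continuous there, so near maximisers converging to T x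
    pass the equality on to T x.\<close>
  have "AE y in distr M borel ?T. y \<in> B" unfolding push by (rule \<nu>.AE_A)
  then have TB: "AE x in M. ?T x \<in> B" by (subst (asm) AE_distr_iff[OF TM]) (use \<nu>.open_A in auto)
  have "AE x in M. \<phi> x + \<psi> (?T x) \<le> x \<bullet> ?T x"
    using \<mu>.AE_A diff TB
  proof eventually_elim
    fix x assume x: "x \<in> A" and d: "\<phi> differentiable (at x)" and TxB: "?T x \<in> B"
    have "\<exists>y\<in>B. \<phi> x - 1 / real (Suc n) < x \<bullet> y - \<psi> y" for n
      unfolding cj[OF x] using conj_on_approx[OF \<nu>.A_nonempty feasibleD[OF f] x, of "1 / real (Suc n)"] by (metis of_nat_0_less_iff zero_less_Suc zero_less_divide_1_iff)
    then obtain y where y: "\<And>n. y n \<in> B" "\<And>n. \<phi> x - 1 / real (Suc n) < x \<bullet> y n - \<psi> (y n)" by metis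
    have l0: "(\<lambda>n. 1 / real (Suc n)) \<longlonglongrightarrow> 0" using LIMSEQ_inverse_real_of_nat by (simp add: inverse_eq_divide)
    have yT: "y \<longlonglongrightarrow> ?T x"
      by (rule conj_maximisers_tendsto[OF f x has_derivative_gradient[OF d] y(1) _ l0]) (use y(2) less_imp_le in blast)
    have "isCont \<psi> (?T x)"
      using convex_on_continuous[OF \<nu>.open_A approx_subdiff_convex_on[OF \<nu>.convex_A sub(2)]] TxB \<nu>.open_A
      by (simp add: continuous_on_eq_continuous_at)
    then have "(\<lambda>n. \<psi> (y n)) \<longlonglongrightarrow> \<psi> (?T x)" using yT by (rule isCont_tendsto_compose)
    then have "(\<lambda>n. x \<bullet> y n - \<psi> (y n) + 1 / real (Suc n)) \<longlonglongrightarrow> x \<bullet> ?T x - \<psi> (?T x) + 0"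
      by (intro tendsto_intros yT l0)
    then have "\<phi> x \<le> x \<bullet> ?T x - \<psi> (?T x) + 0"
      by (rule LIMSEQ_le_const) (use y(2) in \<open>auto simp: diff_less_eq intro!: less_imp_le\<close>)
    then show "\<phi> x + \<psi> (?T x) \<le> x \<bullet> ?T x" by simp
  qed
  then show ?thesis using that T push f by blast
qed

end

section \<open>Transport and product measures\<close>

lemma P2acD:
  assumes "P2ac \<mu>"
  shows "prob_space \<mu>" "sets \<mu> = sets borel" "space \<mu> = UNIV" "integrable \<mu> (\<lambda>x. (norm x)\<^sup>2)" "absolutely_continuous lborel \<mu>"
  using assms sets_eq_imp_space_eq[of \<mu> borel] by (auto simp: P2ac_def)

text \<open>The quadratic cost is |x|^2 + |y|^2 - 2 x . y, and the first two terms have the same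
  integral for every coupling. Minimal cost is therefore maximal correlation; the dual value bounds
  the correlation of every coupling, and T attains it.\<close>

theorem ot_map_exists:
  assumes \<mu>: "P2ac \<mu>" and \<nu>: "P2ac \<nu>"
  shows "\<exists>T. is_ot_map \<mu> \<nu> T"
proof -
  obtain A where A: "convex_core \<mu> A" using ac_convex_core[OF P2acD(1,2,4,5)[OF \<mu>]] .
  obtain B where B: "convex_core \<nu> B" using ac_convex_core[OF P2acD(1,2,4,5)[OF \<nu>]] .
  interpret convex_core_pair \<mu> \<nu> A B using A B by (simp add: convex_core_pair_def)
  obtain T \<phi> \<psi> where T[measurable]: "T \<in> borel_measurable borel" and push: "distr \<mu> borel T = \<nu>" and f: "feasible \<phi> \<psi>"
    and le: "AE x in \<mu>. \<phi> x + \<psi> (T x) \<le> x \<bullet> T x"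
    by (rule gradient_transport_exists[OF P2acD(5)[OF \<mu>]]) blast
  have TM: "T \<in> borel_measurable \<mu>" using T by (simp add: \<mu>.borel_measurable_iff)
  have i\<phi>: "integrable \<mu> \<phi>" and i\<psi>: "integrable \<nu> \<psi>" using f by (auto simp: feasible_def)
  have m\<psi>: "\<psi> \<in> borel_measurable borel" using i\<psi> \<nu>.borel_measurable_iff by blast
  have iT2: "integrable \<mu> (\<lambda>x. (norm (T x))\<^sup>2)" and eT2: "(\<integral>x. (norm (T x))\<^sup>2 \<partial>\<mu>) = (\<integral>y. (norm y)\<^sup>2 \<partial>\<nu>)"
    using \<nu>.sq_integrable unfolding push[symmetric] by (simp_all add: integrable_distr_eq[OF TM] integral_distr[OF TM])
  have i\<psi>T: "integrable \<mu> (\<lambda>x. \<psi> (T x))" and e\<psi>T: "(\<integral>x. \<psi> (T x) \<partial>\<mu>) = (\<integral>y. \<psi> y \<partial>\<nu>)"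
    using i\<psi> m\<psi> unfolding push[symmetric] by (simp_all add: integrable_distr_eq[OF TM] integral_distr[OF TM])
  have inner_bound: "\<bar>x \<bullet> y\<bar> \<le> (norm x)\<^sup>2 + (norm y)\<^sup>2" for x y :: "real^'a"
  proof -
    have "\<bar>x \<bullet> y\<bar> \<le> norm x * norm y" by (rule Cauchy_Schwarz_ineq2)
    also have "\<dots> \<le> (norm x)\<^sup>2 + (norm y)\<^sup>2"
      using zero_le_power2[of "norm x - norm y"] mult_nonneg_nonneg[OF norm_ge_zero norm_ge_zero, of x y]
      unfolding power2_diff by linarith
    finally show ?thesis .
  qed
  have ixT: "integrable \<mu> (\<lambda>x. x \<bullet> T x)"
  proof (rule Bochner_Integration.integrable_bound)
    show "integrable \<mu> (\<lambda>x. (norm x)\<^sup>2 + (norm (T x))\<^sup>2)" using \<mu>.sq_integrable iT2 by simp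
    show "AE x in \<mu>. norm (x \<bullet> T x) \<le> norm ((norm x)\<^sup>2 + (norm (T x))\<^sup>2)" using inner_bound by simp
    show "(\<lambda>x. x \<bullet> T x) \<in> borel_measurable \<mu>" unfolding \<mu>.borel_measurable_iff by measurable
  qed
  have dual: "(\<integral>x. \<phi> x \<partial>\<mu>) + (\<integral>y. \<psi> y \<partial>\<nu>) \<le> (\<integral>x. x \<bullet> T x \<partial>\<mu>)"
  proof -
    have "(\<integral>x. \<phi> x + \<psi> (T x) \<partial>\<mu>) \<le> (\<integral>x. x \<bullet> T x \<partial>\<mu>)"
      by (rule integral_mono_AE) (use i\<phi> i\<psi>T ixT le in auto)
    then show ?thesis using i\<phi> i\<psi>T e\<psi>T by simp
  qed
  have sq: "(dist x y)\<^sup>2 = (norm x)\<^sup>2 + (norm y)\<^sup>2 - 2 * (x \<bullet> y)" for x y :: "real^'a"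
    by (simp add: dist_norm power2_norm_eq_inner inner_diff_left inner_diff_right inner_commute)
  have "is_ot_map \<mu> \<nu> T"
    unfolding is_ot_map_def
  proof (intro conjI allI impI T push)
    fix \<pi> assume "coupling \<mu> \<nu> \<pi>"
    then have p: "prob_space \<pi>" "sets \<pi> = sets borel" "distr \<pi> borel fst = \<mu>" "distr \<pi> borel snd = \<nu>"
      by (auto simp: coupling_def)
    have [measurable]: "fst \<in> borel_measurable \<pi>" "snd \<in> borel_measurable \<pi>"
      unfolding measurable_cong_sets[OF p(2) refl] by (auto intro!: borel_measurable_continuous_onI continuous_intros)
    have m\<phi>: "\<phi> \<in> borel_measurable borel" using i\<phi> \<mu>.borel_measurable_iff by blast
    have tr1: "integrable \<pi> (\<lambda>z. g (fst z))" "(\<integral>z. g (fst z) \<partial>\<pi>) = (\<integral>x. g x \<partial>\<mu>)" if "integrable \<mu> g" for g :: "real^'a \<Rightarrow> real"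
    proof -
      have "g \<in> borel_measurable borel" using that \<mu>.borel_measurable_iff by blast
      then show "integrable \<pi> (\<lambda>z. g (fst z))" "(\<integral>z. g (fst z) \<partial>\<pi>) = (\<integral>x. g x \<partial>\<mu>)"
        using integrable_distr_eq[of fst \<pi> borel g] integral_distr[of fst \<pi> borel g] that by (simp_all add: p(3))
    qed
    have tr2: "integrable \<pi> (\<lambda>z. g (snd z))" "(\<integral>z. g (snd z) \<partial>\<pi>) = (\<integral>x. g x \<partial>\<nu>)" if "integrable \<nu> g" for g :: "real^'a \<Rightarrow> real"
    proof -
      have "g \<in> borel_measurable borel" using that \<nu>.borel_measurable_iff by blast
      then show "integrable \<pi> (\<lambda>z. g (snd z))" "(\<integral>z. g (snd z) \<partial>\<pi>) = (\<integral>x. g x \<partial>\<nu>)"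
        using integrable_distr_eq[of snd \<pi> borel g] integral_distr[of snd \<pi> borel g] that by (simp_all add: p(4))
    qed
    have "AE x in distr \<pi> borel fst. x \<in> A" unfolding p(3) by (rule \<mu>.AE_A)
    then have A: "AE z in \<pi>. fst z \<in> A" by (subst (asm) AE_distr_iff) (use \<mu>.open_A in auto)
    have "AE x in distr \<pi> borel snd. x \<in> B" unfolding p(4) by (rule \<nu>.AE_A)
    then have B: "AE z in \<pi>. snd z \<in> B" by (subst (asm) AE_distr_iff) (use \<nu>.open_A in auto)
    have ipi: "integrable \<pi> (\<lambda>z. fst z \<bullet> snd z)"
    proof (rule Bochner_Integration.integrable_bound)
      show "integrable \<pi> (\<lambda>z. (norm (fst z))\<^sup>2 + (norm (snd z))\<^sup>2)"
        using tr1(1)[OF \<mu>.sq_integrable] tr2(1)[OF \<nu>.sq_integrable] by simp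
      show "AE z in \<pi>. norm (fst z \<bullet> snd z) \<le> norm ((norm (fst z))\<^sup>2 + (norm (snd z))\<^sup>2)" using inner_bound by simp
    qed measurable
    have "(\<integral>z. fst z \<bullet> snd z \<partial>\<pi>) \<le> (\<integral>z. \<phi> (fst z) + \<psi> (snd z) \<partial>\<pi>)"
    proof (rule integral_mono_AE[OF ipi])
      show "AE z in \<pi>. fst z \<bullet> snd z \<le> \<phi> (fst z) + \<psi> (snd z)"
        using A B by eventually_elim (rule feasibleD[OF f])
    qed (use tr1(1)[OF i\<phi>] tr2(1)[OF i\<psi>] in simp)
    also have "\<dots> = (\<integral>x. \<phi> x \<partial>\<mu>) + (\<integral>y. \<psi> y \<partial>\<nu>)" using tr1[OF i\<phi>] tr2[OF i\<psi>] by simp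
    finally have key: "(\<integral>z. fst z \<bullet> snd z \<partial>\<pi>) \<le> (\<integral>x. x \<bullet> T x \<partial>\<mu>)" using dual by linarith
    have i1: "integrable \<mu> (\<lambda>x. (dist (T x) x)\<^sup>2)"
      unfolding sq using \<mu>.sq_integrable iT2 ixT by (simp add: inner_commute)
    have i2: "integrable \<pi> (\<lambda>z. (dist (fst z) (snd z))\<^sup>2)"
      unfolding sq using tr1(1)[OF \<mu>.sq_integrable] tr2(1)[OF \<nu>.sq_integrable] ipi by simp
    have "(\<integral>x. (dist (T x) x)\<^sup>2 \<partial>\<mu>) = (\<integral>x. (norm x)\<^sup>2 \<partial>\<mu>) + (\<integral>y. (norm y)\<^sup>2 \<partial>\<nu>) - 2 * (\<integral>x. x \<bullet> T x \<partial>\<mu>)"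
      unfolding sq using \<mu>.sq_integrable iT2 ixT eT2 by (simp add: inner_commute)
    moreover have "(\<integral>z. (dist (fst z) (snd z))\<^sup>2 \<partial>\<pi>) = (\<integral>x. (norm x)\<^sup>2 \<partial>\<mu>) + (\<integral>y. (norm y)\<^sup>2 \<partial>\<nu>) - 2 * (\<integral>z. fst z \<bullet> snd z \<partial>\<pi>)"
      unfolding sq using tr1[OF \<mu>.sq_integrable] tr2[OF \<nu>.sq_integrable] ipi by simp
    ultimately have "(\<integral>x. (dist (T x) x)\<^sup>2 \<partial>\<mu>) \<le> (\<integral>z. (dist (fst z) (snd z))\<^sup>2 \<partial>\<pi>)" using key by linarith
    then show "(\<integral>\<^sup>+x. ennreal ((dist (T x) x)\<^sup>2) \<partial>\<mu>) \<le> (\<integral>\<^sup>+z. ennreal ((dist (fst z) (snd z))\<^sup>2) \<partial>\<pi>)"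
      using i1 i2 by (simp add: nn_integral_eq_integral ennreal_leI)
  qed
  then show ?thesis by blast
qed

lemma ot_map:
  assumes "P2ac \<mu>" "P2ac \<nu>"
  shows "ot_map \<mu> \<nu> \<in> borel_measurable borel" "distr \<mu> borel (ot_map \<mu> \<nu>) = \<nu>"
  using someI_ex[OF ot_map_exists[OF assms]] by (auto simp: ot_map_def is_ot_map_def)

section \<open>Laws of samples as measures on vectors\<close>

lemma sets_PiM_borel:
  assumes "\<And>i. sets (M i) = sets borel"
  shows "sets (PiM I M) = sets (PiM I (\<lambda>_. borel))"
  by (rule sets_PiM_cong) (use assms in auto)

lemma vec_lambda_measurable:
  fixes M :: "'n::finite \<Rightarrow> ('a::euclidean_space) measure"
  assumes "\<And>i. sets (M i) = sets borel"
  shows "vec_lambda \<in> borel_measurable (PiM UNIV M)"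
proof -
  have "(\<lambda>\<omega>. vec_lambda \<omega> \<bullet> b) \<in> borel_measurable (PiM UNIV (\<lambda>_::'n. borel :: 'a measure))" if b: "b \<in> Basis" for b :: "'a^'n"
  proof -
    obtain i c where "b = axis i c" "c \<in> Basis" using b by (auto simp: Basis_vec_def)
    then show ?thesis by (simp add: inner_axis)
  qed
  then have "vec_lambda \<in> borel_measurable (PiM UNIV (\<lambda>_::'n. borel :: 'a measure))"
    by (subst borel_measurable_euclidean_space) blast
  then show ?thesis unfolding measurable_cong_sets[OF sets_PiM_borel[where M=M, OF assms] refl] .
qed

lemma vec_nth_measurable [measurable]: "(\<lambda>X. X $ i) \<in> borel_measurable (borel :: ('a::euclidean_space^'n) measure)"
  by (intro borel_measurable_continuous_onI continuous_intros)

lemma vec_map_measurable: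
  fixes T :: "'a::euclidean_space \<Rightarrow> 'b::euclidean_space"
  assumes [measurable]: "T \<in> borel_measurable borel"
  shows "(\<lambda>X. \<chi> i. T (X $ i)) \<in> borel_measurable (borel :: ('a^'n) measure)"
proof (subst borel_measurable_euclidean_space, rule ballI)
  fix b :: "'b^'n" assume "b \<in> Basis"
  then obtain i c where "b = axis i c" "c \<in> Basis" by (auto simp: Basis_vec_def)
  then show "(\<lambda>X::'a^'n. (\<chi> i. T (X $ i)) \<bullet> b) \<in> borel_measurable borel" by (simp add: inner_axis)
qed

text \<open>The bridge from product measures on functions to the Euclidean space of samples:
  Lebesgue null sets there correspond to null sets of the product.\<close>

lemma lborel_vec: "distr (PiM UNIV (\<lambda>_::'n::finite. lborel :: 'a::euclidean_space measure)) borel vec_lambda = (lborel :: ('a^'n) measure)"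
proof (rule lborel_eqI[symmetric])
  interpret product_sigma_finite "\<lambda>_::'n. lborel :: 'a measure" ..
  fix l u :: "'a^'n" assume le: "\<And>b. b \<in> Basis \<Longrightarrow> l \<bullet> b \<le> u \<bullet> b"
  have le': "l $ i \<bullet> c \<le> u $ i \<bullet> c" if "c \<in> Basis" for i c
    using le[of "axis i c"] that by (simp add: inner_axis)
  have box: "vec_lambda -` box l u \<inter> space (PiM UNIV (\<lambda>_::'n. lborel :: 'a measure)) = (\<Pi>\<^sub>E i\<in>UNIV. box (l $ i) (u $ i))"
    by (auto simp: mem_box Basis_vec_def inner_axis space_PiM PiE_def Pi_def)
  have "emeasure (distr (PiM UNIV (\<lambda>_::'n. lborel :: 'a measure)) borel vec_lambda) (box l u) =
      emeasure (PiM UNIV (\<lambda>_::'n. lborel :: 'a measure)) (\<Pi>\<^sub>E i\<in>UNIV. box (l $ i) (u $ i))"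
    by (subst emeasure_distr) (auto simp: box intro!: vec_lambda_measurable)
  also have "\<dots> = (\<Prod>i\<in>UNIV. emeasure lborel (box (l $ i) (u $ i)))" by (rule emeasure_PiM) auto
  also have "\<dots> = (\<Prod>i\<in>UNIV. ennreal (\<Prod>c\<in>Basis. (u $ i - l $ i) \<bullet> c))" using le' by simp
  also have "\<dots> = ennreal (\<Prod>i\<in>UNIV. \<Prod>c\<in>Basis. (u $ i - l $ i) \<bullet> c)"
    by (rule prod_ennreal) (use le' in \<open>auto simp: inner_diff_left intro!: prod_nonneg\<close>)
  also have "(\<Prod>i\<in>UNIV. \<Prod>c\<in>Basis. (u $ i - l $ i) \<bullet> c) = (\<Prod>b\<in>Basis. (u - l) \<bullet> b)"
  proof -
    have inj: "inj_on (\<lambda>(i::'n, c). axis i c) (UNIV \<times> (Basis :: 'a set))"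
      by (auto simp: inj_on_def axis_eq_axis)
    have "(Basis :: ('a^'n) set) = (\<lambda>(i, c). axis i c) ` (UNIV \<times> Basis)" by (auto simp: Basis_vec_def)
    then have "(\<Prod>b\<in>Basis. (u - l) \<bullet> b) = prod (\<lambda>b. (u - l) \<bullet> b) ((\<lambda>(i, c). axis i c) ` (UNIV \<times> Basis))"
      by (rule arg_cong)
    also have "\<dots> = (\<Prod>(i, c)\<in>UNIV \<times> Basis. (u - l) \<bullet> axis i c)"
      by (subst prod.reindex[OF inj]) (simp add: case_prod_beta' o_def)
    also have "\<dots> = (\<Prod>i\<in>UNIV. \<Prod>c\<in>Basis. (u $ i - l $ i) \<bullet> c)"
      by (simp add: prod.cartesian_product inner_axis)
    finally show ?thesis by simp
  qed
  finally show "emeasure (distr (PiM UNIV (\<lambda>_::'n. lborel :: 'a measure)) borel vec_lambda) (box l u) = ennreal (\<Prod>b\<in>Basis. (u - l) \<bullet> b)" .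
qed simp

context
  fixes \<mu> :: "(real^'d) measure"
  assumes prob: "prob_space \<mu>" and sets_\<mu> [measurable_cong]: "sets \<mu> = sets borel"
begin

lemma sets_iid [simp, measurable_cong]: "sets (iid \<mu> :: (real^'d^'n) measure) = sets borel"
  by (simp add: iid_def)

lemma space_iid [simp]: "space (iid \<mu> :: (real^'d^'n) measure) = UNIV"
  by (simp add: iid_def)

lemma prob_space_iid: "prob_space (iid \<mu> :: (real^'d^'n) measure)"
proof -
  interpret product_prob_space "\<lambda>_::'n. \<mu>" UNIV
    using prob by (simp add: product_prob_space_def product_prob_space_axioms_def product_sigma_finite_def prob_space_imp_sigma_finite)
  show ?thesis unfolding iid_def by (rule prob_space_distr) (rule vec_lambda_measurable, rule sets_\<mu>)
qed

lemma distr_iid_nth: "distr (iid \<mu> :: (real^'d^'n) measure) borel (\<lambda>X. X $ i) = \<mu>"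
proof -
  have "distr (iid \<mu> :: (real^'d^'n) measure) borel (\<lambda>X. X $ i) = distr (PiM UNIV (\<lambda>_::'n. \<mu>)) borel (\<lambda>\<omega>. \<omega> i)"
    unfolding iid_def by (subst distr_distr) (auto intro!: vec_lambda_measurable sets_\<mu> simp: comp_def)
  also have "\<dots> = distr (PiM UNIV (\<lambda>_::'n. \<mu>)) \<mu> (\<lambda>\<omega>. \<omega> i)"
    by (rule distr_cong) (auto simp: sets_\<mu>)
  also have "\<dots> = \<mu>" by (rule distr_PiM_component[of UNIV "\<lambda>_. \<mu>" i]) (use prob in auto)
  finally show ?thesis .
qed

lemma iid_nth_integral:
  fixes f :: "real^'d \<Rightarrow> 'b::{banach, second_countable_topology}"
  assumes "f \<in> borel_measurable borel"
  shows "(\<integral>X. f (X $ i) \<partial>(iid \<mu> :: (real^'d^'n) measure)) = (\<integral>x. f x \<partial>\<mu>)"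
    "integrable (iid \<mu> :: (real^'d^'n) measure) (\<lambda>X. f (X $ i)) \<longleftrightarrow> integrable \<mu> f"
proof -
  have m: "(\<lambda>X. X $ i) \<in> borel_measurable (iid \<mu> :: (real^'d^'n) measure)" by measurable
  show "(\<integral>X. f (X $ i) \<partial>(iid \<mu> :: (real^'d^'n) measure)) = (\<integral>x. f x \<partial>\<mu>)"
    using integral_distr[OF m assms] unfolding distr_iid_nth by simp
  show "integrable (iid \<mu> :: (real^'d^'n) measure) (\<lambda>X. f (X $ i)) \<longleftrightarrow> integrable \<mu> f"
    using integrable_distr_eq[OF m assms] unfolding distr_iid_nth by simp
qed

text \<open>A map applied to each observation turns a sample from \<mu> into a sample from the image
  law. An expectation at another parameter thereby becomes an expectation at the base
  parameter.\<close>

lemma iid_push: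
  assumes T: "T \<in> borel_measurable borel"
  shows "distr (iid \<mu>) borel (\<lambda>X. \<chi> i. T (X $ i)) = (iid (distr \<mu> borel T) :: (real^'d^'n) measure)"
proof -
  have TM: "T \<in> \<mu> \<rightarrow>\<^sub>M borel" using T measurable_cong_sets[OF sets_\<mu> refl] by blast
  let ?\<nu> = "distr \<mu> borel T"
  have p\<nu>: "prob_space ?\<nu>" using prob TM by (simp add: prob_space.prob_space_distr)
  let ?PB = "PiM UNIV (\<lambda>_::'n. distr \<mu> borel T)"
  have "iid ?\<nu> = distr ?PB borel (vec_lambda :: _ \<Rightarrow> real^'d^'n)" by (simp add: iid_def)
  also have "?PB = distr (PiM UNIV (\<lambda>_::'n. \<mu>)) (PiM UNIV (\<lambda>_. ?\<nu>)) (compose UNIV T)"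
  proof -
    have "distr (PiM UNIV (\<lambda>_::'n. \<mu>)) (PiM UNIV (\<lambda>_. ?\<nu>)) (compose UNIV T) = PiM UNIV (\<lambda>_::'n. distr \<mu> ?\<nu> T)"
    proof (rule distr_PiM_finite_prob_space)
      show "product_prob_space (\<lambda>_::'n. \<mu>)" "product_prob_space (\<lambda>_::'n. ?\<nu>)"
        using prob p\<nu> by (simp_all add: product_prob_space_def product_prob_space_axioms_def product_sigma_finite_def prob_space_imp_sigma_finite)
      show "T \<in> measurable \<mu> ?\<nu>" using TM by simp
    qed simp
    also have "distr \<mu> ?\<nu> T = ?\<nu>" by (rule distr_cong) auto
    finally show ?thesis by simp
  qed
  also have "distr (distr (PiM UNIV (\<lambda>_::'n. \<mu>)) (PiM UNIV (\<lambda>_. ?\<nu>)) (compose UNIV T)) borel (vec_lambda :: _ \<Rightarrow> real^'d^'n)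
      = distr (PiM UNIV (\<lambda>_::'n. \<mu>)) borel (vec_lambda \<circ> compose UNIV T)"
  proof (rule distr_distr)
    show "vec_lambda \<in> PiM UNIV (\<lambda>_::'n. ?\<nu>) \<rightarrow>\<^sub>M borel" by (rule vec_lambda_measurable) simp
    show "compose UNIV T \<in> PiM UNIV (\<lambda>_::'n. \<mu>) \<rightarrow>\<^sub>M PiM UNIV (\<lambda>_. ?\<nu>)"
      using TM by (intro measurable_PiM_single') (auto simp: compose_def)
  qed
  also have "\<dots> = distr (iid \<mu>) borel (\<lambda>X. \<chi> i. T (X $ i))"
  proof -
    have "(\<lambda>X. \<chi> i. T (X $ i)) \<circ> vec_lambda = (vec_lambda \<circ> compose UNIV T :: _ \<Rightarrow> real^'d^'n)"
      by (rule ext) (simp add: compose_def vec_eq_iff)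
    then show ?thesis unfolding iid_def
      by (subst distr_distr[OF vec_map_measurable[OF T] vec_lambda_measurable[of "\<lambda>_. \<mu>", OF sets_\<mu>]]) simp
  qed
  finally show ?thesis by simp
qed

text \<open>The product of the marginal densities is a density of the product law. This makes the
  exceptional set of Rademacher's theorem on the sample space null for the sample.\<close>

lemma iid_absolutely_continuous:
  assumes ac: "absolutely_continuous lborel \<mu>"
  shows "absolutely_continuous lborel (iid \<mu> :: (real^'d^'n) measure)"
proof -
  obtain f where f[measurable]: "f \<in> borel_measurable lborel" and fd: "density lborel f = \<mu>"
    using sigma_finite_measure.density_RN_deriv[OF sigma_finite_lborel ac] sets_\<mu> borel_measurable_RN_deriv
    by (metis sets_lborel)
  let ?L = "PiM UNIV (\<lambda>_::'n. lborel :: (real^'d) measure)"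
  interpret L: product_sigma_finite "\<lambda>_::'n. lborel :: (real^'d) measure" ..
  interpret P: product_sigma_finite "\<lambda>_::'n. \<mu>"
    using prob by (simp add: product_sigma_finite_def prob_space_imp_sigma_finite)
  let ?F = "\<lambda>\<omega>. \<Prod>i\<in>UNIV. f (\<omega> i)"
  have [measurable]: "?F \<in> borel_measurable ?L" by measurable
  have "density ?L ?F = PiM UNIV (\<lambda>_::'n. \<mu>)"
  proof (rule P.PiM_eqI)
    show "sets (density ?L ?F) = sets (PiM UNIV (\<lambda>_::'n. \<mu>))"
      using sets_PiM_borel[of "\<lambda>_::'n. \<mu>"] sets_PiM_borel[of "\<lambda>_::'n. lborel :: (real^'d) measure"] sets_\<mu> by simp
    fix A :: "'n \<Rightarrow> (real^'d) set" assume "\<And>i. i \<in> UNIV \<Longrightarrow> A i \<in> sets \<mu>"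
    then have A[measurable]: "A i \<in> sets borel" for i by (simp add: sets_\<mu>)
    have "emeasure (density ?L ?F) (Pi\<^sub>E UNIV A) = (\<integral>\<^sup>+\<omega>. ?F \<omega> * indicator (Pi\<^sub>E UNIV A) \<omega> \<partial>?L)"
      by (rule emeasure_density) (auto intro!: sets_PiM_I_finite)
    also have "\<dots> = (\<integral>\<^sup>+\<omega>. (\<Prod>i\<in>UNIV. f (\<omega> i) * indicator (A i) (\<omega> i)) \<partial>?L)"
    proof (rule nn_integral_cong)
      fix \<omega> :: "'n \<Rightarrow> real^'d"
      show "?F \<omega> * indicator (Pi\<^sub>E UNIV A) \<omega> = (\<Prod>i\<in>UNIV. f (\<omega> i) * indicator (A i) (\<omega> i))"
      proof (cases "\<omega> \<in> Pi\<^sub>E UNIV A")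
        case True
        then have "\<omega> i \<in> A i" for i by auto
        then show ?thesis using True by simp
      next
        case False
        then obtain i where "\<omega> i \<notin> A i" by auto
        then have "(\<Prod>i\<in>UNIV. f (\<omega> i) * indicator (A i) (\<omega> i)) = 0" by (intro prod_zero) (auto intro: exI[of _ i])
        then show ?thesis using False by simp
      qed
    qed
    also have "\<dots> = (\<Prod>i\<in>UNIV. \<integral>\<^sup>+x. f x * indicator (A i) x \<partial>lborel)"
      by (rule L.product_nn_integral_prod) auto
    also have "\<dots> = (\<Prod>i\<in>UNIV. emeasure \<mu> (A i))"
      unfolding fd[symmetric] by (intro prod.cong refl emeasure_density[symmetric]) auto
    finally show "emeasure (density ?L ?F) (Pi\<^sub>E UNIV A) = (\<Prod>i\<in>UNIV. emeasure \<mu> (A i))" .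
  qed simp
  note dens = this
  show ?thesis
    unfolding absolutely_continuous_def
  proof
    fix N :: "(real^'d^'n) set" assume N: "N \<in> null_sets lborel"
    have vm: "vec_lambda \<in> ?L \<rightarrow>\<^sub>M (borel :: (real^'d^'n) measure)" by (rule vec_lambda_measurable) simp
    have NB: "N \<in> sets borel" using null_setsD2[OF N] by simp
    have "emeasure ?L (vec_lambda -` N \<inter> space ?L) = 0"
      using null_setsD1[OF N] emeasure_distr[OF vm NB] by (simp add: lborel_vec)
    then have n: "vec_lambda -` N \<inter> space ?L \<in> null_sets ?L" using measurable_sets[OF vm NB] by (intro null_setsI)
    have "absolutely_continuous ?L (density ?L ?F)" by (rule absolutely_continuousI_density) simp
    with n have "vec_lambda -` N \<inter> space ?L \<in> null_sets (density ?L ?F)"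
      by (auto simp: absolutely_continuous_def)
    then have "vec_lambda -` N \<inter> space ?L \<in> null_sets (PiM UNIV (\<lambda>_::'n. \<mu>))" by (simp only: dens)
    moreover have "space ?L = space (PiM UNIV (\<lambda>_::'n. \<mu>))" using dens by (metis space_density)
    ultimately have "emeasure (iid \<mu>) N = 0"
      unfolding iid_def using NB by (subst emeasure_distr) (auto intro!: vec_lambda_measurable sets_\<mu>)
    then show "N \<in> null_sets (iid \<mu>)" using NB by (intro null_setsI) auto
  qed
qed

end

section \<open>The Cramer-Rao bound\<close>

lemma lipschitz_on_cball_if_locally:
  fixes f :: "'a::euclidean_space \<Rightarrow> 'b::euclidean_space"
  assumes "locally_lipschitz f"
  obtains L where "L-lipschitz_on (cball x r) f"
proof -
  \<comment> \<open>\<open>local_lipschitz\<close> concerns functions of time and space; f is read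
    as a function constant in time, over the single time 0.\<close>
  have "local_lipschitz {0::real} (cball x r) (\<lambda>_. f)"
    unfolding local_lipschitz_def
  proof (intro ballI)
    fix y and t :: real
    obtain e L where e: "e > 0" "L-lipschitz_on (ball y e) f" using assms unfolding locally_lipschitz_def by blast
    have "L-lipschitz_on (cball y (e/2) \<inter> cball x r) f"
      by (rule lipschitz_on_subset[OF e(2)]) (use e(1) in auto)
    then show "\<exists>u>0. \<exists>L. \<forall>t\<in>cball t u \<inter> {0}. L-lipschitz_on (cball y u \<inter> cball x r) f"
      using e(1) by (intro exI[of _ "e/2"]) auto
  qed
  then obtain L where "\<And>t. t \<in> {0::real} \<Longrightarrow> L-lipschitz_on (cball x r) f"
    using local_lipschitz_compact_implies_lipschitz[where X = "cball x r" and T = "{0::real}" and f = "\<lambda>_. f"] by auto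
  then show ?thesis using that by blast
qed

definition clamp_real :: "real \<Rightarrow> real \<Rightarrow> real" where
  "clamp_real m y = max (- m) (min m y)"

lemma clamp_real_lipschitz: "\<bar>clamp_real m y - clamp_real m z\<bar> \<le> \<bar>y - z\<bar>"
  by (auto simp: clamp_real_def max_def min_def)

lemma clamp_real_bounds: "0 \<le> m \<Longrightarrow> \<bar>clamp_real m y\<bar> \<le> m" "0 \<le> m \<Longrightarrow> \<bar>clamp_real m y\<bar> \<le> \<bar>y\<bar>"
  by (auto simp: clamp_real_def max_def min_def)

lemma clamp_real_id: "\<bar>y\<bar> \<le> m \<Longrightarrow> clamp_real m y = y"
  by (auto simp: clamp_real_def max_def min_def)

definition tent :: "real \<Rightarrow> 'a::real_normed_vector \<Rightarrow> real" where
  "tent r x = max 0 (1 - norm x / r)"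

lemma tent_bounds: "r > 0 \<Longrightarrow> 0 \<le> tent r x" "r > 0 \<Longrightarrow> tent r x \<le> 1"
  by (auto simp: tent_def)

lemma tent_lipschitz:
  assumes "r > 0"
  shows "\<bar>tent r x - tent r y\<bar> \<le> norm (x - y) / r"
proof -
  have "\<bar>tent r x - tent r y\<bar> \<le> \<bar>norm x / r - norm y / r\<bar>" by (auto simp: tent_def max_def abs_if)
  also have "\<dots> = \<bar>norm x - norm y\<bar> / r" using assms by (simp add: diff_divide_distrib[symmetric])
  also have "\<dots> \<le> norm (x - y) / r" using assms by (intro divide_right_mono norm_triangle_ineq3) auto
  finally show ?thesis .
qed

text \<open>The tent has slope at most 1/r and the clamped factor is at most m in size, so the
  cut-off adds at most m/r to the slope of f. This ratio can be made small while both the radius and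
  the height tend to infinity.\<close>

definition truncate :: "real \<Rightarrow> real \<Rightarrow> ('a::real_normed_vector \<Rightarrow> real) \<Rightarrow> 'a \<Rightarrow> real" where
  "truncate r m f x = tent r x * clamp_real m (f x)"

lemma truncate_diff_le:
  assumes r: "r > 0" and m: "m \<ge> 0"
  shows "\<bar>truncate r m f x - truncate r m f y\<bar> \<le> \<bar>f x - f y\<bar> + m / r * norm (x - y)"
proof -
  have "truncate r m f x - truncate r m f y =
      tent r x * (clamp_real m (f x) - clamp_real m (f y)) + (tent r x - tent r y) * clamp_real m (f y)"
    by (simp add: truncate_def algebra_simps)
  also have "\<bar>\<dots>\<bar> \<le> \<bar>tent r x\<bar> * \<bar>clamp_real m (f x) - clamp_real m (f y)\<bar> + \<bar>tent r x - tent r y\<bar> * \<bar>clamp_real m (f y)\<bar>"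
    by (metis abs_mult abs_triangle_ineq)
  also have "\<dots> \<le> 1 * \<bar>f x - f y\<bar> + (norm (x - y) / r) * m"
    using tent_bounds[OF r, of x] clamp_real_lipschitz[of m "f x" "f y"] tent_lipschitz[OF r, of x y]
      clamp_real_bounds(1)[OF m, of "f y"] r by (intro add_mono mult_mono) auto
  finally show ?thesis by (simp add: mult.commute)
qed

lemma truncate_bounds:
  assumes r: "r > 0" and m: "m \<ge> 0"
  shows "\<bar>truncate r m f x\<bar> \<le> m" "\<bar>truncate r m f x\<bar> \<le> \<bar>f x\<bar>"
proof -
  have "\<bar>truncate r m f x\<bar> \<le> 1 * \<bar>clamp_real m (f x)\<bar>"
    unfolding truncate_def abs_mult using tent_bounds[OF r, of x] by (intro mult_right_mono) auto
  then show "\<bar>truncate r m f x\<bar> \<le> m" "\<bar>truncate r m f x\<bar> \<le> \<bar>f x\<bar>"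
    using clamp_real_bounds[OF m, of "f x"] by auto
qed

text \<open>On the closed ball of radius r the function f is Lipschitz by compactness, and outside
  it the truncation is 0. For a pair across the boundary the tent vanishes at the outer point, so at
  the inner one it is at most the distance divided by r.\<close>

lemma truncate_lipschitz:
  fixes f :: "'a::euclidean_space \<Rightarrow> real"
  assumes f: "locally_lipschitz f" and r: "r > 0" and m: "m \<ge> 0"
  obtains L where "L-lipschitz_on UNIV (truncate r m f)"
proof -
  obtain K where K: "K-lipschitz_on (cball 0 r) f" using lipschitz_on_cball_if_locally[OF f] by blast
  have K0: "K \<ge> 0" using K lipschitz_on_nonneg by blast
  define L where "L = K + m / r"
  have L: "m / r \<le> L" "0 \<le> L" using K0 r m by (auto simp: L_def)
  have out: "truncate r m f y = 0" if "y \<notin> cball 0 r" for y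
    using that r by (simp add: truncate_def tent_def divide_simps)
  have one: "\<bar>truncate r m f x - truncate r m f y\<bar> \<le> L * norm (x - y)" if x: "x \<in> cball 0 r" for x y
  proof (cases "y \<in> cball 0 r")
    case True
    have "\<bar>f x - f y\<bar> \<le> K * norm (x - y)" using lipschitz_onD[OF K x True] by (simp add: dist_norm)
    then show ?thesis using truncate_diff_le[OF r m, of f x y] by (simp add: L_def distrib_right)
  next
    case False
    have "\<bar>truncate r m f x\<bar> \<le> tent r x * m"
      unfolding truncate_def abs_mult using tent_bounds[OF r, of x] clamp_real_bounds(1)[OF m, of "f x"] by (intro mult_mono) auto
    also have "tent r x \<le> norm (x - y) / r"
      using tent_lipschitz[OF r, of x y] tent_bounds[OF r, of x] False r by (simp add: tent_def[of r y] divide_simps)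
    then have "tent r x * m \<le> norm (x - y) / r * m" using m by (rule mult_right_mono)
    also have "\<dots> \<le> L * norm (x - y)" using mult_right_mono[OF L(1), of "norm (x - y)"] by (simp add: mult.commute)
    finally show ?thesis using out[OF False] by simp
  qed
  have "L-lipschitz_on UNIV (truncate r m f)"
  proof (rule lipschitz_onI[OF _ L(2)])
    fix x y
    show "dist (truncate r m f x) (truncate r m f y) \<le> L * dist x y"
    proof (cases "x \<in> cball 0 r \<or> y \<in> cball 0 r")
      case True
      then show ?thesis using one[of x y] one[of y x] by (auto simp: dist_norm norm_minus_commute abs_minus_commute)
    qed (use out L in auto)
  qed
  then show ?thesis using that by blast
qed

lemma truncate_tendsto:
  assumes r: "filterlim r at_top sequentially" and m: "filterlim m at_top sequentially"
  shows "(\<lambda>k. truncate (r k) (m k) f x) \<longlonglongrightarrow> f x"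
proof -
  have "(\<lambda>k. norm x / r k) \<longlonglongrightarrow> 0" by (rule real_tendsto_divide_at_top[OF tendsto_const r])
  then have "(\<lambda>k. max 0 (1 - norm x / r k) * f x) \<longlonglongrightarrow> max 0 (1 - 0) * f x" by (intro tendsto_intros)
  moreover have "eventually (\<lambda>k. max 0 (1 - norm x / r k) * f x = truncate (r k) (m k) f x) sequentially"
    using m[unfolded filterlim_at_top, rule_format, of "\<bar>f x\<bar>"]
    by eventually_elim (simp add: truncate_def tent_def clamp_real_id)
  ultimately show ?thesis by (simp add: tendsto_cong)
qed

section \<open>Dini derivatives, quadratic forms and directional bounds\<close>

text \<open>The bound by K + \<epsilon> is inherited by a union of adjacent intervals and holds on
  short intervals around each point, split at that point; Bolzano's bisection makes it global. The
  slack \<open>e / (s + 1)\<close> costs at most e over the length s.\<close>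

lemma dini_bound:
  fixes g :: "real \<Rightarrow> real"
  assumes s: "0 \<le> s"
    and loc: "\<And>\<tau> \<epsilon>. \<lbrakk>0 \<le> \<tau>; \<tau> \<le> s; \<epsilon> > 0\<rbrakk> \<Longrightarrow> eventually (\<lambda>t. \<bar>g (\<tau> + t) - g \<tau>\<bar> \<le> (K + \<epsilon>) * \<bar>t\<bar>) (at 0)"
  shows "\<bar>g s - g 0\<bar> \<le> K * s"
proof (rule field_le_epsilon)
  fix e :: real assume e: "e > 0"
  define \<epsilon> where "\<epsilon> = e / (s + 1)"
  have \<epsilon>: "\<epsilon> > 0" using e s by (simp add: \<epsilon>_def)
  have "\<bar>g s - g 0\<bar> \<le> (K + \<epsilon>) * (s - 0)"
    using s
  proof (induction rule: Bolzano)
    case (trans a b c)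
    then show ?case by (simp add: algebra_simps)
  next
    case (local x)
    obtain d where d: "d > 0" "\<And>t. t \<noteq> 0 \<Longrightarrow> \<bar>t\<bar> < d \<Longrightarrow> \<bar>g (x + t) - g x\<bar> \<le> (K + \<epsilon>) * \<bar>t\<bar>"
      using loc[OF local \<epsilon>] unfolding eventually_at by (auto simp: dist_real_def)
    have d': "\<bar>g y - g x\<bar> \<le> (K + \<epsilon>) * \<bar>y - x\<bar>" if "\<bar>y - x\<bar> < d" for y
      using d(2)[of "y - x"] that by (cases "y = x") auto
    have "\<bar>g b - g a\<bar> \<le> (K + \<epsilon>) * (b - a)" if ab: "a \<le> x" "x \<le> b" "b - a < d" for a b
    proof -
      have "\<bar>g b - g x\<bar> \<le> (K + \<epsilon>) * (b - x)" "\<bar>g a - g x\<bar> \<le> (K + \<epsilon>) * (x - a)"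
        using d'[of b] d'[of a] ab by auto
      moreover have "(K + \<epsilon>) * (b - a) = (K + \<epsilon>) * (b - x) + (K + \<epsilon>) * (x - a)" by (simp add: algebra_simps)
      ultimately show ?thesis by linarith
    qed
    then show ?case using d(1) by blast
  qed
  also have "\<dots> = K * s + e * (s / (s + 1))" by (simp add: \<epsilon>_def distrib_right)
  also have "\<dots> \<le> K * s + e * 1" using e s by (intro add_left_mono mult_left_mono) auto
  finally show "\<bar>g s - g 0\<bar> \<le> K * s + e" by simp
qed

lemma inner_gram: "(v :: real^'k) \<bullet> ((transpose A ** A) *v v) = (norm (A *v v))\<^sup>2" for A :: "real^'k^'m"
  by (simp add: power2_norm_eq_inner matrix_vector_mul_assoc[symmetric] transpose_matrix_vector[symmetric] dot_lmul_matrix del: transpose_matrix_vector)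
     (metis dot_lmul_matrix inner_commute transpose_matrix_vector)

text \<open>Because \<open>jac\<close> is transposed, it acts on target vectors and is the adjoint
  of the derivative.\<close>

lemma inner_jac:
  fixes F :: "real^'a \<Rightarrow> real^'b"
  assumes "F differentiable (at x)"
  shows "h \<bullet> (jac F x *v u) = u \<bullet> frechet_derivative F (at x) h"
proof -
  have "linear (frechet_derivative F (at x))" using assms by (rule linear_frechet_derivative)
  then have "matrix (frechet_derivative F (at x)) *v h = frechet_derivative F (at x) h" by (metis matrix_vector_mul(2))
  then show ?thesis
    unfolding jac_def by (metis dot_lmul_matrix inner_commute transpose_matrix_vector)
qed

lemma cos_integrand_quad:
  fixes T :: "real^'d^'n \<Rightarrow> real^'k"
  shows "u \<bullet> (cos_integrand T X *v u) = (\<Sum>i\<in>UNIV. (norm (partial_jac T i X *v u))\<^sup>2)"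
proof -
  have "(\<Sum>i\<in>S. A i) *v u = (\<Sum>i\<in>S. A i *v u)" for A :: "'n \<Rightarrow> real^'k^'k" and S
    by (induction S rule: infinite_finite_induct) (simp_all add: matrix_vector_mult_add_rdistrib)
  then have "cos_integrand T X *v u = (\<Sum>i\<in>UNIV. (transpose (partial_jac T i X) ** partial_jac T i X) *v u)"
    unfolding cos_integrand_def .
  then show ?thesis by (simp add: inner_sum_right inner_gram)
qed

text \<open>The derivative splits into one contribution per observation. Cauchy-Schwarz is applied
  inside each observation and then across the sample, where the squared norms add up to the
  quadratic form of the cosensitivity integrand.\<close>

lemma directional_derivative_bound:
  fixes T :: "real^'d^'n \<Rightarrow> real^'k"
  assumes T: "(T has_derivative D) (at X)"
  shows "\<bar>u \<bullet> D V\<bar> \<le> sqrt (u \<bullet> (cos_integrand T X *v u)) * norm V"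
proof -
  have lin: "linear D" using T has_derivative_linear by blast
  have part: "u \<bullet> D (axis i v) = v \<bullet> (partial_jac T i X *v u)" for i v
  proof -
    let ?f = "\<lambda>y. T (\<chi> j. if j = i then y else X $ j)"
    have e: "(\<chi> j. if j = i then y else X $ j) = X + axis i (y - X $ i)" for y
      by (auto simp: vec_eq_iff axis_def)
    have "bounded_linear (axis i :: real^'d \<Rightarrow> real^'d^'n)"
      by (intro linear_conv_bounded_linear[THEN iffD1] linearI) (auto simp: axis_def vec_eq_iff)
    then have "((\<lambda>y. axis i (y - X $ i)) has_derivative (\<lambda>h. axis i h)) (at (X $ i))"
      by (rule bounded_linear.has_derivative) (auto intro!: derivative_eq_intros)
    from has_derivative_add[OF has_derivative_const this]
    have "((\<lambda>y. X + axis i (y - X $ i)) has_derivative (\<lambda>h. axis i h)) (at (X $ i))" by simp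
    moreover have "(T has_derivative D) (at (X + axis i (X $ i - X $ i)))" using T by (simp add: axis_def) (simp add: vec_eq_iff zero_vec_def[symmetric])
    ultimately have d: "(?f has_derivative (\<lambda>h. D (axis i h))) (at (X $ i))"
      unfolding e by (rule has_derivative_compose)
    \<comment> \<open>Full differentiability of T at X makes each partial map differentiable, so the
      default value 0 in \<open>partial_jac\<close> does not arise here.\<close>
    then have df: "?f differentiable (at (X $ i))" unfolding differentiable_def by blast
    have "frechet_derivative ?f (at (X $ i)) = (\<lambda>h. D (axis i h))" using frechet_derivative_at[OF d] by simp
    then have "v \<bullet> (jac ?f (X $ i) *v u) = u \<bullet> D (axis i v)" using inner_jac[OF df] by simp
    then show ?thesis using df by (simp add: partial_jac_def Let_def)
  qed
  have "V = (\<Sum>i\<in>UNIV. axis i (V $ i))" by (simp add: vec_eq_iff axis_def if_distrib cong: if_cong)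
  then have "u \<bullet> D V = (\<Sum>i\<in>UNIV. u \<bullet> D (axis i (V $ i)))"
    using linear_sum[OF lin, of "\<lambda>i. axis i (V $ i)" UNIV] by (metis inner_sum_right)
  also have "\<dots> = (\<Sum>i\<in>UNIV. V $ i \<bullet> (partial_jac T i X *v u))" by (simp add: part)
  finally have "\<bar>u \<bullet> D V\<bar> \<le> (\<Sum>i\<in>UNIV. \<bar>V $ i \<bullet> (partial_jac T i X *v u)\<bar>)" by (simp add: sum_abs)
  also have "\<dots> \<le> (\<Sum>i\<in>UNIV. \<bar>norm (V $ i)\<bar> * \<bar>norm (partial_jac T i X *v u)\<bar>)"
    by (intro sum_mono) (simp add: Cauchy_Schwarz_ineq2)
  also have "\<dots> \<le> L2_set (\<lambda>i. norm (V $ i)) UNIV * L2_set (\<lambda>i. norm (partial_jac T i X *v u)) UNIV"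
    by (rule L2_set_mult_ineq)
  also have "\<dots> = norm V * sqrt (u \<bullet> (cos_integrand T X *v u))"
    by (simp add: norm_vec_def cos_integrand_quad L2_set_def)
  finally show ?thesis by (simp add: mult.commute)
qed

text \<open>The clamp and the tent have kinks, so the truncation is not differentiated: only the
  increment of T is, and the cut-off is absorbed by the additive m/r.\<close>

lemma truncate_directional_bound:
  fixes T :: "real^'d^'n \<Rightarrow> real^'k"
  assumes T: "T differentiable (at X)" and r: "r > 0" and m: "m \<ge> 0" and \<epsilon>: "\<epsilon> > 0"
  shows "eventually (\<lambda>t. \<bar>truncate r m (\<lambda>X. u \<bullet> T X) (X + t *\<^sub>R V) - truncate r m (\<lambda>X. u \<bullet> T X) X\<bar>
     \<le> (sqrt (u \<bullet> (cos_integrand T X *v u)) * norm V + m / r * norm V + \<epsilon>) * \<bar>t\<bar>) (at 0)"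
proof -
  obtain D where D: "(T has_derivative D) (at X)" using T differentiable_def by blast
  then have "((\<lambda>X. u \<bullet> T X) has_derivative (\<lambda>h. u \<bullet> D h)) (at X)" by (rule has_derivative_inner_right)
  then have "has_dir_deriv (\<lambda>X. u \<bullet> T X) V X (u \<bullet> D V)" by (rule has_derivative_has_dir_deriv)
  then have "eventually (\<lambda>t. dist ((u \<bullet> T (X + t *\<^sub>R V) - u \<bullet> T X) / t) (u \<bullet> D V) < \<epsilon>) (at 0)"
    unfolding has_dir_deriv_def using \<epsilon> by (rule tendstoD)
  moreover have "eventually (\<lambda>t::real. t \<noteq> 0) (at 0)" by (simp add: eventually_at_filter)
  ultimately show ?thesis
  proof eventually_elim
    fix t :: real assume t: "dist ((u \<bullet> T (X + t *\<^sub>R V) - u \<bullet> T X) / t) (u \<bullet> D V) < \<epsilon>" "t \<noteq> 0"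
    have "\<bar>(u \<bullet> T (X + t *\<^sub>R V) - u \<bullet> T X) / t\<bar> \<le> sqrt (u \<bullet> (cos_integrand T X *v u)) * norm V + \<epsilon>"
      using t(1) directional_derivative_bound[OF D, of u V] by (simp add: dist_real_def)
    then have "\<bar>u \<bullet> T (X + t *\<^sub>R V) - u \<bullet> T X\<bar> \<le> (sqrt (u \<bullet> (cos_integrand T X *v u)) * norm V + \<epsilon>) * \<bar>t\<bar>"
      using t(2) by (simp add: abs_divide divide_le_eq)
    then show "\<bar>truncate r m (\<lambda>X. u \<bullet> T X) (X + t *\<^sub>R V) - truncate r m (\<lambda>X. u \<bullet> T X) X\<bar>
       \<le> (sqrt (u \<bullet> (cos_integrand T X *v u)) * norm V + m / r * norm V + \<epsilon>) * \<bar>t\<bar>"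
      using truncate_diff_le[OF r m, of "\<lambda>X. u \<bullet> T X" "X + t *\<^sub>R V" X] by (simp add: algebra_simps)
  qed
qed

lemma integral_Cauchy_Schwarz:
  fixes f g :: "'a \<Rightarrow> real"
  assumes f: "integrable M (\<lambda>x. (f x)\<^sup>2)" and g: "integrable M (\<lambda>x. (g x)\<^sup>2)"
    and [measurable]: "f \<in> borel_measurable M" "g \<in> borel_measurable M"
  shows "integrable M (\<lambda>x. f x * g x)"
    "(\<integral>x. f x * g x \<partial>M) \<le> sqrt (\<integral>x. (f x)\<^sup>2 \<partial>M) * sqrt (\<integral>x. (g x)\<^sup>2 \<partial>M)"
proof -
  have amgm: "\<bar>a * b\<bar> \<le> a\<^sup>2 + b\<^sup>2" for a b :: real
    using zero_le_power2[of "a - b"] zero_le_power2[of "a + b"] zero_le_power2[of a] zero_le_power2[of b]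
    unfolding power2_diff power2_sum by linarith
  show fg: "integrable M (\<lambda>x. f x * g x)"
  proof (rule Bochner_Integration.integrable_bound)
    show "integrable M (\<lambda>x. (f x)\<^sup>2 + (g x)\<^sup>2)" using f g by simp
    show "AE x in M. norm (f x * g x) \<le> norm ((f x)\<^sup>2 + (g x)\<^sup>2)" using amgm by simp
  qed measurable
  define F where "F = (\<integral>x. (f x)\<^sup>2 \<partial>M)"
  define G where "G = (\<integral>x. (g x)\<^sup>2 \<partial>M)"
  define C where "C = (\<integral>x. f x * g x \<partial>M)"
  have FG: "F \<ge> 0" "G \<ge> 0" by (auto simp: F_def G_def)
  have "C\<^sup>2 \<le> F * G"
  proof (cases "G = 0")
    case True
    then have "AE x in M. (g x)\<^sup>2 = 0" unfolding G_def using g by (simp add: integral_nonneg_eq_0_iff_AE)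
    then have "AE x in M. f x * g x = 0" by eventually_elim simp
    then have "C = 0" unfolding C_def by (simp add: integral_eq_zero_AE)
    then show ?thesis using True by simp
  next
    case False
    \<comment> \<open>The multiple of g closest to f in mean square; the squared distance F - C^2 /
      G is nonnegative.\<close>
    define s where "s = C / G"
    have "0 \<le> (\<integral>x. (f x - s * g x)\<^sup>2 \<partial>M)" by simp
    also have "\<dots> = (\<integral>x. (f x)\<^sup>2 - 2 * s * (f x * g x) + s\<^sup>2 * (g x)\<^sup>2 \<partial>M)"
      by (simp add: power2_diff power_mult_distrib algebra_simps)
    also have "\<dots> = F - 2 * s * C + s\<^sup>2 * G" using f g fg by (simp add: F_def G_def C_def)
    also have "\<dots> = F - C\<^sup>2 / G" using False by (simp add: s_def power2_eq_square)
    finally show ?thesis using False FG by (simp add: divide_le_eq)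
  qed
  then have "C \<le> sqrt (F * G)" by (rule real_le_rsqrt)
  then show "(\<integral>x. f x * g x \<partial>M) \<le> sqrt (\<integral>x. (f x)\<^sup>2 \<partial>M) * sqrt (\<integral>x. (g x)\<^sup>2 \<partial>M)"
    by (simp add: real_sqrt_mult F_def G_def C_def)
qed

lemma bounded_linear_quadratic_form: "bounded_linear (\<lambda>A :: real^'k^'k. v \<bullet> (A *v v))"
  by (intro linear_conv_bounded_linear[THEN iffD1] linearI)
     (simp_all add: matrix_vector_mult_add_rdistrib inner_add_right scaleR_matrix_vector_assoc[symmetric])

text \<open>A non-integrable function has Bochner integral 0, and the zero matrix is not invertible.
  Invertibility of the information matrix thus carries the square integrability of the
  linearization.\<close>

lemma invertible_integral_integrable:
  fixes f :: "'a \<Rightarrow> real^'k^'k"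
  assumes "invertible (\<integral>x. f x \<partial>M)"
  shows "integrable M f"
proof (rule ccontr)
  assume "\<not> integrable M f"
  then have "(\<integral>x. f x \<partial>M) = 0" by (rule not_integrable_integral_eq)
  then obtain B :: "real^'k^'k" where "0 ** B = (mat 1 :: real^'k^'k)" using assms unfolding invertible_def by auto
  then have "(mat 1 :: real^'k^'k) *v 1 = 0 *v (B *v 1)" by (metis matrix_vector_mul_assoc)
  then show False by (simp add: vec_eq_iff)
qed

lemma matrix_vector_measurable:
  fixes A :: "'a \<Rightarrow> real^'p^'d"
  assumes "A \<in> borel_measurable M"
  shows "(\<lambda>x. A x *v h) \<in> borel_measurable M"
proof -
  have "linear (\<lambda>A :: real^'p^'d. A *v h)"
    by (rule linearI) (simp_all add: matrix_vector_mult_add_rdistrib scaleR_matrix_vector_assoc)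
  then have "continuous_on UNIV (\<lambda>A :: real^'p^'d. A *v h)"
    using linear_continuous_on linear_conv_bounded_linear by blast
  then show ?thesis using measurable_compose[OF assms borel_measurable_continuous_onI] by blast
qed

lemma norm_vec_le_sum: "norm (X :: 'a::real_normed_vector^'n) \<le> (\<Sum>i\<in>UNIV. norm (X $ i))"
  unfolding norm_vec_def by (rule L2_set_le_sum) simp

lemma lipschitz_imp_abs_le:
  fixes F :: "'a::real_normed_vector \<Rightarrow> real"
  assumes "L-lipschitz_on UNIV F"
  shows "\<bar>F x - F y\<bar> \<le> L * norm (x - y)"
  using lipschitz_onD[OF assms, of x y] by (simp add: dist_norm)

lemma integral_quadratic_form:
  fixes f :: "'a \<Rightarrow> real^'k^'k"
  assumes "integrable M f"
  shows "integrable M (\<lambda>x. v \<bullet> (f x *v v))" "v \<bullet> ((\<integral>x. f x \<partial>M) *v v) = (\<integral>x. v \<bullet> (f x *v v) \<partial>M)"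
  using integrable_bounded_linear[OF bounded_linear_quadratic_form assms]
    integral_bounded_linear[OF bounded_linear_quadratic_form assms] by auto

lemma wass_info_quad:
  assumes inv: "invertible (wass_info P \<Phi> \<theta>)"
  shows "integrable (P \<theta>) (\<lambda>x. (norm (\<Phi> \<theta> x *v h))\<^sup>2)"
    "h \<bullet> (wass_info P \<Phi> \<theta> *v h) = (\<integral>x. (norm (\<Phi> \<theta> x *v h))\<^sup>2 \<partial>P \<theta>)"
proof -
  have i: "integrable (P \<theta>) (\<lambda>x. transpose (\<Phi> \<theta> x) ** \<Phi> \<theta> x)"
    by (rule invertible_integral_integrable) (use inv in \<open>simp add: wass_info_def\<close>)
  show "integrable (P \<theta>) (\<lambda>x. (norm (\<Phi> \<theta> x *v h))\<^sup>2)"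
    "h \<bullet> (wass_info P \<Phi> \<theta> *v h) = (\<integral>x. (norm (\<Phi> \<theta> x *v h))\<^sup>2 \<partial>P \<theta>)"
    using integral_quadratic_form[OF i, of h] by (simp_all add: wass_info_def inner_gram)
qed

text \<open>Only the push-forward property of the optimal maps enters here: it turns the expectation under
  \<open>P (\<theta> + t h)\<close> into one under \<open>P \<theta>\<close>, where the displacement is \<open>t \<Phi> h\<close> up to \<open>o(t)\<close> in \<open>L\<^sup>2\<close>.\<close>

lemma expectation_upper_dini:
  fixes P :: "real^'p \<Rightarrow> (real^'d) measure" and F :: "real^'d^'n \<Rightarrow> real"
    and \<Phi> :: "real^'d \<Rightarrow> real^'p^'d"
  assumes \<Theta>: "open \<Theta>" "\<theta> \<in> \<Theta>" and model: "\<forall>\<theta>\<in>\<Theta>. P2ac (P \<theta>)" and TL: "transport_lin P \<theta> \<Phi>"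
    and sq: "integrable (P \<theta>) (\<lambda>x. (norm (\<Phi> x *v h))\<^sup>2)"
    and lip: "L-lipschitz_on UNIV F" and bd: "\<And>X. \<bar>F X\<bar> \<le> m"
    and B: "integrable (iid (P \<theta>)) B"
    and dd: "AE X in iid (P \<theta>). \<forall>\<epsilon>>0. eventually (\<lambda>t. \<bar>F (X + t *\<^sub>R (\<chi> i. \<Phi> (X $ i) *v h)) - F X\<bar> \<le> (B X + \<epsilon>) * \<bar>t\<bar>) (at 0)"
    and \<epsilon>: "\<epsilon> > 0"
  shows "eventually (\<lambda>t. \<bar>(\<integral>X. F X \<partial>iid (P (\<theta> + t *\<^sub>R h))) - (\<integral>X. F X \<partial>iid (P \<theta>))\<bar> \<le> ((\<integral>X. B X \<partial>iid (P \<theta>)) + \<epsilon>) * \<bar>t\<bar>) (at 0)"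
proof (rule sequentially_imp_eventually_at, intro allI impI)
  \<comment> \<open>Dominated convergence works along sequences, and an eventual statement at 0
    follows from all sequences of nonzero numbers tending to 0.\<close>
  fix t :: "nat \<Rightarrow> real" assume t: "(\<forall>n. t n \<noteq> 0) \<and> t \<longlonglongrightarrow> 0"
  have t0: "t n \<noteq> 0" for n using t by simp
  let ?Q = "iid (P \<theta>) :: (real^'d^'n) measure"
  define N where "N = real CARD('n)"
  define \<beta> where "\<beta> = (\<integral>X. B X \<partial>?Q)"
  note p = P2acD[OF model[rule_format, OF \<Theta>(2)]]
  interpret P: prob_space "P \<theta>" by (rule p)
  interpret Q: prob_space ?Q by (rule prob_space_iid[OF p(1,2)])
  note [simp, measurable_cong] = sets_iid[OF p(1,2)]
  note [measurable_cong] = p(2)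
  have Qb: "f \<in> borel_measurable ?Q \<longleftrightarrow> f \<in> borel_measurable borel" for f :: "real^'d^'n \<Rightarrow> real"
    by (simp add: measurable_cong_sets[OF sets_iid[OF p(1,2)] refl])
  have L0: "L \<ge> 0" using lip lipschitz_on_nonneg by blast
  have [measurable]: "F \<in> borel_measurable borel"
    using lip lipschitz_on_continuous_on borel_measurable_continuous_onI by blast
  have [measurable]: "\<Phi> \<in> borel_measurable borel" using TL by (simp add: transport_lin_def)
  define v where "v x = \<Phi> x *v h" for x
  have vm[measurable]: "v \<in> borel_measurable borel" unfolding v_def by (rule matrix_vector_measurable) simp
  define V where "V X = (\<chi> i. v (X $ i))" for X :: "real^'d^'n"
  have Vm[measurable]: "V \<in> borel_measurable borel" unfolding V_def by (rule vec_map_measurable) simp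
  have iv: "integrable (P \<theta>) (\<lambda>x. norm (v x))"
  proof (rule Bochner_Integration.integrable_bound)
    show "integrable (P \<theta>) (\<lambda>x. 1 + (norm (v x))\<^sup>2)" using sq by (simp add: v_def)
    have le: "norm y \<le> 1 + (norm y)\<^sup>2" for y :: "real^'d"
      using zero_le_power2[of "norm y - 1"] zero_le_power2[of "norm y"] unfolding power2_diff one_power2 by linarith
    have "norm y \<le> norm (1 + (norm y)\<^sup>2)" for y :: "real^'d"
      using le[of y] by simp
    then show "AE x in P \<theta>. norm (norm (v x)) \<le> norm (1 + (norm (v x))\<^sup>2)" by simp
  qed measurable
  have iV: "integrable ?Q (\<lambda>X. norm (V X))"
  proof (rule Bochner_Integration.integrable_bound)
    show "integrable ?Q (\<lambda>X. \<Sum>i\<in>UNIV. norm (v (X $ i)))"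
      using iid_nth_integral(2)[OF p(1,2) measurable_compose[OF vm borel_measurable_norm]] iv by (intro Bochner_Integration.integrable_sum) blast
    show "AE X in ?Q. norm (norm (V X)) \<le> norm (\<Sum>i\<in>UNIV. norm (v (X $ i)))"
      using norm_vec_le_sum[of "V _"] by (simp add: V_def abs_of_nonneg sum_nonneg)
  qed measurable
  have iF: "integrable ?Q (\<lambda>X. F (g X))" if "g \<in> borel_measurable borel" for g :: "real^'d^'n \<Rightarrow> real^'d^'n"
    using that by (intro Q.integrable_const_bound[of _ m]) (auto simp: bd)
  \<comment> \<open>The excess of the difference quotient over B. It tends to 0 almost everywhere by
    \<open>dd\<close>, and the Lipschitz constant supplies the integrable majorant; the limit of its
    integral no longer involves L.\<close>
  define q where "q n X = max 0 (\<bar>F (X + t n *\<^sub>R V X) - F X\<bar> / \<bar>t n\<bar> - B X)" for n X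
  have Bm[measurable]: "B \<in> borel_measurable ?Q" using B by auto
  have qm[measurable]: "q n \<in> borel_measurable ?Q" for n unfolding q_def[abs_def] by measurable
  have quot: "\<bar>F (X + t n *\<^sub>R V X) - F X\<bar> / \<bar>t n\<bar> \<le> L * norm (V X)" for n X
    using lipschitz_imp_abs_le[OF lip, of "X + t n *\<^sub>R V X" X] t0[of n] by (simp add: divide_le_eq mult.assoc mult.commute mult.left_commute)
  have qle: "norm (q n X) \<le> L * norm (V X) + \<bar>B X\<bar>" for n X
    using quot[of X n] L0 unfolding q_def by auto
  have dom: "integrable ?Q (\<lambda>X. L * norm (V X) + \<bar>B X\<bar>)" using iV B by auto
  have iq: "integrable ?Q (q n)" for n
    by (rule Bochner_Integration.integrable_bound[OF dom]) (use qle L0 in \<open>auto intro!: order_trans[OF _ abs_ge_self]\<close>)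
  have qlim: "(\<lambda>n. \<integral>X. q n X \<partial>?Q) \<longlonglongrightarrow> (\<integral>X. 0 \<partial>?Q)"
  proof (rule integral_dominated_convergence[OF _ _ dom])
    show "AE X in ?Q. (\<lambda>n. q n X) \<longlonglongrightarrow> 0"
      using dd
    proof eventually_elim
      fix X assume X: "\<forall>\<epsilon>>0. eventually (\<lambda>t. \<bar>F (X + t *\<^sub>R (\<chi> i. \<Phi> (X $ i) *v h)) - F X\<bar> \<le> (B X + \<epsilon>) * \<bar>t\<bar>) (at 0)"
      show "(\<lambda>n. q n X) \<longlonglongrightarrow> 0"
      proof (rule tendstoI)
        fix e :: real assume e: "e > 0"
        have "filterlim t (at 0) sequentially" using t by (simp add: filterlim_at)
        moreover have "eventually (\<lambda>t. \<bar>F (X + t *\<^sub>R V X) - F X\<bar> \<le> (B X + e/2) * \<bar>t\<bar>) (at 0)"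
          using X e unfolding V_def v_def by simp
        ultimately have "eventually (\<lambda>n. \<bar>F (X + t n *\<^sub>R V X) - F X\<bar> \<le> (B X + e/2) * \<bar>t n\<bar>) sequentially"
          by (rule eventually_compose_filterlim[rotated])
        then show "eventually (\<lambda>n. dist (q n X) 0 < e) sequentially"
        proof eventually_elim
          fix n assume "\<bar>F (X + t n *\<^sub>R V X) - F X\<bar> \<le> (B X + e/2) * \<bar>t n\<bar>"
          then have "\<bar>F (X + t n *\<^sub>R V X) - F X\<bar> / \<bar>t n\<bar> \<le> B X + e/2" using t0[of n] by (simp add: divide_le_eq)
          then show "dist (q n X) 0 < e" using e by (auto simp: q_def)
        qed
      qed
    qed
  qed (use qle in auto)
  then have ev_q: "eventually (\<lambda>n. (\<integral>X. q n X \<partial>?Q) < \<epsilon>/2) sequentially"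
    using \<epsilon> by (intro order_tendstoD(2)[where y=0]) auto
  \<comment> \<open>The remainder reaches F through the Lipschitz constant L and N coordinates, and
    L N \<eta> is at most \<epsilon>/2; the 1 covers L = 0. The other half of \<epsilon> goes to
    q.\<close>
  define \<eta> where "\<eta> = \<epsilon> / (2 * (L * N + 1))"
  have LN: "L * N \<ge> 0" using L0 by (simp add: N_def)
  then have \<eta>: "\<eta> > 0" using \<epsilon> by (simp add: \<eta>_def)
  have LN\<eta>: "L * (N * \<eta>) \<le> \<epsilon>/2"
  proof -
    have "L * (N * \<eta>) = (L * N) / (L * N + 1) * (\<epsilon> / 2)" by (simp add: \<eta>_def ac_simps)
    also have "\<dots> \<le> 1 * (\<epsilon> / 2)" using LN \<epsilon> by (intro mult_right_mono) auto
    finally show ?thesis by simp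
  qed
  have tat: "filterlim t (at 0) sequentially" using t by (simp add: filterlim_at)
  have "((\<lambda>s. \<theta> + s *\<^sub>R h) \<longlongrightarrow> \<theta> + 0 *\<^sub>R h) (at 0)" by (intro tendsto_intros)
  then have "eventually (\<lambda>s. \<theta> + s *\<^sub>R h \<in> \<Theta>) (at 0)" using \<Theta> by (intro topological_tendstoD) auto
  then have ev1: "eventually (\<lambda>n. \<theta> + t n *\<^sub>R h \<in> \<Theta>) sequentially"
    by (rule eventually_compose_filterlim[OF _ tat])
  have "eventually (\<lambda>s. (\<integral>\<^sup>+x. ennreal ((norm (ot_map (P \<theta>) (P (\<theta> + s *\<^sub>R h)) x - x - s *\<^sub>R (\<Phi> x *v h)))\<^sup>2) \<partial>P \<theta>)
          \<le> ennreal (\<eta>\<^sup>2 * s\<^sup>2)) (at 0)"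
    using TL \<eta> by (simp add: transport_lin_def)
  then have ev2: "eventually (\<lambda>n. (\<integral>\<^sup>+x. ennreal ((norm (ot_map (P \<theta>) (P (\<theta> + t n *\<^sub>R h)) x - x - t n *\<^sub>R v x))\<^sup>2) \<partial>P \<theta>)
          \<le> ennreal (\<eta>\<^sup>2 * (t n)\<^sup>2)) sequentially"
    unfolding v_def by (rule eventually_compose_filterlim[OF _ tat])
  show "eventually (\<lambda>n. \<bar>(\<integral>X. F X \<partial>iid (P (\<theta> + t n *\<^sub>R h))) - (\<integral>X. F X \<partial>?Q)\<bar> \<le> ((\<integral>X. B X \<partial>?Q) + \<epsilon>) * \<bar>t n\<bar>) sequentially"
    using ev1 ev2 ev_q
  proof eventually_elim
    fix n
    assume in\<Theta>: "\<theta> + t n *\<^sub>R h \<in> \<Theta>"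
      and small: "(\<integral>\<^sup>+x. ennreal ((norm (ot_map (P \<theta>) (P (\<theta> + t n *\<^sub>R h)) x - x - t n *\<^sub>R v x))\<^sup>2) \<partial>P \<theta>) \<le> ennreal (\<eta>\<^sup>2 * (t n)\<^sup>2)"
      and qs: "(\<integral>X. q n X \<partial>?Q) < \<epsilon>/2"
    define S where "S = ot_map (P \<theta>) (P (\<theta> + t n *\<^sub>R h))"
    have S[measurable]: "S \<in> borel_measurable borel" and push: "distr (P \<theta>) borel S = P (\<theta> + t n *\<^sub>R h)"
      using ot_map[OF model[rule_format, OF \<Theta>(2)] model[rule_format, OF in\<Theta>]] by (simp_all add: S_def)
    define r where "r x = S x - x - t n *\<^sub>R v x" for x
    have rm[measurable]: "r \<in> borel_measurable borel" unfolding r_def[abs_def] by measurable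
    have nnr: "(\<integral>\<^sup>+x. ennreal ((norm (r x))\<^sup>2) \<partial>P \<theta>) \<le> ennreal (\<eta>\<^sup>2 * (t n)\<^sup>2)"
      using small by (simp add: r_def S_def)
    have ir2: "integrable (P \<theta>) (\<lambda>x. (norm (r x))\<^sup>2)"
      by (rule integrableI_nonneg) (use nnr in \<open>auto intro: le_less_trans\<close>)
    have r2: "(\<integral>x. (norm (r x))\<^sup>2 \<partial>P \<theta>) \<le> \<eta>\<^sup>2 * (t n)\<^sup>2"
      using nnr nn_integral_eq_integral[OF ir2] by simp
    \<comment> \<open>Cauchy-Schwarz against the constant 1 turns the mean square bound into a bound
      on the mean, which is why the linearization was invoked with tolerance \<eta>^2.\<close>
    have r1: "integrable (P \<theta>) (\<lambda>x. norm (r x) * 1)"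
      "(\<integral>x. norm (r x) * 1 \<partial>P \<theta>) \<le> sqrt (\<integral>x. (norm (r x))\<^sup>2 \<partial>P \<theta>) * sqrt (\<integral>x. 1\<^sup>2 \<partial>P \<theta>)"
      by (rule integral_Cauchy_Schwarz; use ir2 in simp)+
    have r1': "(\<integral>x. norm (r x) \<partial>P \<theta>) \<le> \<eta> * \<bar>t n\<bar>"
    proof -
      have "sqrt (\<integral>x. (norm (r x))\<^sup>2 \<partial>P \<theta>) \<le> sqrt (\<eta>\<^sup>2 * (t n)\<^sup>2)" using r2 by (rule real_sqrt_le_mono)
      then show ?thesis using r1(2) \<eta> P.prob_space p(3) by (simp add: real_sqrt_mult)
    qed
    define SS where "SS X = (\<chi> i. S (X $ i))" for X :: "real^'d^'n"
    have SSm[measurable]: "SS \<in> borel_measurable borel" unfolding SS_def by (rule vec_map_measurable) simp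
    have "(\<integral>X. F X \<partial>iid (P (\<theta> + t n *\<^sub>R h))) = (\<integral>X. F X \<partial>distr ?Q borel SS)"
      unfolding push[symmetric] SS_def using iid_push[OF p(1,2) S] by metis
    also have "\<dots> = (\<integral>X. F (SS X) \<partial>?Q)" by (rule integral_distr) auto
    finally have eq: "(\<integral>X. F X \<partial>iid (P (\<theta> + t n *\<^sub>R h))) = (\<integral>X. F (SS X) \<partial>?Q)" .
    \<comment> \<open>The first summand is the step from the linear displacement to the transported
      sample, the second the step along the linear displacement.\<close>
    define W where "W X = L * (\<Sum>i\<in>UNIV. norm (r (X $ i))) + \<bar>t n\<bar> * (B X + q n X)" for X :: "real^'d^'n"
    have ir: "integrable ?Q (\<lambda>X. norm (r (X $ i)))" "(\<integral>X. norm (r (X $ i)) \<partial>?Q) = (\<integral>x. norm (r x) \<partial>P \<theta>)" for i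
      using iid_nth_integral[OF p(1,2), of "\<lambda>x. norm (r x)"] r1(1) by auto
    have iW: "integrable ?Q W" unfolding W_def[abs_def] using ir(1) B iq
      by (intro Bochner_Integration.integrable_add integrable_mult_right Bochner_Integration.integrable_sum) auto
    have FW: "\<bar>F (SS X) - F X\<bar> \<le> W X" for X
    proof -
      have "\<bar>F (SS X) - F (X + t n *\<^sub>R V X)\<bar> \<le> L * norm (SS X - (X + t n *\<^sub>R V X))"
        by (rule lipschitz_imp_abs_le[OF lip])
      also have "norm (SS X - (X + t n *\<^sub>R V X)) \<le> (\<Sum>i\<in>UNIV. norm (r (X $ i)))"
        using norm_vec_le_sum[of "SS X - (X + t n *\<^sub>R V X)"] by (simp add: SS_def V_def r_def diff_diff_eq)
      finally have 1: "\<bar>F (SS X) - F (X + t n *\<^sub>R V X)\<bar> \<le> L * (\<Sum>i\<in>UNIV. norm (r (X $ i)))"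
        using L0 by (simp add: mult_left_mono)
      have "\<bar>F (X + t n *\<^sub>R V X) - F X\<bar> / \<bar>t n\<bar> \<le> B X + q n X" by (simp add: q_def)
      then have 2: "\<bar>F (X + t n *\<^sub>R V X) - F X\<bar> \<le> \<bar>t n\<bar> * (B X + q n X)" using t0[of n] by (simp add: divide_le_eq mult.commute)
      show ?thesis using 1 2 unfolding W_def by linarith
    qed
    have iFS: "integrable ?Q (\<lambda>X. F (SS X))" "integrable ?Q F" using iF[of SS] iF[of "\<lambda>x. x"] by auto
    have "\<bar>(\<integral>X. F (SS X) \<partial>?Q) - (\<integral>X. F X \<partial>?Q)\<bar> = \<bar>\<integral>X. F (SS X) - F X \<partial>?Q\<bar>" using iFS by simp
    also have "\<dots> \<le> (\<integral>X. \<bar>F (SS X) - F X\<bar> \<partial>?Q)" by (rule integral_abs_bound)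
    also have "\<dots> \<le> (\<integral>X. W X \<partial>?Q)" by (rule integral_mono) (use iFS iW FW in auto)
    also have "\<dots> = L * (N * (\<integral>x. norm (r x) \<partial>P \<theta>)) + \<bar>t n\<bar> * (\<beta> + (\<integral>X. q n X \<partial>?Q))"
      unfolding W_def N_def \<beta>_def using ir B iq by simp
    also have "\<dots> \<le> L * (N * (\<eta> * \<bar>t n\<bar>)) + \<bar>t n\<bar> * (\<beta> + \<epsilon>/2)"
      using r1' qs L0 by (intro add_mono mult_left_mono) (auto simp: N_def)
    also have "\<dots> = (L * (N * \<eta>) + \<beta> + \<epsilon>/2) * \<bar>t n\<bar>" by (simp add: algebra_simps)
    also have "\<dots> \<le> (\<beta> + \<epsilon>) * \<bar>t n\<bar>" using LN\<eta> by (intro mult_right_mono) auto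
    finally show "\<bar>(\<integral>X. F X \<partial>iid (P (\<theta> + t n *\<^sub>R h))) - (\<integral>X. F X \<partial>?Q)\<bar> \<le> ((\<integral>X. B X \<partial>?Q) + \<epsilon>) * \<bar>t n\<bar>"
      unfolding eq \<beta>_def .
  qed
qed

text \<open>The pointwise slope bound is integrated with Cauchy-Schwarz under the sample law. The
  squared displacement has expectation n times h . J h, because every coordinate has law P \<theta>.
  The Lipschitz constant of the truncation has disappeared; only the ratio m/r remembers the
  cut-off.\<close>

lemma truncated_estimator_upper_dini:
  fixes P :: "real^'p \<Rightarrow> (real^'d) measure" and T :: "real^'d^'n \<Rightarrow> real^'k"
    and \<Phi> :: "real^'p \<Rightarrow> real^'d \<Rightarrow> real^'p^'d"
  assumes \<Theta>: "open \<Theta>" "\<theta> \<in> \<Theta>" and model: "\<forall>\<theta>\<in>\<Theta>. P2ac (P \<theta>)" and TL: "transport_lin P \<theta> (\<Phi> \<theta>)"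
    and inv: "invertible (wass_info P \<Phi> \<theta>)" and cosI: "integrable (iid (P \<theta>)) (cos_integrand T)"
    and lip: "locally_lipschitz T" and r: "r > 0" and m: "m \<ge> 0" and \<epsilon>: "\<epsilon> > 0"
  shows "eventually (\<lambda>t. \<bar>(\<integral>X. truncate r m (\<lambda>X. u \<bullet> T X) X \<partial>iid (P (\<theta> + t *\<^sub>R h)))
        - (\<integral>X. truncate r m (\<lambda>X. u \<bullet> T X) X \<partial>iid (P \<theta>))\<bar>
      \<le> ((sqrt (u \<bullet> (cosens P T \<theta> *v u)) + m / r) * sqrt (real CARD('n) * (h \<bullet> (wass_info P \<Phi> \<theta> *v h))) + \<epsilon>) * \<bar>t\<bar>) (at 0)"
proof -
  let ?Q = "iid (P \<theta>) :: (real^'d^'n) measure"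
  note p = P2acD[OF model[rule_format, OF \<Theta>(2)]]
  interpret Q: prob_space ?Q by (rule prob_space_iid[OF p(1,2)])
  note [simp, measurable_cong] = sets_iid[OF p(1,2)]
  note sq = wass_info_quad[OF inv, of h]
  define c where "c X = u \<bullet> (cos_integrand T X *v u)" for X
  have c0: "c X \<ge> 0" for X unfolding c_def cos_integrand_quad by (simp add: sum_nonneg)
  have ic: "integrable ?Q c" and ec: "(\<integral>X. c X \<partial>?Q) = u \<bullet> (cosens P T \<theta> *v u)"
    using integral_quadratic_form[OF cosI, of u] by (simp_all add: c_def[abs_def] cosens_def)
  have cm[measurable]: "c \<in> borel_measurable ?Q" using ic by auto
  have [measurable]: "\<Phi> \<theta> \<in> borel_measurable borel" using TL by (simp add: transport_lin_def)
  define v where "v x = \<Phi> \<theta> x *v h" for x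
  have vm[measurable]: "v \<in> borel_measurable borel" unfolding v_def by (rule matrix_vector_measurable) simp
  define V where "V X = (\<chi> i. v (X $ i))" for X :: "real^'d^'n"
  have Vm[measurable]: "V \<in> borel_measurable borel" unfolding V_def by (rule vec_map_measurable) simp
  have nV: "(norm (V X))\<^sup>2 = (\<Sum>i\<in>UNIV. (norm (v (X $ i)))\<^sup>2)" for X
    unfolding norm_vec_def L2_set_def V_def by (simp add: sum_nonneg)
  have iv: "integrable ?Q (\<lambda>X. (norm (v (X $ i)))\<^sup>2)" "(\<integral>X. (norm (v (X $ i)))\<^sup>2 \<partial>?Q) = h \<bullet> (wass_info P \<Phi> \<theta> *v h)" for i
    using iid_nth_integral[OF p(1,2), of "\<lambda>x. (norm (v x))\<^sup>2" i] sq unfolding v_def[symmetric] by auto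
  have iV: "integrable ?Q (\<lambda>X. (norm (V X))\<^sup>2)"
    and eV: "(\<integral>X. (norm (V X))\<^sup>2 \<partial>?Q) = real CARD('n) * (h \<bullet> (wass_info P \<Phi> \<theta> *v h))"
    unfolding nV using iv by simp_all
  have cs1: "integrable ?Q (\<lambda>X. sqrt (c X) * norm (V X))"
      "(\<integral>X. sqrt (c X) * norm (V X) \<partial>?Q) \<le> sqrt (\<integral>X. (sqrt (c X))\<^sup>2 \<partial>?Q) * sqrt (\<integral>X. (norm (V X))\<^sup>2 \<partial>?Q)"
    by (rule integral_Cauchy_Schwarz; use ic iV c0 in simp)+
  have cs2: "integrable ?Q (\<lambda>X. 1 * norm (V X))"
      "(\<integral>X. 1 * norm (V X) \<partial>?Q) \<le> sqrt (\<integral>X. 1\<^sup>2 \<partial>?Q) * sqrt (\<integral>X. (norm (V X))\<^sup>2 \<partial>?Q)"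
    by (rule integral_Cauchy_Schwarz; use iV in simp)+
  define B where "B X = sqrt (c X) * norm (V X) + m / r * norm (V X)" for X
  have iB: "integrable ?Q B" unfolding B_def[abs_def] using cs1(1) cs2(1) by auto
  have Q1: "Q.prob UNIV = 1" using Q.prob_space by (simp add: space_iid[OF p(1,2)])
  have eB: "(\<integral>X. B X \<partial>?Q) \<le> (sqrt (u \<bullet> (cosens P T \<theta> *v u)) + m / r) * sqrt (real CARD('n) * (h \<bullet> (wass_info P \<Phi> \<theta> *v h)))"
  proof -
    have "(\<integral>X. B X \<partial>?Q) = (\<integral>X. sqrt (c X) * norm (V X) \<partial>?Q) + m / r * (\<integral>X. norm (V X) \<partial>?Q)"
      unfolding B_def using cs1(1) cs2(1) by simp
    also have "\<dots> \<le> sqrt (\<integral>X. c X \<partial>?Q) * sqrt (\<integral>X. (norm (V X))\<^sup>2 \<partial>?Q) + m / r * sqrt (\<integral>X. (norm (V X))\<^sup>2 \<partial>?Q)"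
      using cs1(2) cs2(2) c0 Q1 r m by (intro add_mono mult_left_mono) (auto simp: space_iid[OF p(1,2)])
    finally show ?thesis unfolding ec eV by (simp add: distrib_right)
  qed
  \<comment> \<open>Rademacher's theorem is used on the space of whole samples and transferred to
    the sample law by absolute continuity.\<close>
  have "AE X in lborel. X \<in> (UNIV :: (real^'d^'n) set) \<longrightarrow> T differentiable (at X)"
    by (rule rademacher) (use lip in \<open>auto simp: locally_lipschitz_def\<close>)
  then have "AE X in lborel. T differentiable (at X)" by simp
  then have diff: "AE X in ?Q. T differentiable (at X)"
    by (rule absolutely_continuous_AE[OF _ iid_absolutely_continuous[OF p(1,2,5)], rotated]) simp
  have lipu: "locally_lipschitz (\<lambda>X. u \<bullet> T X)"
    unfolding locally_lipschitz_def
  proof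
    fix X
    obtain e K where eK: "e > 0" "K-lipschitz_on (ball X e) T" using lip unfolding locally_lipschitz_def by blast
    have "(norm u * K)-lipschitz_on (ball X e) (\<lambda>X. u \<bullet> T X)"
    proof (rule lipschitz_onI)
      fix x y assume "x \<in> ball X e" "y \<in> ball X e"
      then have "dist (T x) (T y) \<le> K * dist x y" by (rule lipschitz_onD[OF eK(2)])
      then have "norm u * norm (T x - T y) \<le> norm u * (K * dist x y)" by (intro mult_left_mono) (auto simp: dist_norm)
      then show "dist (u \<bullet> T x) (u \<bullet> T y) \<le> norm u * K * dist x y"
        using Cauchy_Schwarz_ineq2[of u "T x - T y"] by (simp add: dist_real_def inner_diff_right mult.assoc)
    next
      show "0 \<le> norm u * K" using lipschitz_on_nonneg[OF eK(2)] by simp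
    qed
    then show "\<exists>e>0. \<exists>L. L-lipschitz_on (ball X e) (\<lambda>X. u \<bullet> T X)" using eK(1) by blast
  qed
  obtain L where L: "L-lipschitz_on UNIV (truncate r m (\<lambda>X. u \<bullet> T X))"
    using truncate_lipschitz[OF lipu r m] by blast
  let ?F = "truncate r m (\<lambda>X. u \<bullet> T X)"
  have "eventually (\<lambda>t. \<bar>(\<integral>X. ?F X \<partial>iid (P (\<theta> + t *\<^sub>R h))) - (\<integral>X. ?F X \<partial>?Q)\<bar> \<le> ((\<integral>X. B X \<partial>?Q) + \<epsilon>) * \<bar>t\<bar>) (at 0)"
  proof (rule expectation_upper_dini[OF \<Theta> model TL sq(1) L truncate_bounds(1)[OF r m] iB _ \<epsilon>])
    show "AE X in ?Q. \<forall>\<epsilon>>0. eventually (\<lambda>t. \<bar>?F (X + t *\<^sub>R (\<chi> i. \<Phi> \<theta> (X $ i) *v h)) - ?F X\<bar> \<le> (B X + \<epsilon>) * \<bar>t\<bar>) (at 0)"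
      using diff
    proof eventually_elim
      fix X assume X: "T differentiable (at X)"
      show "\<forall>\<epsilon>>0. eventually (\<lambda>t. \<bar>?F (X + t *\<^sub>R (\<chi> i. \<Phi> \<theta> (X $ i) *v h)) - ?F X\<bar> \<le> (B X + \<epsilon>) * \<bar>t\<bar>) (at 0)"
        using truncate_directional_bound[OF X r m, where V = "V X" and u = u]
        unfolding B_def c_def V_def v_def by blast
    qed
  qed
  then show ?thesis
  proof eventually_elim
    fix t
    let ?K = "(sqrt (u \<bullet> (cosens P T \<theta> *v u)) + m / r) * sqrt (real CARD('n) * (h \<bullet> (wass_info P \<Phi> \<theta> *v h)))"
    assume a: "\<bar>(\<integral>X. ?F X \<partial>iid (P (\<theta> + t *\<^sub>R h))) - (\<integral>X. ?F X \<partial>?Q)\<bar> \<le> ((\<integral>X. B X \<partial>?Q) + \<epsilon>) * \<bar>t\<bar>"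
    also have "\<dots> \<le> (?K + \<epsilon>) * \<bar>t\<bar>"
      using eB by (intro mult_right_mono) auto
    finally show "\<bar>(\<integral>X. ?F X \<partial>iid (P (\<theta> + t *\<^sub>R h))) - (\<integral>X. ?F X \<partial>?Q)\<bar> \<le> (?K + \<epsilon>) * \<bar>t\<bar>" .
  qed
qed

section \<open>Passage to the limit and the choice of direction\<close>

text \<open>Stated with \<open>nhds 0\<close> rather than \<open>at 0\<close>, since the estimates
  along a segment include its starting point.\<close>

lemma continuous_on_along_line:
  fixes f :: "'a::real_normed_vector \<Rightarrow> 'b::topological_space"
  assumes "continuous_on \<Theta> f" "open \<Theta>" "\<theta> \<in> \<Theta>"
  shows "((\<lambda>s. f (\<theta> + s *\<^sub>R h)) \<longlongrightarrow> f \<theta>) (nhds 0)"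
proof -
  have "isCont f \<theta>" using assms by (simp add: continuous_on_eq_continuous_at)
  then have f: "(f \<longlongrightarrow> f \<theta>) (nhds \<theta>)" unfolding isCont_def tendsto_at_iff_tendsto_nhds .
  have "((\<lambda>s. \<theta> + s *\<^sub>R h) \<longlongrightarrow> \<theta> + 0 *\<^sub>R h) (nhds 0)" by (intro tendsto_intros) (rule filterlim_ident)
  then have "((\<lambda>s. \<theta> + s *\<^sub>R h) \<longlongrightarrow> \<theta>) (nhds 0)" by simp
  with f show ?thesis by (rule filterlim_compose)
qed

lemma tendsto_quadratic_form:
  fixes A :: "'a \<Rightarrow> real^'k^'k"
  assumes "(A \<longlongrightarrow> A0) F"
  shows "((\<lambda>x. v \<bullet> (A x *v v)) \<longlongrightarrow> v \<bullet> (A0 *v v)) F"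
  using bounded_linear.tendsto[OF bounded_linear_quadratic_form assms] .

text \<open>On a short segment of parameters the slope bound stays within \<delta> of its value at
  \<theta>, so it integrates to a bound on increments. This bound survives the removal of the
  truncation, since only expectations at the two endpoints are involved. The segment is then shrunk
  and \<delta> sent to 0.\<close>

lemma cosensitivity_bilinear:
  fixes P :: "real^'p \<Rightarrow> (real^'d) measure" and T :: "real^'d^'n \<Rightarrow> real^'k"
    and \<Phi> :: "real^'p \<Rightarrow> real^'d \<Rightarrow> real^'p^'d" and chi :: "real^'p \<Rightarrow> real^'k"
  assumes \<Theta>: "open \<Theta>" "\<theta> \<in> \<Theta>" and model: "\<forall>\<theta>\<in>\<Theta>. P2ac (P \<theta>)"
    and DWS: "\<forall>\<theta>\<in>\<Theta>. transport_lin P \<theta> (\<Phi> \<theta>)"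
    and chi_diff: "chi differentiable (at \<theta>)"
    and unbiased: "\<forall>\<theta>\<in>\<Theta>. integrable (iid (P \<theta>)) T \<and> (\<integral>X. T X \<partial>(iid (P \<theta>))) = chi \<theta>"
    and J_cont: "continuous_on \<Theta> (wass_info P \<Phi>)"
    and J_inv: "\<forall>\<theta>\<in>\<Theta>. invertible (wass_info P \<Phi> \<theta>)"
    and cosI: "\<forall>\<theta>\<in>\<Theta>. integrable (iid (P \<theta>)) (cos_integrand T)"
    and Cos_cont: "continuous_on \<Theta> (cosens P T)"
    and lip: "locally_lipschitz T"
  shows "\<bar>h \<bullet> (jac chi \<theta> *v u)\<bar> \<le> sqrt (u \<bullet> (cosens P T \<theta> *v u)) * sqrt (real CARD('n) * (h \<bullet> (wass_info P \<Phi> \<theta> *v h)))"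
proof -
  define c where "c s = sqrt (u \<bullet> (cosens P T (\<theta> + s *\<^sub>R h) *v u))" for s
  define j where "j s = sqrt (real CARD('n) * (h \<bullet> (wass_info P \<Phi> (\<theta> + s *\<^sub>R h) *v h)))" for s
  have clim: "(c \<longlongrightarrow> c 0) (nhds 0)" unfolding c_def
    using continuous_on_along_line[OF Cos_cont \<Theta>, of h] by (auto intro!: tendsto_real_sqrt tendsto_quadratic_form)
  have jlim: "(j \<longlongrightarrow> j 0) (nhds 0)" unfolding j_def
    using continuous_on_along_line[OF J_cont \<Theta>, of h] by (auto intro!: tendsto_real_sqrt tendsto_mult tendsto_const tendsto_quadratic_form)
  have j0: "j s \<ge> 0" if "\<theta> + s *\<^sub>R h \<in> \<Theta>" for s
    using wass_info_quad(2)[OF J_inv[rule_format, OF that], of h] by (simp add: j_def)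
  \<comment> \<open>Height k+1 over radius (k+1)^2 makes the extra slope 1/(k+1).\<close>
  define \<rho> where "\<rho> k = (real (Suc k))\<^sup>2" for k
  define F where "F k = truncate (\<rho> k) (real (Suc k)) (\<lambda>X. u \<bullet> T X)" for k
  have \<rho>: "\<rho> k > 0" for k by (simp add: \<rho>_def)
  have quot: "real (Suc k) / \<rho> k = 1 / real (Suc k)" for k by (simp add: \<rho>_def power2_eq_square)
  have mtop: "filterlim (\<lambda>k. real (Suc k)) at_top sequentially"
    by (rule filterlim_compose[OF filterlim_real_sequentially filterlim_Suc])
  have \<rho>top: "filterlim \<rho> at_top sequentially" unfolding \<rho>_def
    by (rule filterlim_pow_at_top[OF _ mtop]) simp
  \<comment> \<open>Unbiasedness enters here: truncation never increases absolute values, so |u . T|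
    dominates and the expectations converge to u . chi.\<close>
  have Flim: "(\<lambda>k. \<integral>X. F k X \<partial>iid (P \<theta>')) \<longlonglongrightarrow> u \<bullet> chi \<theta>'" if \<theta>': "\<theta>' \<in> \<Theta>" for \<theta>'
  proof -
    let ?Q = "iid (P \<theta>') :: (real^'d^'n) measure"
    note p = P2acD[OF model[rule_format, OF \<theta>']]
    note [simp, measurable_cong] = sets_iid[OF p(1,2)]
    have iT: "integrable ?Q T" and eT: "(\<integral>X. T X \<partial>?Q) = chi \<theta>'" using unbiased \<theta>' by auto
    have Fm: "F k \<in> borel_measurable ?Q" for k
    proof -
      have "T \<in> borel_measurable ?Q" using iT by auto
      then show ?thesis unfolding F_def truncate_def[abs_def] tent_def clamp_real_def by measurable
    qed
    have "(\<lambda>k. \<integral>X. F k X \<partial>?Q) \<longlonglongrightarrow> (\<integral>X. u \<bullet> T X \<partial>?Q)"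
    proof (rule integral_dominated_convergence[where w = "\<lambda>X. \<bar>u \<bullet> T X\<bar>"])
      show "integrable ?Q (\<lambda>X. \<bar>u \<bullet> T X\<bar>)" using iT by (intro integrable_abs integrable_inner_right) auto
      show "AE X in ?Q. (\<lambda>k. F k X) \<longlonglongrightarrow> u \<bullet> T X"
        unfolding F_def using truncate_tendsto[OF \<rho>top mtop, of "\<lambda>X. u \<bullet> T X"] by simp
      show "AE X in ?Q. norm (F k X) \<le> \<bar>u \<bullet> T X\<bar>" for k
        unfolding F_def using truncate_bounds(2)[OF \<rho>, of "real (Suc k)" k "\<lambda>X. u \<bullet> T X"] by simp
      show "(\<lambda>X. u \<bullet> T X) \<in> borel_measurable ?Q" using iT by auto
    qed (rule Fm)
    also have "(\<integral>X. u \<bullet> T X \<partial>?Q) = u \<bullet> chi \<theta>'" using iT eT by simp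
    finally show ?thesis .
  qed
  have chi_le: "\<exists>d>0. \<forall>s. 0 < s \<longrightarrow> s < d \<longrightarrow> \<bar>u \<bullet> chi (\<theta> + s *\<^sub>R h) - u \<bullet> chi \<theta>\<bar> \<le> (c 0 * j 0 + \<delta>) * s" if \<delta>: "\<delta> > 0" for \<delta>
  proof -
    have "((\<lambda>s. c s * j s) \<longlongrightarrow> c 0 * j 0) (nhds 0)" by (intro tendsto_intros clim jlim)
    then have "eventually (\<lambda>s. c s * j s < c 0 * j 0 + \<delta>) (nhds 0)" using \<delta> by (intro order_tendstoD(2)) auto
    \<comment> \<open>The cut-off error is j divided by k+1, so a bound on j along the segment makes
      it vanish uniformly there.\<close>
    moreover have "eventually (\<lambda>s. j s < j 0 + 1) (nhds 0)" using jlim by (intro order_tendstoD(2)) auto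
    moreover have "eventually (\<lambda>s. \<theta> + s *\<^sub>R h \<in> \<Theta>) (nhds 0)"
    proof -
      have "((\<lambda>s. \<theta> + s *\<^sub>R h) \<longlongrightarrow> \<theta>) (nhds 0)" using continuous_on_along_line[OF continuous_on_id \<Theta>] by simp
      then show ?thesis using \<Theta> by (rule topological_tendstoD)
    qed
    ultimately have "eventually (\<lambda>s. c s * j s < c 0 * j 0 + \<delta> \<and> j s < j 0 + 1 \<and> \<theta> + s *\<^sub>R h \<in> \<Theta>) (nhds 0)" by eventually_elim simp
    then obtain d where d: "d > 0" "\<And>s. \<bar>s\<bar> < d \<Longrightarrow> c s * j s < c 0 * j 0 + \<delta> \<and> j s < j 0 + 1 \<and> \<theta> + s *\<^sub>R h \<in> \<Theta>"
      unfolding eventually_nhds_metric by (auto simp: dist_real_def)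
    have "\<bar>u \<bullet> chi (\<theta> + s *\<^sub>R h) - u \<bullet> chi \<theta>\<bar> \<le> (c 0 * j 0 + \<delta>) * s" if s: "0 < s" "s < d" for s
    proof -
      define g where "g k \<tau> = (\<integral>X. F k X \<partial>iid (P (\<theta> + \<tau> *\<^sub>R h)))" for k \<tau>
      \<comment> \<open>The length s is fixed independently of k, which is what allows k to tend to
        infinity afterwards.\<close>
      have gle: "\<bar>g k s - g k 0\<bar> \<le> (c 0 * j 0 + \<delta> + 1 / real (Suc k) * (j 0 + 1)) * s" for k
      proof (rule dini_bound)
        fix \<tau> \<epsilon> :: real assume \<tau>: "0 \<le> \<tau>" "\<tau> \<le> s" and \<epsilon>: "\<epsilon> > 0"
        then have \<tau>d: "c \<tau> * j \<tau> < c 0 * j 0 + \<delta>" "j \<tau> < j 0 + 1" "\<theta> + \<tau> *\<^sub>R h \<in> \<Theta>" using d(2)[of \<tau>] s by auto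
        have "eventually (\<lambda>t. \<bar>(\<integral>X. F k X \<partial>iid (P (\<theta> + \<tau> *\<^sub>R h + t *\<^sub>R h))) - (\<integral>X. F k X \<partial>iid (P (\<theta> + \<tau> *\<^sub>R h)))\<bar>
            \<le> ((c \<tau> + real (Suc k) / \<rho> k) * j \<tau> + \<epsilon>) * \<bar>t\<bar>) (at 0)"
          unfolding F_def c_def j_def
          by (rule truncated_estimator_upper_dini[OF \<Theta>(1) \<tau>d(3) model]) (use DWS J_inv cosI lip \<rho> \<epsilon> \<tau>d(3) in auto)
        then show "eventually (\<lambda>t. \<bar>g k (\<tau> + t) - g k \<tau>\<bar> \<le> (c 0 * j 0 + \<delta> + 1 / real (Suc k) * (j 0 + 1) + \<epsilon>) * \<bar>t\<bar>) (at 0)"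
        proof eventually_elim
          fix t
          assume a: "\<bar>(\<integral>X. F k X \<partial>iid (P (\<theta> + \<tau> *\<^sub>R h + t *\<^sub>R h))) - (\<integral>X. F k X \<partial>iid (P (\<theta> + \<tau> *\<^sub>R h)))\<bar>
            \<le> ((c \<tau> + real (Suc k) / \<rho> k) * j \<tau> + \<epsilon>) * \<bar>t\<bar>"
          have "1 / real (Suc k) * j \<tau> \<le> 1 / real (Suc k) * (j 0 + 1)" using \<tau>d(2) by (intro mult_left_mono) auto
          then have "(c \<tau> + real (Suc k) / \<rho> k) * j \<tau> + \<epsilon> \<le> c 0 * j 0 + \<delta> + 1 / real (Suc k) * (j 0 + 1) + \<epsilon>"
            using \<tau>d(1) unfolding quot distrib_right by linarith
          then have "((c \<tau> + real (Suc k) / \<rho> k) * j \<tau> + \<epsilon>) * \<bar>t\<bar> \<le> (c 0 * j 0 + \<delta> + 1 / real (Suc k) * (j 0 + 1) + \<epsilon>) * \<bar>t\<bar>"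
            by (intro mult_right_mono) auto
          with a show "\<bar>g k (\<tau> + t) - g k \<tau>\<bar> \<le> (c 0 * j 0 + \<delta> + 1 / real (Suc k) * (j 0 + 1) + \<epsilon>) * \<bar>t\<bar>"
            unfolding g_def by (simp add: scaleR_add_left add.assoc)
        qed
      qed (use s in simp)
      have l0: "(\<lambda>k. 1 / real (Suc k)) \<longlonglongrightarrow> 0" using LIMSEQ_inverse_real_of_nat by (simp add: inverse_eq_divide)
      have in\<Theta>: "\<theta> + s *\<^sub>R h \<in> \<Theta>" using d(2)[of s] s by simp
      have "(\<lambda>k. \<bar>g k s - g k 0\<bar>) \<longlonglongrightarrow> \<bar>u \<bullet> chi (\<theta> + s *\<^sub>R h) - u \<bullet> chi \<theta>\<bar>"
        unfolding g_def using Flim[OF in\<Theta>] Flim[OF \<Theta>(2)] by (intro tendsto_intros) simp_all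
      moreover have "(\<lambda>k. (c 0 * j 0 + \<delta> + 1 / real (Suc k) * (j 0 + 1)) * s) \<longlonglongrightarrow> (c 0 * j 0 + \<delta> + 0 * (j 0 + 1)) * s"
        by (intro tendsto_intros l0)
      ultimately have "\<bar>u \<bullet> chi (\<theta> + s *\<^sub>R h) - u \<bullet> chi \<theta>\<bar> \<le> (c 0 * j 0 + \<delta> + 0 * (j 0 + 1)) * s"
        by (rule LIMSEQ_le) (use gle in blast)
      then show ?thesis by simp
    qed
    then show ?thesis using d(1) by blast
  qed
  let ?D = "frechet_derivative chi (at \<theta>)"
  have "(chi has_derivative ?D) (at \<theta>)" using chi_diff frechet_derivative_works by blast
  then have "((\<lambda>x. u \<bullet> chi x) has_derivative (\<lambda>h. u \<bullet> ?D h)) (at \<theta>)" by (rule has_derivative_inner_right)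
  then have "has_dir_deriv (\<lambda>x. u \<bullet> chi x) h \<theta> (u \<bullet> ?D h)" by (rule has_derivative_has_dir_deriv)
  \<comment> \<open>Increments were bounded for s > 0 only; the limit from the right already
    determines the derivative, as chi is differentiable.\<close>
  then have "((\<lambda>s. (u \<bullet> chi (\<theta> + s *\<^sub>R h) - u \<bullet> chi \<theta>) / s) \<longlongrightarrow> u \<bullet> ?D h) (at_right 0)"
    unfolding has_dir_deriv_def by (rule tendsto_mono[rotated]) (simp add: at_le)
  then have lim: "((\<lambda>s. \<bar>(u \<bullet> chi (\<theta> + s *\<^sub>R h) - u \<bullet> chi \<theta>) / s\<bar>) \<longlongrightarrow> \<bar>u \<bullet> ?D h\<bar>) (at_right 0)" by (rule tendsto_rabs)
  have "\<bar>u \<bullet> ?D h\<bar> \<le> c 0 * j 0"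
  proof (rule field_le_epsilon)
    fix \<delta> :: real assume "\<delta> > 0"
    then obtain d where d: "d > 0" "\<And>s. 0 < s \<Longrightarrow> s < d \<Longrightarrow> \<bar>u \<bullet> chi (\<theta> + s *\<^sub>R h) - u \<bullet> chi \<theta>\<bar> \<le> (c 0 * j 0 + \<delta>) * s"
      using chi_le by blast
    show "\<bar>u \<bullet> ?D h\<bar> \<le> c 0 * j 0 + \<delta>"
    proof (rule tendsto_upperbound[OF lim])
      show "\<forall>\<^sub>F s in at_right 0. \<bar>(u \<bullet> chi (\<theta> + s *\<^sub>R h) - u \<bullet> chi \<theta>) / s\<bar> \<le> c 0 * j 0 + \<delta>"
        unfolding eventually_at_right_field using d by (intro exI[of _ d]) (auto simp: abs_divide divide_le_eq)
    qed simp
  qed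
  then show ?thesis unfolding inner_jac[OF chi_diff] by (simp add: c_def j_def)
qed

theorem theorem4p8:
  fixes \<Theta> :: "(real^'p) set"
    and P :: "real^'p \<Rightarrow> (real^'d) measure"
    and \<Phi> :: "real^'p \<Rightarrow> real^'d \<Rightarrow> real^'p^'d"
    and chi :: "real^'p \<Rightarrow> real^'k"
    and T :: "real^'d^'n \<Rightarrow> real^'k"
  assumes open_\<Theta>: "open \<Theta>"
    and model: "\<forall>\<theta>\<in>\<Theta>. P2ac (P \<theta>)"
    and DWS: "\<forall>\<theta>\<in>\<Theta>. transport_lin P \<theta> (\<Phi> \<theta>)"
    and chi_diff: "\<forall>\<theta>\<in>\<Theta>. chi differentiable (at \<theta>)"
    and unbiased: "\<forall>\<theta>\<in>\<Theta>. integrable (iid (P \<theta>)) T \<and> (\<integral>X. T X \<partial>(iid (P \<theta>))) = chi \<theta>"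
    and J_cont: "continuous_on \<Theta> (wass_info P \<Phi>)"
    and J_inv: "\<forall>\<theta>\<in>\<Theta>. invertible (wass_info P \<Phi> \<theta>)"
    and Dchi_cont: "continuous_on \<Theta> (jac chi)"
    and Dchi_inj: "\<forall>\<theta>\<in>\<Theta>. inj (\<lambda>v. jac chi \<theta> *v v)"
    and Cos_def: "\<forall>\<theta>\<in>\<Theta>. integrable (iid (P \<theta>)) (cos_integrand T)"
    and Cos_cont: "continuous_on \<Theta> (cosens P T)"
    and T_lip: "locally_lipschitz T"
    and loc_int: "\<forall>\<theta>\<in>\<Theta>. \<exists>U. open U \<and> \<theta> \<in> U \<and> U \<subseteq> \<Theta> \<and>
        (\<forall>i. (\<integral>\<^sup>+\<theta>'. indicator U \<theta>' * (\<integral>\<^sup>+X. ennreal ((norm (partial_jac T i X))\<^sup>2) \<partial>(iid (P \<theta>'))) \<partial>lborel) < \<infinity>)"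
  shows "\<forall>\<theta>\<in>\<Theta>. psd_ge (cosens P T \<theta>)
           ((1 / real CARD('n)) *\<^sub>R (transpose (jac chi \<theta>) ** matrix_inv (wass_info P \<Phi> \<theta>) ** jac chi \<theta>))"
proof
  fix \<theta> assume \<theta>: "\<theta> \<in> \<Theta>"
  let ?C = "cosens P T \<theta>" and ?J = "wass_info P \<Phi> \<theta>" and ?D = "jac chi \<theta>"
  let ?N = "real CARD('n)"
  show "psd_ge ?C ((1 / ?N) *\<^sub>R (transpose ?D ** matrix_inv ?J ** ?D))"
    unfolding psd_ge_def
  proof
    fix u
    \<comment> \<open>With J h = D u, the left side of the bilinear bound and the form h . J h are
      both equal to q, so the bound becomes an inequality in q alone.\<close>
    define h where "h = matrix_inv ?J *v (?D *v u)"
    define q where "q = h \<bullet> (?D *v u)"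
    have "\<exists>B. ?J ** B = mat 1 \<and> B ** ?J = mat 1" using J_inv \<theta> unfolding invertible_def by blast
    then have "?J ** matrix_inv ?J = mat 1" unfolding matrix_inv_def by (rule someI2_ex) blast
    then have Jh: "?J *v h = ?D *v u" unfolding h_def by (metis matrix_vector_mul_assoc matrix_vector_mul_lid)
    have c0: "0 \<le> u \<bullet> (?C *v u)"
      unfolding cosens_def integral_quadratic_form(2)[OF Cos_def[rule_format, OF \<theta>]]
      by (rule Bochner_Integration.integral_nonneg) (simp add: cos_integrand_quad sum_nonneg)
    have q0: "0 \<le> q" unfolding q_def Jh[symmetric] using wass_info_quad(2)[OF J_inv[rule_format, OF \<theta>], of h] by simp
    have "\<bar>q\<bar> \<le> sqrt (u \<bullet> (?C *v u)) * sqrt (?N * q)"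
      using cosensitivity_bilinear[OF open_\<Theta> \<theta> model DWS chi_diff[rule_format, OF \<theta>] unbiased J_cont J_inv Cos_def Cos_cont T_lip, of h u]
      by (simp add: q_def Jh)
    then have "\<bar>q\<bar> \<le> sqrt (u \<bullet> (?C *v u) * (?N * q))" by (simp add: real_sqrt_mult)
    then have "q\<^sup>2 \<le> u \<bullet> (?C *v u) * (?N * q)"
      using c0 q0 by (metis abs_ge_zero mult_nonneg_nonneg of_nat_0_le_iff power2_abs power_mono real_sqrt_pow2)
    then have "q * q \<le> (?N * (u \<bullet> (?C *v u))) * q" by (simp add: power2_eq_square ac_simps)
    \<comment> \<open>One factor q cancels if it is positive; for q = 0 the claim is the
      nonnegativity of the cosensitivity form.\<close>
    then have "q \<le> ?N * (u \<bullet> (?C *v u))"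
      using q0 c0 by (cases "q = 0") (simp_all add: mult_le_cancel_right)
    then have "q / ?N \<le> u \<bullet> (?C *v u)" by (simp add: divide_le_eq mult.commute)
    moreover have "u \<bullet> (((1 / ?N) *\<^sub>R (transpose ?D ** matrix_inv ?J ** ?D)) *v u) = q / ?N"
    proof -
      have "u \<bullet> (transpose ?D *v h) = q" unfolding q_def by (metis dot_lmul_matrix inner_commute transpose_matrix_vector)
      then show ?thesis by (simp add: scaleR_matrix_vector_assoc[symmetric] matrix_vector_mul_assoc[symmetric] h_def del: transpose_matrix_vector)
    qed
    ultimately show "0 \<le> u \<bullet> ((?C - (1 / ?N) *\<^sub>R (transpose ?D ** matrix_inv ?J ** ?D)) *v u)"
      by (simp add: matrix_vector_mult_diff_rdistrib inner_diff_right)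
  qed
qed

end
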